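(* Let $(\Lambda_A,E_A)$ be an affine Jacobi structure on an affine bundle $\pi:A\to M$ of rank $n>0$, with Jacobi bracket $\{\cdot,\cdot\}_{(\Lambda_A,E_A)}$. Then the bracket $[\![\cdot,\cdot]\!]^+:\Gamma(A^+)\times\Gamma(A^+)\to\Gamma(A^+)$ and the map $\rho^+:\Gamma(A^+)\to\mathfrak{X}(M)$ given by $$[\![\tilde a,\tilde b]\!]^+=\widetilde{\{a,b\}_{(\Lambda_A,E_A)}},\qquad \rho^+(\tilde a)(f_M)\circ\pi=\{a,f_M\circ\pi\}_{(\Lambda_A,E_A)}-(f_M\circ\pi)\{a,1\}_{(\Lambda_A,E_A)},$$ for all affine functions $a,b:A\to\mathbb{R}$ and all $f_M\in C^\infty(M,\mathbb{R})$, define a Lie algebroid structure on the vector bundle $A^+\to M$.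
   Context: Everything is smooth. A Jacobi structure on a manifold $N$ is a pair $(\Lambda,E)$ of a bivector field and a vector field such that the Jacobi bracket $\{f,g\}_{(\Lambda,E)}=\Lambda(df,dg)+fE(g)-gE(f)$ on $C^\infty(N,\mathbb{R})$ satisfies the Jacobi identity. An affine bundle $\pi:A\to M$ is a locally trivial bundle whose fibres $A_p$ are affine spaces modelled on the fibres of a vector bundle $V(A)\to M$, with affine transition maps. A function $A\to\mathbb{R}$ is affine if it is smooth and its restriction to every fibre is an affine function. A Jacobi structure on $A$ is affine if the Jacobi bracket of two affine functions is an affine function. $A^+=\bigcup_{p\in M}\mathrm{Aff}(A_p,\mathbb{R})\to M$ is the vector bundle (of rank $n+1$) whose fibre at $p$ is the space of affine functions $A_p\to\mathbb{R}$. Sections of $A^+$ correspond bijectively to affine functions on $A$; $\tilde a\in\Gamma(A^+)$ denotes the section corresponding to the affine function $a:A\to\mathbb{R}$. A Lie algebroid structure on a vector bundle $V\to M$ is a Lie bracket $[\![\cdot,\cdot]\!]$ on $\Gamma(V)$ together with a vector bundle morphism $\rho:V\to TM$ (the anchor; also viewed as a map on sections) such that $[\![X,fY]\!]=f[\![X,Y]\!]+\rho(X)(f)Y$ for all $X,Y\in\Gamma(V)$, $f\in C^\infty(M,\mathbb{R})$. *)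

theory Defs
  imports "HOL-Analysis.Analysis"
begin

section \<open>Smooth maps between open subsets of finite-dimensional spaces\<close>

text \<open>For open \<open>S\<close> in a finite-dimensional space these are the usual \<open>C\<^sup>k\<close> and
  \<open>C\<^sup>\<infinity>\<close> functions; only the values on \<open>S\<close> matter.\<close>

fun Ck_on :: "nat \<Rightarrow> 'a::real_normed_vector set \<Rightarrow> ('a \<Rightarrow> 'b::real_normed_vector) \<Rightarrow> bool" where
  "Ck_on 0 S f \<longleftrightarrow> continuous_on S f"
| "Ck_on (Suc k) S f \<longleftrightarrow>
     (\<forall>x\<in>S. f differentiable (at x)) \<and> (\<forall>v. Ck_on k S (\<lambda>x. frechet_derivative f (at x) v))"

definition smooth_on :: "'a::real_normed_vector set \<Rightarrow> ('a \<Rightarrow> 'b::real_normed_vector) \<Rightarrow> bool" where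
  "smooth_on S f \<longleftrightarrow> (\<forall>k. Ck_on k S f)"


section \<open>Smooth manifolds\<close>

text \<open>A manifold is given by a (not necessarily maximal) atlas; its underlying set is the union
  of the chart domains and its topology is the one induced by the charts. The model space \<open>'e\<close>
  is a finite-dimensional inner product space. The class \<open>real_inner\<close> is used instead of
  \<open>euclidean_space\<close> because the latter excludes dimension 0.\<close>

type_synonym ('m, 'e) chart = "'m set \<times> ('m \<Rightarrow> 'e)"
type_synonym ('m, 'e) atlas = "('m, 'e) chart set"

definition points :: "('m, 'e) atlas \<Rightarrow> 'm set" where
  "points N = (\<Union>c\<in>N. fst c)"

definition atlas_open :: "('m, 'e::real_inner) atlas \<Rightarrow> 'm set \<Rightarrow> bool" where
  "atlas_open N W \<longleftrightarrow> W \<subseteq> points N \<and> (\<forall>(U, \<phi>)\<in>N. open (\<phi> ` (W \<inter> U)))"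

definition atlas_topology :: "('m, 'e::real_inner) atlas \<Rightarrow> 'm topology" where
  "atlas_topology N = topology (atlas_open N)"

lemma istopology_atlas_open:
  assumes "\<And>U \<phi>. (U, \<phi>) \<in> N \<Longrightarrow> inj_on \<phi> U"
  shows "istopology (atlas_open N)"
  unfolding istopology_def
proof (intro conjI allI impI)
  fix S T assume S: "atlas_open N S" and T: "atlas_open N T"
  have "open (\<phi> ` (S \<inter> T \<inter> U))" if c: "(U, \<phi>) \<in> N" for U \<phi>
  proof -
    have "\<phi> ` (S \<inter> T \<inter> U) = \<phi> ` (S \<inter> U) \<inter> \<phi> ` (T \<inter> U)"
      using inj_on_image_Int[OF assms[OF c], of "S \<inter> U" "T \<inter> U"]
      by (simp add: Int_ac)
    with S T c show ?thesis by (auto simp: atlas_open_def)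
  qed
  with S show "atlas_open N (S \<inter> T)" by (auto simp: atlas_open_def)
next
  fix K assume K: "\<forall>S\<in>K. atlas_open N S"
  have "open (\<phi> ` (\<Union>K \<inter> U))" if c: "(U, \<phi>) \<in> N" for U \<phi>
  proof -
    have "\<phi> ` (\<Union>K \<inter> U) = (\<Union>S\<in>K. \<phi> ` (S \<inter> U))" by auto
    moreover have "open (\<phi> ` (S \<inter> U))" if "S \<in> K" for S
      using K c that by (auto simp: atlas_open_def)
    ultimately show ?thesis by (auto intro!: open_UN)
  qed
  with K show "atlas_open N (\<Union>K)" by (auto simp: atlas_open_def)
qed

abbreviation chart_inv :: "('m, 'e) chart \<Rightarrow> 'e \<Rightarrow> 'm" where
  "chart_inv c \<equiv> inv_into (fst c) (snd c)"

definition finite_dimensional :: "'e::real_vector itself \<Rightarrow> bool" where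
  "finite_dimensional _ \<longleftrightarrow> (\<exists>B::'e set. finite B \<and> span B = UNIV)"

definition smooth_manifold :: "('m, 'e::real_inner) atlas \<Rightarrow> bool" where
  "smooth_manifold N \<longleftrightarrow>
     finite_dimensional TYPE('e) \<and>
     (\<forall>(U, \<phi>)\<in>N. inj_on \<phi> U \<and> open (\<phi> ` U)) \<and>
     (\<forall>(U, \<phi>)\<in>N. \<forall>(V, \<psi>)\<in>N.
        open (\<phi> ` (U \<inter> V)) \<and> smooth_on (\<phi> ` (U \<inter> V)) (\<psi> \<circ> inv_into U \<phi>)) \<and>
     Hausdorff_space (atlas_topology N) \<and> second_countable (atlas_topology N)"

definition euclid :: "('e, 'e) atlas" where
  "euclid = {(UNIV, id)}"

definition restrict_atlas :: "('m, 'e) atlas \<Rightarrow> 'm set \<Rightarrow> ('m, 'e) atlas" where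
  "restrict_atlas N W = (\<lambda>(U, \<phi>). (U \<inter> W, \<phi>)) ` N"

definition prod_atlas :: "('m, 'e) atlas \<Rightarrow> ('n, 'g) atlas \<Rightarrow> ('m \<times> 'n, 'e \<times> 'g) atlas" where
  "prod_atlas N P = {(U \<times> V, map_prod \<phi> \<psi>) |U \<phi> V \<psi>. (U, \<phi>) \<in> N \<and> (V, \<psi>) \<in> P}"

definition smooth_map ::
  "('m, 'e::real_inner) atlas \<Rightarrow> ('n, 'g::real_inner) atlas \<Rightarrow> ('m \<Rightarrow> 'n) \<Rightarrow> bool" where
  "smooth_map N P F \<longleftrightarrow>
     continuous_map (atlas_topology N) (atlas_topology P) F \<and>
     (\<forall>(U, \<phi>)\<in>N. \<forall>(V, \<psi>)\<in>P. smooth_on (\<phi> ` (U \<inter> F -` V)) (\<psi> \<circ> F \<circ> inv_into U \<phi>))"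

text \<open>Elements of \<open>smooth_functions N\<close> are unconstrained outside \<open>points N\<close>; all statements
  about their values below are restricted to \<open>points N\<close>.\<close>

definition smooth_functions :: "('m, 'e::real_inner) atlas \<Rightarrow> ('m \<Rightarrow> real) set" where
  "smooth_functions N = {f. smooth_map N euclid f}"


section \<open>Fibre, vector and affine bundles\<close>

text \<open>A locally trivial bundle is given by a bundle atlas: a pair \<open>(W, \<Phi>)\<close> in \<open>trivs\<close> stands
  for the local trivialization \<open>x \<mapsto> (proj x, \<Phi> x)\<close> of the part over \<open>W\<close> onto \<open>W \<times> 'f\<close>.\<close>

record ('x, 'm, 'f) fibre_bundle =
  total_space :: "'x set"
  proj :: "'x \<Rightarrow> 'm"
  trivs :: "('m set \<times> ('x \<Rightarrow> 'f)) set"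

definition fibre :: "('x, 'm, 'f, 'z) fibre_bundle_scheme \<Rightarrow> 'm \<Rightarrow> 'x set" where
  "fibre B p = {x \<in> total_space B. proj B x = p}"

definition is_fibre_bundle ::
  "('m, 'e::real_inner) atlas \<Rightarrow> ('x, 'm, 'f::real_inner, 'z) fibre_bundle_scheme \<Rightarrow> bool" where
  "is_fibre_bundle M B \<longleftrightarrow>
     smooth_manifold M \<and> finite_dimensional TYPE('f) \<and>
     proj B ` total_space B \<subseteq> points M \<and>
     points M = (\<Union>t\<in>trivs B. fst t) \<and>
     (\<forall>(W, \<Phi>)\<in>trivs B.
        openin (atlas_topology M) W \<and> (\<forall>p\<in>W. bij_betw \<Phi> (fibre B p) UNIV)) \<and>
     (\<forall>(W, \<Phi>)\<in>trivs B. \<forall>(W', \<Phi>')\<in>trivs B.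
        smooth_map (prod_atlas (restrict_atlas M (W \<inter> W')) euclid) euclid
          (\<lambda>(p, y). \<Phi>' (inv_into (fibre B p) \<Phi> y)))"

text \<open>The manifold structure of the total space.\<close>

definition total_atlas ::
  "('m, 'e) atlas \<Rightarrow> ('x, 'm, 'f, 'z) fibre_bundle_scheme \<Rightarrow> ('x, 'e \<times> 'f) atlas" where
  "total_atlas M B =
     {({x \<in> total_space B. proj B x \<in> U \<inter> W}, \<lambda>x. (\<phi> (proj B x), \<Phi> x)) |U \<phi> W \<Phi>.
        (U, \<phi>) \<in> M \<and> (W, \<Phi>) \<in> trivs B}"

record ('x, 'm, 'f) vector_bundle = "('x, 'm, 'f) fibre_bundle" +
  vadd :: "'x \<Rightarrow> 'x \<Rightarrow> 'x"
  vscale :: "real \<Rightarrow> 'x \<Rightarrow> 'x"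

text \<open>The vector space axioms in the fibres hold automatically, because each trivialization is,
  fibre by fibre, a bijection onto \<open>'f\<close> that respects both operations.\<close>

definition is_vector_bundle ::
  "('m, 'e::real_inner) atlas \<Rightarrow> ('x, 'm, 'f::real_inner, 'z) vector_bundle_scheme \<Rightarrow> bool" where
  "is_vector_bundle M V \<longleftrightarrow>
     is_fibre_bundle M V \<and>
     (\<forall>p\<in>points M. \<forall>v\<in>fibre V p.
        (\<forall>w\<in>fibre V p. vadd V v w \<in> fibre V p) \<and> (\<forall>r. vscale V r v \<in> fibre V p)) \<and>
     (\<forall>(W, \<Psi>)\<in>trivs V. \<forall>p\<in>W. \<forall>v\<in>fibre V p.
        (\<forall>w\<in>fibre V p. \<Psi> (vadd V v w) = \<Psi> v + \<Psi> w) \<and> (\<forall>r. \<Psi> (vscale V r v) = r *\<^sub>R \<Psi> v))"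

text \<open>\<open>model A\<close> is the vector bundle \<open>V(A)\<close>, and \<open>translate A x v\<close> is \<open>x + v\<close>
  for \<open>x \<in> A\<^sub>p\<close> and \<open>v \<in> V(A)\<^sub>p\<close>.\<close>

record ('x, 'm, 'f, 'v) affine_bundle = "('x, 'm, 'f) fibre_bundle" +
  model :: "('v, 'm, 'f) vector_bundle"
  translate :: "'x \<Rightarrow> 'v \<Rightarrow> 'x"

text \<open>In the last condition \<open>\<Psi>\<close> is the linear part of \<open>\<Phi>\<close>; adding \<open>(W, \<Psi>)\<close> to the bundle atlas
  of \<open>V(A)\<close> again yields a vector bundle exactly when \<open>\<Psi>\<close> is a smooth local trivialization
  of \<open>V(A)\<close>.\<close>

definition is_affine_bundle ::
  "('m, 'e::real_inner) atlas \<Rightarrow> ('x, 'm, 'f::real_inner, 'v) affine_bundle \<Rightarrow> bool" where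
  "is_affine_bundle M A \<longleftrightarrow>
     is_fibre_bundle M A \<and> is_vector_bundle M (model A) \<and>
     (\<forall>p\<in>points M. \<forall>x\<in>fibre A p.
        (\<forall>v\<in>fibre (model A) p. translate A x v \<in> fibre A p) \<and>
        (\<forall>v\<in>fibre (model A) p. \<forall>w\<in>fibre (model A) p.
           translate A (translate A x v) w = translate A x (vadd (model A) v w)) \<and>
        (\<forall>y\<in>fibre A p. \<exists>!v. v \<in> fibre (model A) p \<and> translate A x v = y)) \<and>
     (\<forall>(W, \<Phi>)\<in>trivs A. \<exists>\<Psi>.
        is_vector_bundle M ((model A)\<lparr>trivs := insert (W, \<Psi>) (trivs (model A))\<rparr>) \<and>
        (\<forall>p\<in>W. \<forall>x\<in>fibre A p. \<forall>v\<in>fibre (model A) p. \<Phi> (translate A x v) = \<Phi> x + \<Psi> v))"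


section \<open>Sections and vector bundle morphisms\<close>

text \<open>Sections take the value \<open>undefined\<close> outside \<open>points M\<close>, so that equality of sections is
  equality of functions.\<close>

definition sections ::
  "('m, 'e::real_inner) atlas \<Rightarrow> ('x, 'm, 'f::real_inner, 'z) fibre_bundle_scheme \<Rightarrow> ('m \<Rightarrow> 'x) set"
  where
  "sections M B = {s \<in> extensional (points M).
     smooth_map M (total_atlas M B) s \<and> (\<forall>p\<in>points M. proj B (s p) = p)}"

definition sec_add ::
  "('m, 'e) atlas \<Rightarrow> ('x, 'm, 'f, 'z) vector_bundle_scheme \<Rightarrow> ('m \<Rightarrow> 'x) \<Rightarrow> ('m \<Rightarrow> 'x) \<Rightarrow> 'm \<Rightarrow> 'x"
  where "sec_add M V s t = (\<lambda>p\<in>points M. vadd V (s p) (t p))"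

definition sec_mult ::
  "('m, 'e) atlas \<Rightarrow> ('x, 'm, 'f, 'z) vector_bundle_scheme \<Rightarrow> ('m \<Rightarrow> real) \<Rightarrow> ('m \<Rightarrow> 'x) \<Rightarrow> 'm \<Rightarrow> 'x"
  where "sec_mult M V f s = (\<lambda>p\<in>points M. vscale V (f p) (s p))"

definition vector_bundle_morphism ::
  "('m, 'e::real_inner) atlas \<Rightarrow> ('x, 'm, 'f::real_inner, 'z) vector_bundle_scheme \<Rightarrow>
   ('y, 'm, 'g::real_inner, 'w) vector_bundle_scheme \<Rightarrow> ('x \<Rightarrow> 'y) \<Rightarrow> bool" where
  "vector_bundle_morphism M V V' \<rho> \<longleftrightarrow>
     smooth_map (total_atlas M V) (total_atlas M V') \<rho> \<and>
     (\<forall>v\<in>total_space V. proj V' (\<rho> v) = proj V v) \<and>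
     (\<forall>p\<in>points M. \<forall>v\<in>fibre V p.
        (\<forall>w\<in>fibre V p. \<rho> (vadd V v w) = vadd V' (\<rho> v) (\<rho> w)) \<and>
        (\<forall>r. \<rho> (vscale V r v) = vscale V' r (\<rho> v)))"


section \<open>Tangent vectors, vector fields and bivector fields\<close>

text \<open>A tangent vector at \<open>p\<close> is the compatible family of its coordinate vectors in all charts
  around \<open>p\<close> (with the value 0 at everything that is not a chart around \<open>p\<close>).\<close>

type_synonym ('m, 'e) tangent = "('m, 'e) chart \<Rightarrow> 'e"
type_synonym ('m, 'e) cotangent = "('m, 'e) tangent \<Rightarrow> real"

definition tangent_space :: "('m, 'e::real_inner) atlas \<Rightarrow> 'm \<Rightarrow> ('m, 'e) tangent set" where
  "tangent_space N p = {v.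
     (\<forall>c. \<not> (c \<in> N \<and> p \<in> fst c) \<longrightarrow> v c = 0) \<and>
     (\<forall>c\<in>N. \<forall>d\<in>N. p \<in> fst c \<longrightarrow> p \<in> fst d \<longrightarrow>
        v d = frechet_derivative (snd d \<circ> chart_inv c) (at (snd c p)) (v c))}"

definition tangent_bundle ::
  "('m, 'e::real_inner) atlas \<Rightarrow> ('m \<times> ('m, 'e) tangent, 'm, 'e) vector_bundle" where
  "tangent_bundle N = \<lparr>
     total_space = {(p, v). p \<in> points N \<and> v \<in> tangent_space N p},
     proj = fst,
     trivs = {(fst c, \<lambda>(p, v). v c) |c. c \<in> N},
     vadd = (\<lambda>(p, v) (q, w). (p, \<lambda>c. v c + w c)),
     vscale = (\<lambda>r (p, v). (p, \<lambda>c. r *\<^sub>R v c))\<rparr>"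

abbreviation vector_fields ::
  "('m, 'e::real_inner) atlas \<Rightarrow> ('m \<Rightarrow> 'm \<times> ('m, 'e) tangent) set" where
  "vector_fields N \<equiv> sections N (tangent_bundle N)"

text \<open>Covectors are extended by 0 outside the tangent space.\<close>

definition cotangent_space :: "('m, 'e::real_inner) atlas \<Rightarrow> 'm \<Rightarrow> ('m, 'e) cotangent set" where
  "cotangent_space N p = {\<omega>.
     (\<forall>v. v \<notin> tangent_space N p \<longrightarrow> \<omega> v = 0) \<and>
     (\<forall>v\<in>tangent_space N p. \<forall>w\<in>tangent_space N p. \<omega> (\<lambda>c. v c + w c) = \<omega> v + \<omega> w) \<and>
     (\<forall>r. \<forall>v\<in>tangent_space N p. \<omega> (\<lambda>c. r *\<^sub>R v c) = r * \<omega> v)}"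

text \<open>\<open>df\<^sub>p(v) = D(f \<circ> \<phi>\<^sup>-\<^sup>1)(\<phi> p)(v\<^sub>\<phi>)\<close>, which for smooth \<open>f\<close> does not depend on the chart.\<close>

definition differential ::
  "('m, 'e::real_inner) atlas \<Rightarrow> ('m \<Rightarrow> real) \<Rightarrow> 'm \<Rightarrow> ('m, 'e) cotangent" where
  "differential N f p = (\<lambda>v. if v \<in> tangent_space N p
     then (let c = (SOME c. c \<in> N \<and> p \<in> fst c)
           in frechet_derivative (f \<circ> chart_inv c) (at (snd c p)) (v c))
     else 0)"

definition vf_apply ::
  "('m, 'e::real_inner) atlas \<Rightarrow> ('m \<Rightarrow> 'm \<times> ('m, 'e) tangent) \<Rightarrow> ('m \<Rightarrow> real) \<Rightarrow> 'm \<Rightarrow> real" where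
  "vf_apply N X f p = differential N f p (snd (X p))"

text \<open>An element of \<open>\<And>\<^sup>2 T\<^sub>pN\<close> is an alternating bilinear form on \<open>T\<^sub>p\<^sup>*N\<close>. For a
  linear form \<open>\<alpha>\<close> on the model space, \<open>coord_covector N c \<alpha> p\<close> is the covector
  \<open>d(\<alpha> \<circ> \<phi>)\<^sub>p\<close> of the chart \<open>c = (U, \<phi>)\<close>, so smoothness below means smoothness
  of the components of \<open>\<Lambda>\<close> in every chart.\<close>

definition coord_covector ::
  "('m, 'e::real_inner) atlas \<Rightarrow> ('m, 'e) chart \<Rightarrow> ('e \<Rightarrow> real) \<Rightarrow> 'm \<Rightarrow> ('m, 'e) cotangent" where
  "coord_covector N c \<alpha> p = (\<lambda>v. if v \<in> tangent_space N p then \<alpha> (v c) else 0)"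

type_synonym ('m, 'e) bivector_field =
  "'m \<Rightarrow> ('m, 'e) cotangent \<Rightarrow> ('m, 'e) cotangent \<Rightarrow> real"

definition is_bivector_field ::
  "('m, 'e::real_inner) atlas \<Rightarrow> ('m, 'e) bivector_field \<Rightarrow> bool" where
  "is_bivector_field N \<Lambda> \<longleftrightarrow>
     (\<forall>p\<in>points N. \<forall>\<omega>\<in>cotangent_space N p. \<forall>\<eta>\<in>cotangent_space N p.
        \<Lambda> p \<omega> \<omega> = 0 \<and>
        (\<forall>\<theta>\<in>cotangent_space N p. \<forall>r s.
           \<Lambda> p (\<lambda>v. r * \<omega> v + s * \<eta> v) \<theta> = r * \<Lambda> p \<omega> \<theta> + s * \<Lambda> p \<eta> \<theta> \<and>
           \<Lambda> p \<theta> (\<lambda>v. r * \<omega> v + s * \<eta> v) = r * \<Lambda> p \<theta> \<omega> + s * \<Lambda> p \<theta> \<eta>)) \<and>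
     (\<forall>c\<in>N. \<forall>\<alpha> \<beta>. linear \<alpha> \<longrightarrow> linear \<beta> \<longrightarrow>
        (\<lambda>p. \<Lambda> p (coord_covector N c \<alpha> p) (coord_covector N c \<beta> p))
          \<in> smooth_functions (restrict_atlas N (fst c)))"


section \<open>Jacobi structures\<close>

definition jacobi_bracket ::
  "('m, 'e::real_inner) atlas \<Rightarrow> ('m, 'e) bivector_field \<Rightarrow> ('m \<Rightarrow> 'm \<times> ('m, 'e) tangent) \<Rightarrow>
   ('m \<Rightarrow> real) \<Rightarrow> ('m \<Rightarrow> real) \<Rightarrow> 'm \<Rightarrow> real" where
  "jacobi_bracket N \<Lambda> E f g = (\<lambda>x.
     \<Lambda> x (differential N f x) (differential N g x)
     + f x * vf_apply N E g x - g x * vf_apply N E f x)"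

definition jacobi_structure ::
  "('m, 'e::real_inner) atlas \<Rightarrow> ('m, 'e) bivector_field \<Rightarrow> ('m \<Rightarrow> 'm \<times> ('m, 'e) tangent) \<Rightarrow> bool"
  where
  "jacobi_structure N \<Lambda> E \<longleftrightarrow>
     smooth_manifold N \<and> is_bivector_field N \<Lambda> \<and> E \<in> vector_fields N \<and>
     (let J = jacobi_bracket N \<Lambda> E in
      \<forall>f\<in>smooth_functions N. \<forall>g\<in>smooth_functions N. \<forall>h\<in>smooth_functions N. \<forall>x\<in>points N.
        J f (J g h) x + J g (J h f) x + J h (J f g) x = 0)"


section \<open>Affine functions and the bundle \<open>A\<^sup>+\<close>\<close>

definition affine_on_fibre ::
  "('x, 'm, 'f, 'v) affine_bundle \<Rightarrow> 'm \<Rightarrow> ('x \<Rightarrow> real) \<Rightarrow> bool" where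
  "affine_on_fibre A p h \<longleftrightarrow> (\<exists>l.
     (\<forall>v\<in>fibre (model A) p. \<forall>w\<in>fibre (model A) p. l (vadd (model A) v w) = l v + l w) \<and>
     (\<forall>r. \<forall>v\<in>fibre (model A) p. l (vscale (model A) r v) = r * l v) \<and>
     (\<forall>x\<in>fibre A p. \<forall>v\<in>fibre (model A) p. h (translate A x v) = h x + l v))"

definition affine_functions ::
  "('m, 'e::real_inner) atlas \<Rightarrow> ('x, 'm, 'f::real_inner, 'v) affine_bundle \<Rightarrow> ('x \<Rightarrow> real) set" where
  "affine_functions M A = {a \<in> smooth_functions (total_atlas M A).
     \<forall>p\<in>points M. affine_on_fibre A p a}"

definition affine_jacobi_structure ::
  "('m, 'e::real_inner) atlas \<Rightarrow> ('x, 'm, 'f::real_inner, 'v) affine_bundle \<Rightarrow>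
   ('x, 'e \<times> 'f) bivector_field \<Rightarrow> ('x \<Rightarrow> 'x \<times> ('x, 'e \<times> 'f) tangent) \<Rightarrow> bool" where
  "affine_jacobi_structure M A \<Lambda> E \<longleftrightarrow>
     jacobi_structure (total_atlas M A) \<Lambda> E \<and>
     (\<forall>a\<in>affine_functions M A. \<forall>b\<in>affine_functions M A.
        jacobi_bracket (total_atlas M A) \<Lambda> E a b \<in> affine_functions M A)"

text \<open>A point of \<open>A\<^sup>+\<close> over \<open>p\<close> is a pair \<open>(p, \<alpha>)\<close> with \<open>\<alpha>\<close> an affine function on
  \<open>A\<^sub>p\<close>, extended by 0 outside \<open>A\<^sub>p\<close>. A trivialization \<open>\<Phi>\<close> of \<open>A\<close> turns \<open>\<alpha>\<close> into
  an affine function \<open>y \<mapsto> g \<bullet> y + k\<close> on \<open>'f\<close>, and the induced trivialization of \<open>A\<^sup>+\<close>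
  sends \<open>(p, \<alpha>)\<close> to \<open>(g, k)\<close>. Here \<open>A\<close> has rank \<open>DIM('f)\<close>, which is positive for every
  type of class \<open>euclidean_space\<close>.\<close>

definition Aplus ::
  "('m, 'e) atlas \<Rightarrow> ('x, 'm, 'f::euclidean_space, 'v) affine_bundle \<Rightarrow>
   ('m \<times> ('x \<Rightarrow> real), 'm, 'f \<times> real) vector_bundle" where
  "Aplus M A = \<lparr>
     total_space = {(p, \<alpha>). p \<in> points M \<and> affine_on_fibre A p \<alpha> \<and> (\<forall>x. x \<notin> fibre A p \<longrightarrow> \<alpha> x = 0)},
     proj = fst,
     trivs = {(W, \<lambda>(p, \<alpha>).
                let \<alpha>' = \<alpha> \<circ> inv_into (fibre A p) \<Phi>
                in (\<Sum>b\<in>Basis. (\<alpha>' b - \<alpha>' 0) *\<^sub>R b, \<alpha>' 0)) |W \<Phi>. (W, \<Phi>) \<in> trivs A},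
     vadd = (\<lambda>(p, \<alpha>) (q, \<beta>). (p, \<lambda>x. \<alpha> x + \<beta> x)),
     vscale = (\<lambda>r (p, \<alpha>). (p, \<lambda>x. r * \<alpha> x))\<rparr>"

text \<open>\<open>tilde M A a\<close> is the section of \<open>A\<^sup>+\<close> corresponding to the affine function \<open>a\<close>.\<close>

definition tilde ::
  "('m, 'e) atlas \<Rightarrow> ('x, 'm, 'f, 'v) affine_bundle \<Rightarrow> ('x \<Rightarrow> real) \<Rightarrow> 'm \<Rightarrow> 'm \<times> ('x \<Rightarrow> real)" where
  "tilde M A a = (\<lambda>p\<in>points M. (p, \<lambda>x. if x \<in> fibre A p then a x else 0))"


section \<open>Lie algebroids\<close>

definition lie_bracket_on_sections ::
  "('m, 'e::real_inner) atlas \<Rightarrow> ('x, 'm, 'f::real_inner, 'z) vector_bundle_scheme \<Rightarrow>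
   (('m \<Rightarrow> 'x) \<Rightarrow> ('m \<Rightarrow> 'x) \<Rightarrow> 'm \<Rightarrow> 'x) \<Rightarrow> bool" where
  "lie_bracket_on_sections M V br \<longleftrightarrow>
     (\<forall>X\<in>sections M V. \<forall>Y\<in>sections M V.
        br X Y \<in> sections M V \<and>
        br X Y = sec_mult M V (\<lambda>_. -1) (br Y X) \<and>
        (\<forall>r. br (sec_mult M V (\<lambda>_. r) X) Y = sec_mult M V (\<lambda>_. r) (br X Y) \<and>
             br X (sec_mult M V (\<lambda>_. r) Y) = sec_mult M V (\<lambda>_. r) (br X Y)) \<and>
        (\<forall>Z\<in>sections M V.
           br (sec_add M V X Y) Z = sec_add M V (br X Z) (br Y Z) \<and>
           br Z (sec_add M V X Y) = sec_add M V (br Z X) (br Z Y) \<and>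
           br X (br Y Z) = sec_add M V (br (br X Y) Z) (br Y (br X Z))))"

definition lie_algebroid ::
  "('m, 'e::real_inner) atlas \<Rightarrow> ('x, 'm, 'f::real_inner, 'z) vector_bundle_scheme \<Rightarrow>
   (('m \<Rightarrow> 'x) \<Rightarrow> ('m \<Rightarrow> 'x) \<Rightarrow> 'm \<Rightarrow> 'x) \<Rightarrow> ('x \<Rightarrow> 'm \<times> ('m, 'e) tangent) \<Rightarrow> bool" where
  "lie_algebroid M V br \<rho> \<longleftrightarrow>
     is_vector_bundle M V \<and>
     lie_bracket_on_sections M V br \<and>
     vector_bundle_morphism M V (tangent_bundle M) \<rho> \<and>
     (\<forall>X\<in>sections M V. \<forall>Y\<in>sections M V. \<forall>f\<in>smooth_functions M.
        br X (sec_mult M V f Y) =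
        sec_add M V (sec_mult M V f (br X Y)) (sec_mult M V (vf_apply M (\<rho> \<circ> X) f) Y))"

text \<open>The defining equations of \<open>\<lbrakk>\<cdot>,\<cdot>\<rbrakk>\<^sup>+ : \<Gamma>(A\<^sup>+) \<times> \<Gamma>(A\<^sup>+) \<rightarrow> \<Gamma>(A\<^sup>+)\<close>
  and \<open>\<rho>\<^sup>+ : \<Gamma>(A\<^sup>+) \<rightarrow> \<XX>(M)\<close>.\<close>

definition plus_operations ::
  "('m, 'e::real_inner) atlas \<Rightarrow> ('x, 'm, 'f::euclidean_space, 'v) affine_bundle \<Rightarrow>
   ('x, 'e \<times> 'f) bivector_field \<Rightarrow> ('x \<Rightarrow> 'x \<times> ('x, 'e \<times> 'f) tangent) \<Rightarrow>
   (('m \<Rightarrow> 'm \<times> ('x \<Rightarrow> real)) \<Rightarrow> ('m \<Rightarrow> 'm \<times> ('x \<Rightarrow> real)) \<Rightarrow> 'm \<Rightarrow> 'm \<times> ('x \<Rightarrow> real)) \<Rightarrow>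
   (('m \<Rightarrow> 'm \<times> ('x \<Rightarrow> real)) \<Rightarrow> 'm \<Rightarrow> 'm \<times> ('m, 'e) tangent) \<Rightarrow> bool" where
  "plus_operations M A \<Lambda> E br rho \<longleftrightarrow>
     (let \<Gamma> = sections M (Aplus M A); J = jacobi_bracket (total_atlas M A) \<Lambda> E in
      br \<in> \<Gamma> \<rightarrow>\<^sub>E \<Gamma> \<rightarrow>\<^sub>E \<Gamma> \<and>
      rho \<in> \<Gamma> \<rightarrow>\<^sub>E vector_fields M \<and>
      (\<forall>a\<in>affine_functions M A. \<forall>b\<in>affine_functions M A.
         br (tilde M A a) (tilde M A b) = tilde M A (J a b)) \<and>
      (\<forall>a\<in>affine_functions M A. \<forall>f\<in>smooth_functions M. \<forall>x\<in>total_space A.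
         vf_apply M (rho (tilde M A a)) f (proj A x) =
         J a (f \<circ> proj A) x - f (proj A x) * J a (\<lambda>_. 1) x))"

end

theory Submission
  imports Defs
begin

text \<open>
  For affine \<open>a\<close> and basic \<open>f\<close>, the Leibniz rule of the Jacobi bracket reads
  \<open>{a, f b} = f {a, b} + b R(a, f)\<close> with \<open>R(a, f) = \<Lambda>(da, df) + a E(f)\<close>.
  Hence \<open>b R(a, f)\<close> is fibrewise affine for every affine \<open>b\<close>, which in positive rank forces
  \<open>R(a, f)\<close> to be constant on the fibres. Replacing \<open>a\<close> by \<open>g a\<close> with \<open>g\<close> basic gives the
  additional term \<open>a \<Lambda>(dg, df)\<close>, which must also be constant on the fibres, so that
  \<open>\<Lambda>(dg, df) = 0\<close> for basic \<open>f, g\<close>. If \<open>a\<close> vanishes on a fibre, then along that fibre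
  \<open>da\<close> is the differential of a basic function; therefore \<open>R(a, \<cdot>)\<close> at \<open>p\<close> depends only on the
  restriction of \<open>a\<close> to \<open>A\<^sub>p\<close>, that is, \<open>R\<close> is a bundle map from \<open>A\<^sup>+\<close> to \<open>TM\<close>. Bump
  functions extend local data and show that a tangent vector is determined by its action on
  global functions.
\<close>

subsection \<open>Differential calculus\<close>

text \<open>Two obstacles shape the rest. The map \<open>rho\<close> acts on sections, while a Lie
  algebroid needs a bundle map that is smooth on the total space of \<open>Aplus M A\<close>. A
  vector of that bundle is therefore extended to a global affine function before \<open>rho\<close>
  is applied. Smoothness is read off in a local frame of affine functions: the anchor is linear in
  the fibre coordinates \<open>(g, k)\<close>, and its coefficients are basic, so they descend to
  smooth functions on \<open>M\<close>. No smooth selection of extensions is needed. The second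
  obstacle is that the model space of \<open>M\<close> is only a finite-dimensional inner product
  space. Orthonormal bases, the chain rule for higher derivatives and compactness of balls are
  derived from \<open>finite_dimensional\<close>. Tangent vectors of \<open>M\<close> come out of
  the anchor form without any Taylor expansion: the form sees \<open>f\<close> only through its
  differential, so \<open>f\<close> can be traded for a combination of cut-off coordinate functions.
  Throughout, functions are total in the logic and meaningful only on the total space, so identities
  between them hold pointwise there and are transported by congruence lemmas.\<close>

lemma frechet_derivative_cong_open:
  assumes "open S" "x \<in> S" "\<And>y. y \<in> S \<Longrightarrow> f y = g y"
  shows "frechet_derivative f (at x) = frechet_derivative g (at x)"
proof -
  \<comment> \<open>No differentiability is assumed: both derivatives are chosen by
    \<open>SOME\<close> from the same set of candidates, so they coincide even when that set is
    empty.\<close>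
  have "(f has_derivative D) (at x) \<longleftrightarrow> (g has_derivative D) (at x)" for D
    using has_derivative_transform_within_open[of f D x UNIV S g]
      has_derivative_transform_within_open[of g D x UNIV S f] assms by auto
  then show ?thesis by (simp add: frechet_derivative_def)
qed

lemma differentiable_cong_open:
  assumes "open S" "x \<in> S" "\<And>y. y \<in> S \<Longrightarrow> f y = g y"
  shows "f differentiable (at x) \<longleftrightarrow> g differentiable (at x)"
  using has_derivative_transform_within_open[of f _ x UNIV S g]
      has_derivative_transform_within_open[of g _ x UNIV S f] assms
  unfolding differentiable_def by metis

lemma Ck_on_cong:
  assumes "open S" "\<And>y. y \<in> S \<Longrightarrow> f y = g y"
  shows "Ck_on k S f \<longleftrightarrow> Ck_on k S g"
  using assms(2)
proof (induction k arbitrary: f g)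
  case 0
  then show ?case using continuous_on_cong[of S S f g] by simp
next
  case (Suc k)
  have "f differentiable (at x) \<longleftrightarrow> g differentiable (at x)" if "x \<in> S" for x
    by (rule differentiable_cong_open[OF assms(1) that Suc.prems])
  moreover have "Ck_on k S (\<lambda>x. frechet_derivative f (at x) v) \<longleftrightarrow>
      Ck_on k S (\<lambda>x. frechet_derivative g (at x) v)" for v
    by (rule Suc.IH) (simp add: frechet_derivative_cong_open[OF assms(1) _ Suc.prems])
  ultimately show ?case by auto
qed

lemma Ck_on_subset: "Ck_on k S f \<Longrightarrow> T \<subseteq> S \<Longrightarrow> Ck_on k T f"
  by (induction k arbitrary: f) (auto intro: continuous_on_subset)

lemma Ck_on_Suc_imp: "Ck_on (Suc k) S f \<Longrightarrow> Ck_on k S f"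
proof (induction k arbitrary: f)
  case 0
  then show ?case
    by (auto intro!: differentiable_imp_continuous_on
        simp: differentiable_on_def differentiable_at_withinI)
qed auto

text \<open>This localization allows smoothness to be checked with different coordinate functions,
  or a different frame, near each point.\<close>

lemma Ck_on_local:
  assumes "\<And>x. x \<in> S \<Longrightarrow> \<exists>T. open T \<and> x \<in> T \<and> Ck_on k T f"
  shows "Ck_on k S f"
  using assms
proof (induction k arbitrary: f)
  case 0
  then show ?case
    by (auto simp: continuous_on_eq_continuous_within)
      (metis at_within_open continuous_at_imp_continuous_at_within continuous_on_eq_continuous_within)
next
  case (Suc k)
  have "f differentiable (at x)" if "x \<in> S" for x
    using Suc.prems[OF that] by auto
  moreover have "Ck_on k S (\<lambda>x. frechet_derivative f (at x) v)" for v
    by (rule Suc.IH) (use Suc.prems in \<open>fastforce\<close>)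
  ultimately show ?case by simp
qed

lemma Ck_on_const: "Ck_on k S (\<lambda>x. c)"
proof (induction k arbitrary: c)
  case (Suc k)
  have "frechet_derivative (\<lambda>x. c) (at x) = (\<lambda>_. 0)" for x
    by (rule frechet_derivative_at[symmetric]) simp
  with Suc show ?case by simp
qed simp

lemma Ck_on_bounded_linear:
  assumes "bounded_linear L"
  shows "Ck_on k S L"
proof (cases k)
  case 0
  then show ?thesis using assms by (simp add: linear_continuous_on)
next
  case (Suc j)
  have "frechet_derivative L (at x) = L" for x
    by (rule frechet_derivative_at[symmetric]) (rule bounded_linear_imp_has_derivative[OF assms])
  moreover have "L differentiable (at x)" for x
    by (rule bounded_linear_imp_differentiable[OF assms])
  ultimately show ?thesis using Suc by (simp add: Ck_on_const)
qed

lemma Ck_on_add: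
  assumes "open S" "Ck_on k S f" "Ck_on k S g"
  shows "Ck_on k S (\<lambda>x. f x + g x)"
  using assms(2,3)
proof (induction k arbitrary: f g)
  case 0
  then show ?case by (simp add: continuous_on_add)
next
  case (Suc k)
  have 1: "((\<lambda>x. f x + g x) has_derivative
      (\<lambda>v. frechet_derivative f (at x) v + frechet_derivative g (at x) v)) (at x)" if "x \<in> S" for x
    using Suc.prems that by (auto intro!: has_derivative_add simp: frechet_derivative_works[symmetric])
  have "Ck_on k S (\<lambda>x. frechet_derivative (\<lambda>x. f x + g x) (at x) v)" for v
  proof -
    have "Ck_on k S (\<lambda>x. frechet_derivative f (at x) v + frechet_derivative g (at x) v)"
      by (rule Suc.IH) (use Suc.prems in auto)
    then show ?thesis
      by (subst Ck_on_cong[OF assms(1)]) (auto simp: frechet_derivative_at[OF 1, symmetric])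
  qed
  with 1 show ?case by (auto simp: differentiable_def)
qed

text \<open>The product rule yields \<open>P\<close> applied to one function and a derivative of the
  other, so the induction runs over all pairs and uses the undifferentiated factor at the lower
  order. Products, scalings and inner products are all instances.\<close>

lemma Ck_on_bilinear:
  assumes "bounded_bilinear P" "open S" "Ck_on k S f" "Ck_on k S g"
  shows "Ck_on k S (\<lambda>x. P (f x) (g x))"
  using assms(3,4)
proof (induction k arbitrary: f g)
  case 0
  then show ?case by (simp add: bounded_bilinear.continuous_on[OF assms(1)])
next
  case (Suc k)
  have 1: "((\<lambda>x. P (f x) (g x)) has_derivative
      (\<lambda>v. P (f x) (frechet_derivative g (at x) v) + P (frechet_derivative f (at x) v) (g x))) (at x)"
    if "x \<in> S" for x
    using Suc.prems that
    by (auto intro!: bounded_bilinear.FDERIV[OF assms(1)] simp: frechet_derivative_works[symmetric])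
  have "Ck_on k S (\<lambda>x. frechet_derivative (\<lambda>x. P (f x) (g x)) (at x) v)" for v
  proof -
    have "Ck_on k S (\<lambda>x. P (f x) (frechet_derivative g (at x) v) + P (frechet_derivative f (at x) v) (g x))"
      using Suc.prems Suc.prems[THEN Ck_on_Suc_imp]
      by (intro Ck_on_add[OF assms(2)] Suc.IH) simp_all
    then show ?thesis
      by (subst Ck_on_cong[OF assms(2)]) (auto simp: frechet_derivative_at[OF 1, symmetric])
  qed
  with 1 show ?case by (auto simp: differentiable_def)
qed

lemma Ck_on_sum:
  assumes "open S" "finite B" "\<And>b. b \<in> B \<Longrightarrow> Ck_on k S (f b)"
  shows "Ck_on k S (\<lambda>x. \<Sum>b\<in>B. f b x)"
  using assms(2,3) by (induction B) (auto simp: Ck_on_const intro!: Ck_on_add[OF assms(1)])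

lemma Ck_on_linear_comp:
  assumes "bounded_linear L" "open S" "Ck_on k S f"
  shows "Ck_on k S (\<lambda>x. L (f x))"
  using assms(3)
proof (induction k arbitrary: f)
  case 0
  then show ?case by (simp add: bounded_linear.continuous_on[OF assms(1)])
next
  case (Suc k)
  have 1: "((\<lambda>x. L (f x)) has_derivative (\<lambda>v. L (frechet_derivative f (at x) v))) (at x)"
    if "x \<in> S" for x
    using Suc.prems that
    by (auto intro!: bounded_linear.has_derivative[OF assms(1)] simp: frechet_derivative_works[symmetric])
  have "Ck_on k S (\<lambda>x. frechet_derivative (\<lambda>x. L (f x)) (at x) v)" for v
  proof -
    have "Ck_on k S (\<lambda>x. L (frechet_derivative f (at x) v))"
      by (rule Suc.IH) (use Suc.prems in auto)
    then show ?thesis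
      by (subst Ck_on_cong[OF assms(2)]) (auto simp: frechet_derivative_at[OF 1, symmetric])
  qed
  with 1 show ?case by (auto simp: differentiable_def)
qed

section \<open>Orthonormal bases of finite-dimensional inner product spaces and composition of
  smooth maps\<close>

definition orthonormal_basis :: "'a::real_inner set \<Rightarrow> bool" where
  "orthonormal_basis B \<longleftrightarrow> finite B \<and> (\<forall>b\<in>B. \<forall>c\<in>B. b \<bullet> c = (if b = c then 1 else 0)) \<and>
     (\<forall>x. x = (\<Sum>b\<in>B. (x \<bullet> b) *\<^sub>R b))"

text \<open>Gram-Schmidt, one generator at a time: the part \<open>w\<close> of the new vector
  orthogonal to the old basis either vanishes, and then the old basis still reproduces the larger
  span, or it is normalized and added.\<close>

lemma orthonormal_span_exists:
  assumes "finite S"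
  shows "\<exists>B::'a::real_inner set. finite B \<and> (\<forall>b\<in>B. \<forall>c\<in>B. b \<bullet> c = (if b = c then 1 else 0)) \<and>
     (\<forall>x\<in>span S. x = (\<Sum>b\<in>B. (x \<bullet> b) *\<^sub>R b))"
  using assms
proof (induction S)
  case empty
  then show ?case by (intro exI[of _ "{}"]) auto
next
  case (insert a S)
  then obtain B :: "'a set" where B: "finite B" "\<And>b c. b \<in> B \<Longrightarrow> c \<in> B \<Longrightarrow> b \<bullet> c = (if b = c then 1 else 0)"
    "\<And>x. x \<in> span S \<Longrightarrow> x = (\<Sum>b\<in>B. (x \<bullet> b) *\<^sub>R b)" by metis
  define w where "w = a - (\<Sum>b\<in>B. (a \<bullet> b) *\<^sub>R b)"
  have wb: "w \<bullet> c = 0" if "c \<in> B" for c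
    using that B(1) by (simp add: w_def inner_diff_left inner_sum_left B(2) if_distrib sum.delta' cong: if_cong)
  define P where "P x = (\<Sum>b\<in>B. (x \<bullet> b) *\<^sub>R b)" for x :: 'a
  have dec: "\<exists>t. x - t *\<^sub>R a \<in> span S" if "x \<in> span (insert a S)" for x
    using that by (auto simp: span_insert)
  have P_lin: "P (x + t *\<^sub>R y) = P x + t *\<^sub>R P y" for x y t
    by (simp add: P_def inner_add_left scaleR_add_left sum.distrib scaleR_sum_right)
  show ?case
  proof (cases "w = 0")
    case True
    have "x = P x" if x: "x \<in> span (insert a S)" for x
    proof -
      obtain t where t: "x - t *\<^sub>R a \<in> span S" using dec[OF x] by auto
      have "P x = P (x - t *\<^sub>R a) + t *\<^sub>R P a"
        using P_lin[of "x - t *\<^sub>R a" t a] by simp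
      moreover have "P (x - t *\<^sub>R a) = x - t *\<^sub>R a" using B(3)[OF t] by (simp add: P_def)
      moreover have "P a = a" using True by (simp add: P_def w_def)
      ultimately show ?thesis by simp
    qed
    with B(1,2) show ?thesis by (auto simp: P_def intro!: exI[of _ B])
  next
    case False
    define u where "u = w /\<^sub>R norm w"
    have uu: "u \<bullet> u = 1" using False by (simp add: u_def dot_square_norm power2_eq_square)
    have ub: "u \<bullet> b = 0" "b \<bullet> u = 0" if "b \<in> B" for b using wb[OF that] by (simp_all add: u_def inner_commute)
    have uB: "u \<notin> B" using ub uu by force
    have w: "w = (norm w) *\<^sub>R u" using False by (simp add: u_def)
    have "x = P x + (x \<bullet> u) *\<^sub>R u" if x: "x \<in> span (insert a S)" for x
    proof -
      obtain t where t: "x - t *\<^sub>R a \<in> span S" using dec[OF x] by auto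
      have 1: "P (x - t *\<^sub>R a) = x - t *\<^sub>R a" using B(3)[OF t] by (simp add: P_def)
      have "P x = P (x - t *\<^sub>R a) + t *\<^sub>R P a"
        using P_lin[of "x - t *\<^sub>R a" t a] by simp
      then have 2: "P x = x - t *\<^sub>R w" using 1 by (simp add: w_def P_def scaleR_diff_right)
      have "P x \<bullet> u = 0" by (simp add: P_def inner_sum_left ub)
      then have "x \<bullet> u = t * (w \<bullet> u)" using 2 by (simp add: inner_diff_left)
      also have "w \<bullet> u = norm w" by (subst w) (simp add: uu)
      finally have "(x \<bullet> u) *\<^sub>R u = t *\<^sub>R w" by (subst w) simp
      with 2 show ?thesis by simp
    qed
    then show ?thesis using B(1,2) uB uu ub
      by (intro exI[of _ "insert u B"]) (auto simp: P_def add.commute)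
  qed
qed

lemma finite_dimensional_orthonormal_basis:
  assumes "finite_dimensional TYPE('a::real_inner)"
  obtains B :: "'a::real_inner set" where "orthonormal_basis B"
proof -
  obtain S :: "'a set" where "finite S" "span S = UNIV"
    using assms by (auto simp: finite_dimensional_def)
  with orthonormal_span_exists[OF \<open>finite S\<close>] obtain B :: "'a set" where "finite B"
    "\<forall>b\<in>B. \<forall>c\<in>B. b \<bullet> c = (if b = c then 1 else 0)" "\<forall>x. x = (\<Sum>b\<in>B. (x \<bullet> b) *\<^sub>R b)" by auto
  then have "orthonormal_basis B" unfolding orthonormal_basis_def by (intro conjI)
  then show ?thesis by (rule that)
qed

lemma orthonormal_basisD:
  assumes "orthonormal_basis B"
  shows "finite B" "(\<Sum>b\<in>B. (x \<bullet> b) *\<^sub>R b) = x"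
    "b \<in> B \<Longrightarrow> c \<in> B \<Longrightarrow> b \<bullet> c = (if b = c then 1 else 0)"
proof -
  show "finite B" "b \<in> B \<Longrightarrow> c \<in> B \<Longrightarrow> b \<bullet> c = (if b = c then 1 else 0)"
    using assms unfolding orthonormal_basis_def by blast+
  have "\<forall>x. x = (\<Sum>b\<in>B. (x \<bullet> b) *\<^sub>R b)"
    using assms unfolding orthonormal_basis_def by blast
  from this[rule_format, of x] show "(\<Sum>b\<in>B. (x \<bullet> b) *\<^sub>R b) = x" by (rule sym)
qed

lemma orthonormal_basis_linear:
  assumes "orthonormal_basis B" "linear f"
  shows "f x = (\<Sum>b\<in>B. (x \<bullet> b) *\<^sub>R f b)"
proof -
  have "f (\<Sum>b\<in>B. (x \<bullet> b) *\<^sub>R b) = (\<Sum>b\<in>B. (x \<bullet> b) *\<^sub>R f b)"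
    by (simp add: linear_sum[OF assms(2)] linear_cmul[OF assms(2)])
  then show ?thesis by (simp only: orthonormal_basisD(2)[OF assms(1)])
qed

lemma finite_dimensional_euclidean: "finite_dimensional TYPE('a::euclidean_space)"
  unfolding finite_dimensional_def by (intro exI[of _ Basis]) auto

lemma finite_dimensional_prod:
  assumes "finite_dimensional TYPE('a::real_vector)" "finite_dimensional TYPE('b::real_vector)"
  shows "finite_dimensional TYPE('a \<times> 'b)"
proof -
  obtain S :: "'a set" and T :: "'b set" where ST: "finite S" "span S = UNIV" "finite T" "span T = UNIV"
    using assms by (auto simp: finite_dimensional_def)
  let ?B = "(\<lambda>x. (x, 0)) ` S \<union> (\<lambda>y. (0, y)) ` T"
  have l: "linear (\<lambda>x::'a. (x, 0::'b))" "linear (\<lambda>y::'b. (0::'a, y))"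
    by (auto intro!: linearI)
  have "(x, y) \<in> span ?B" for x y
  proof -
    have "(x, 0) \<in> span ?B" using span_mono[of "(\<lambda>x. (x, 0)) ` S" ?B] linear_span_image[OF l(1), of S] ST by blast
    moreover have "(0, y) \<in> span ?B" using span_mono[of "(\<lambda>y. (0, y)) ` T" ?B] linear_span_image[OF l(2), of T] ST by blast
    ultimately show ?thesis using span_add[of "(x,0)" ?B "(0,y)"] by simp
  qed
  then show ?thesis unfolding finite_dimensional_def using ST by (intro exI[of _ ?B]) auto
qed

text \<open>\<open>Ck_on\<close> controls derivatives only in fixed directions, while the chain rule
  evaluates the derivative of \<open>f\<close> in the direction
  \<open>frechet_derivative g (at x) v\<close>, which moves with \<open>x\<close>. Expanding this
  direction in an orthonormal basis leaves fixed directions with scalar coefficients of the right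
  regularity; this is where finite dimension enters.\<close>

lemma Ck_on_compose:
  fixes f :: "'b::real_inner \<Rightarrow> 'c::real_normed_vector" and g :: "'a::real_normed_vector \<Rightarrow> 'b"
  assumes "finite_dimensional TYPE('b)" "open S" "open T" "Ck_on k S g" "Ck_on k T f" "g ` S \<subseteq> T"
  shows "Ck_on k S (\<lambda>x. f (g x))"
proof -
  obtain B :: "'b set" where B: "orthonormal_basis B"
    using finite_dimensional_orthonormal_basis[OF assms(1)] .
  show ?thesis using assms(4,5)
  proof (induction k arbitrary: f)
    case 0
    then show ?case using assms(6) continuous_on_compose2 by (simp, blast)
  next
    case (Suc k)
    have fd: "(f has_derivative frechet_derivative f (at (g x))) (at (g x))"
      and gd: "(g has_derivative frechet_derivative g (at x)) (at x)" if "x \<in> S" for x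
      using Suc.prems assms(6) that by (auto simp: frechet_derivative_works[symmetric])
    have 1: "((\<lambda>x. f (g x)) has_derivative
       (\<lambda>v. frechet_derivative f (at (g x)) (frechet_derivative g (at x) v))) (at x)" if "x \<in> S" for x
      using has_derivative_compose[OF gd fd] that by (simp add: o_def)
    have 2: "frechet_derivative f (at (g x)) (frechet_derivative g (at x) v) =
       (\<Sum>b\<in>B. (frechet_derivative g (at x) v \<bullet> b) *\<^sub>R frechet_derivative f (at (g x)) b)"
      if "x \<in> S" for x v
      by (rule orthonormal_basis_linear[OF B]) (rule has_derivative_linear[OF fd[OF that]])
    have "Ck_on k S (\<lambda>x. frechet_derivative (\<lambda>x. f (g x)) (at x) v)" for v
    proof -
      have "Ck_on k S (\<lambda>x. \<Sum>b\<in>B. (frechet_derivative g (at x) v \<bullet> b) *\<^sub>R frechet_derivative f (at (g x)) b)"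
      proof (intro Ck_on_sum[OF assms(2)] orthonormal_basisD[OF B] Ck_on_bilinear[OF bounded_bilinear_scaleR assms(2)])
        fix b
        show "Ck_on k S (\<lambda>x. frechet_derivative g (at x) v \<bullet> b)"
          by (rule Ck_on_linear_comp[OF bounded_linear_inner_left assms(2)]) (use Suc.prems in auto)
        show "Ck_on k S (\<lambda>x. frechet_derivative f (at (g x)) b)"
          by (rule Suc.IH) (use Suc.prems Suc.prems(1)[THEN Ck_on_Suc_imp] in simp_all)
      qed
      then show ?thesis
        by (subst Ck_on_cong[OF assms(2)]) (auto simp: frechet_derivative_at[OF 1, symmetric] 2)
    qed
    with 1 show ?case by (auto simp: differentiable_def)
  qed
qed

section \<open>Closure properties of smooth maps\<close>

lemma smooth_on_cong: "open S \<Longrightarrow> (\<And>y. y \<in> S \<Longrightarrow> f y = g y) \<Longrightarrow> smooth_on S f \<longleftrightarrow> smooth_on S g"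
  unfolding smooth_on_def using Ck_on_cong by blast

lemma smooth_on_transform:
  "smooth_on S f \<Longrightarrow> open S \<Longrightarrow> (\<And>y. y \<in> S \<Longrightarrow> f y = g y) \<Longrightarrow> smooth_on S g"
  using smooth_on_cong by blast

lemma smooth_on_subset: "smooth_on S f \<Longrightarrow> T \<subseteq> S \<Longrightarrow> smooth_on T f"
  unfolding smooth_on_def using Ck_on_subset by blast

lemma smooth_on_local:
  assumes "\<And>x. x \<in> S \<Longrightarrow> \<exists>T. open T \<and> x \<in> T \<and> smooth_on T f"
  shows "smooth_on S f"
  unfolding smooth_on_def by (intro allI Ck_on_local) (use assms smooth_on_def in blast)

lemma smooth_on_const: "smooth_on S (\<lambda>x. c)"
  by (simp add: smooth_on_def Ck_on_const)

lemma smooth_on_bounded_linear: "bounded_linear L \<Longrightarrow> smooth_on S L"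
  by (simp add: smooth_on_def Ck_on_bounded_linear)

lemma smooth_on_id: "smooth_on S (\<lambda>x. x)"
  by (rule smooth_on_bounded_linear) (rule bounded_linear_ident)

lemma smooth_on_add: "open S \<Longrightarrow> smooth_on S f \<Longrightarrow> smooth_on S g \<Longrightarrow> smooth_on S (\<lambda>x. f x + g x)"
  by (simp add: smooth_on_def Ck_on_add)

lemma smooth_on_bilinear:
  "bounded_bilinear P \<Longrightarrow> open S \<Longrightarrow> smooth_on S f \<Longrightarrow> smooth_on S g \<Longrightarrow> smooth_on S (\<lambda>x. P (f x) (g x))"
  by (simp add: smooth_on_def Ck_on_bilinear)

lemmas smooth_on_mult = smooth_on_bilinear[OF bounded_bilinear_mult]
lemmas smooth_on_scaleR = smooth_on_bilinear[OF bounded_bilinear_scaleR]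
lemmas smooth_on_inner = smooth_on_bilinear[OF bounded_bilinear_inner]

lemma smooth_on_sum:
  "open S \<Longrightarrow> finite B \<Longrightarrow> (\<And>b. b \<in> B \<Longrightarrow> smooth_on S (f b)) \<Longrightarrow> smooth_on S (\<lambda>x. \<Sum>b\<in>B. f b x)"
  by (simp add: smooth_on_def Ck_on_sum)

lemma smooth_on_linear_comp:
  "bounded_linear L \<Longrightarrow> open S \<Longrightarrow> smooth_on S f \<Longrightarrow> smooth_on S (\<lambda>x. L (f x))"
  by (simp add: smooth_on_def Ck_on_linear_comp)

lemmas smooth_on_fst = smooth_on_linear_comp[OF bounded_linear_fst]
lemmas smooth_on_snd = smooth_on_linear_comp[OF bounded_linear_snd]

lemma smooth_on_minus: "open S \<Longrightarrow> smooth_on S f \<Longrightarrow> smooth_on S g \<Longrightarrow> smooth_on S (\<lambda>x. f x - g x)"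
  using smooth_on_add[of S f "\<lambda>x. - g x"] smooth_on_linear_comp[OF bounded_linear_minus[OF bounded_linear_ident], of S g]
  by simp

lemma smooth_on_Pair:
  assumes "open S" "smooth_on S f" "smooth_on S g"
  shows "smooth_on S (\<lambda>x. (f x, g x))"
proof -
  have "smooth_on S (\<lambda>x. (f x, 0) + (0, g x))"
    using assms
    by (intro smooth_on_add smooth_on_linear_comp[where L = "\<lambda>u. (u, 0)"] smooth_on_linear_comp[where L = "\<lambda>u. (0, u)"]
         bounded_linear_Pair bounded_linear_ident bounded_linear_zero)
  then show ?thesis by simp
qed

lemma smooth_on_compose:
  fixes f :: "'b::real_inner \<Rightarrow> 'c::real_normed_vector" and g :: "'a::real_normed_vector \<Rightarrow> 'b"
  assumes "finite_dimensional TYPE('b)" "open S" "open T" "smooth_on S g" "smooth_on T f" "g ` S \<subseteq> T"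
  shows "smooth_on S (\<lambda>x. f (g x))"
  using Ck_on_compose[OF assms(1-3) _ _ assms(6)] assms(4,5) unfolding smooth_on_def by blast

lemma smooth_on_continuous: "smooth_on S f \<Longrightarrow> continuous_on S f"
  unfolding smooth_on_def by (metis Ck_on.simps(1))

lemma smooth_on_differentiable: "smooth_on S f \<Longrightarrow> x \<in> S \<Longrightarrow> f differentiable (at x)"
  unfolding smooth_on_def by (metis Ck_on.simps(2))

lemma smooth_on_has_derivative:
  "smooth_on S f \<Longrightarrow> x \<in> S \<Longrightarrow> (f has_derivative frechet_derivative f (at x)) (at x)"
  using smooth_on_differentiable frechet_derivative_works by blast

lemma open_continuous_Int_vimage:
  "continuous_on S f \<Longrightarrow> open S \<Longrightarrow> open T \<Longrightarrow> open {x \<in> S. f x \<in> T}"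
  using continuous_open_preimage[of S f T] by (simp add: Collect_conj_eq vimage_def)

subsection \<open>Smooth bump functions\<close>

lemma DERIV_inverse_power:
  fixes x :: real
  assumes "x \<noteq> 0"
  shows "((\<lambda>x. inverse x ^ n) has_real_derivative - real n * inverse x ^ Suc n) (at x)"
proof (cases n)
  case (Suc m)
  show ?thesis unfolding Suc
    by (rule DERIV_cong[OF DERIV_power_Suc[OF DERIV_inverse[OF assms]]]) (simp add: algebra_simps)
qed simp

text \<open>The functions \<open>c * inverse x ^ n\<close> are closed under differentiation, so the
  induction is run for all \<open>c\<close> and \<open>n\<close> at once.\<close>

lemma smooth_on_real_inverse: "smooth_on {x::real. x \<noteq> 0} inverse"
proof -
  let ?S = "{x::real. x \<noteq> 0}"
  have o: "open ?S" by (rule open_Collect_neq) (auto intro: continuous_intros)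
  have "Ck_on k ?S (\<lambda>x. c * inverse x ^ n)" for k n and c :: real
  proof (induction k arbitrary: n c)
    case 0
    then show ?case by (auto intro!: continuous_intros)
  next
    case (Suc k)
    have 1: "((\<lambda>x. c * inverse x ^ n) has_derivative (\<lambda>v. (- c * n * v) * inverse x ^ Suc n)) (at x)"
      if "x \<in> ?S" for x
    proof -
      have "((\<lambda>x. c * inverse x ^ n) has_real_derivative (- c * n) * inverse x ^ Suc n) (at x)"
        by (rule DERIV_cong[OF DERIV_cmult[OF DERIV_inverse_power]]) (use that in \<open>simp_all add: algebra_simps\<close>)
      moreover have "(*) ((- c * n) * inverse x ^ Suc n) = (\<lambda>v. (- c * n * v) * inverse x ^ Suc n)"
        by (auto simp: algebra_simps)
      ultimately show ?thesis unfolding has_field_derivative_def by (simp only:)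
    qed
    have "Ck_on k ?S (\<lambda>x. frechet_derivative (\<lambda>x. c * inverse x ^ n) (at x) v)" for v
      using Suc[of "- c * n * v" "Suc n"]
      by (subst Ck_on_cong[OF o]) (auto simp: frechet_derivative_at[OF 1, symmetric])
    with 1 show ?case by (auto simp: differentiable_def)
  qed
  from this[of _ 1 1] show ?thesis by (simp add: smooth_on_def)
qed

text \<open>With y = 1/x this is the domination of powers by the exponential at infinity. It makes
  the function used for bumps flat at the origin.\<close>

lemma exp_inverse_div_power_tendsto_0:
  "((\<lambda>x::real. exp (- inverse x) * inverse x ^ n) \<longlongrightarrow> 0) (at_right 0)"
proof -
  have "((\<lambda>y::real. y ^ n / exp y) \<longlongrightarrow> 0) at_top" by (rule tendsto_power_div_exp_0)
  then have "((\<lambda>x::real. inverse x ^ n / exp (inverse x)) \<longlongrightarrow> 0) (at_right 0)"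
    by (rule filterlim_compose) (rule filterlim_inverse_at_top_right)
  then show ?thesis by (simp add: exp_minus field_simps)
qed

text \<open>The family \<open>e\<^sup>-\<^sup>1\<^sup>/\<^sup>x / x\<^sup>n\<close>, extended by zero, is closed under
  differentiation up to linear combinations.\<close>

lemma smooth_on_exp_inverse:
  "smooth_on (UNIV::real set) (\<lambda>x. if x > 0 then exp (- inverse x) else 0)"
proof -
  define h where "h n x = (if x > 0 then exp (- inverse x) * inverse x ^ n else 0)" for n and x :: real
  have der: "(h n has_real_derivative (h (n+2) x - n * h (n+1) x)) (at x)" for n x
  proof -
    consider "x > 0" | "x < 0" | "x = 0" by linarith
    then show ?thesis
    proof cases
      case 1
      have "((\<lambda>x. exp (- inverse x) * inverse x ^ n) has_real_derivative (h (n+2) x - n * h (n+1) x)) (at x)"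
      proof (rule DERIV_cong[OF DERIV_mult'[OF _ DERIV_inverse_power]])
        show "((\<lambda>x. exp (- inverse x)) has_real_derivative exp (- inverse x) * inverse x ^ 2) (at x)"
          using 1 by (auto intro!: derivative_eq_intros simp: power2_eq_square)
      qed (use 1 in \<open>simp_all add: h_def algebra_simps power2_eq_square\<close>)
      then show ?thesis
        by (rule has_field_derivative_transform_within_open[where S="{0<..}"]) (use 1 in \<open>auto simp: h_def\<close>)
    next
      case 2
      have "((\<lambda>x. 0) has_real_derivative 0) (at x)" by simp
      then have "(h n has_real_derivative 0) (at x)"
        by (rule has_field_derivative_transform_within_open[where S="{..<0}"]) (use 2 in \<open>auto simp: h_def\<close>)
      then show ?thesis using 2 by (simp add: h_def)
    next
      case 3
      have "((\<lambda>y. (h n y - h n 0) / (y - 0)) \<longlongrightarrow> 0) (at 0)"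
        unfolding filterlim_at_split
      proof
        show "((\<lambda>y. (h n y - h n 0) / (y - 0)) \<longlongrightarrow> 0) (at_left 0)"
          by (rule tendsto_eventually) (auto simp: h_def eventually_at_left_field intro: exI[of _ "-1"])
        \<comment> \<open>For y > 0 the difference quotient at 0 is \<open>h (Suc n) y\<close>,
          hence the exponent in the limit that is used.\<close>
        show "((\<lambda>y. (h n y - h n 0) / (y - 0)) \<longlongrightarrow> 0) (at_right 0)"
          by (rule Lim_transform_eventually[OF exp_inverse_div_power_tendsto_0[of "Suc n"]])
            (auto simp: h_def eventually_at_right_field field_simps intro!: exI[of _ 1])
      qed
      then have "(h n has_real_derivative 0) (at 0)" by (simp add: has_field_derivative_iff)
      then show ?thesis using 3 by (simp add: h_def)
    qed
  qed
  have "Ck_on k UNIV (h n)" for k n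
  proof (induction k arbitrary: n)
    case 0
    have "isCont (h n) x" for x using DERIV_isCont der by blast
    then show ?case by (simp add: continuous_at_imp_continuous_on)
  next
    case (Suc k)
    have "frechet_derivative (h n) (at x) = (\<lambda>v. (h (n+2) x - n * h (n+1) x) * v)" for x
      using frechet_derivative_at[of "h n"] der by (metis has_field_derivative_def)
    moreover have "Ck_on k UNIV (\<lambda>x. (h (n+2) x + (- real n) * h (n+1) x) * v)" for v
      by (intro Ck_on_bilinear[OF bounded_bilinear_mult] Ck_on_add Ck_on_const Suc open_UNIV)
    moreover have "h n differentiable (at x)" for x
      using der has_field_derivative_def differentiable_def by blast
    ultimately show ?case by simp
  qed
  moreover have "h 0 = (\<lambda>x. if x > 0 then exp (- inverse x) else 0)" by (auto simp: h_def)
  ultimately show ?thesis unfolding smooth_on_def by metis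
qed

text \<open>The bump is F / (F + G). \<open>F\<close> is positive exactly where the distance to
  \<open>c\<close> is below 2r, and \<open>G\<close> exactly where it exceeds r; every point lies in
  one of these regions, so the denominator never vanishes.\<close>

lemma smooth_bump_exists:
  fixes c :: "'a::real_inner"
  assumes "r > 0"
  obtains \<beta> :: "'a \<Rightarrow> real"
  where "smooth_on UNIV \<beta>" "\<And>y. norm (y - c) < r \<Longrightarrow> \<beta> y = 1" "\<And>y. norm (y - c) \<ge> 2 * r \<Longrightarrow> \<beta> y = 0"
proof -
  define h where "h x = (if x > 0 then exp (- inverse x) else 0)" for x :: real
  have h: "smooth_on UNIV h" using smooth_on_exp_inverse by (simp add: h_def[abs_def])
  have hpos: "h x \<ge> 0" "x > 0 \<Longrightarrow> h x > 0" for x by (auto simp: h_def)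
  have fd: "finite_dimensional TYPE(real)" by (rule finite_dimensional_euclidean)
  \<comment> \<open>The squared distance is smooth also at \<open>c\<close>, where the norm need not
    be; the radii accordingly appear squared below.\<close>
  define q where "q y = (y - c) \<bullet> (y - c)" for y :: 'a
  have "smooth_on UNIV q"
    unfolding q_def by (intro smooth_on_inner smooth_on_minus smooth_on_id smooth_on_const open_UNIV)
  define F where "F y = h (4 * r\<^sup>2 - q y)" for y
  define G where "G y = h (q y - r\<^sup>2)" for y
  have F: "smooth_on UNIV F" unfolding F_def
    by (rule smooth_on_compose[OF fd _ _ _ h]) (auto intro!: smooth_on_minus smooth_on_const \<open>smooth_on UNIV q\<close>)
  have G: "smooth_on UNIV G" unfolding G_def
    by (rule smooth_on_compose[OF fd _ _ _ h]) (auto intro!: smooth_on_minus smooth_on_const \<open>smooth_on UNIV q\<close>)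
  have qn: "q y = (norm (y - c))\<^sup>2" for y by (simp add: q_def dot_square_norm)
  have pos: "F y + G y \<noteq> 0" for y
  proof (cases "q y < 4 * r\<^sup>2")
    case True
    then have "F y > 0" by (simp add: F_def hpos)
    then show ?thesis using hpos(1)[of "q y - r\<^sup>2"] by (simp add: G_def)
  next
    case False
    moreover have "r\<^sup>2 > 0" using assms by simp
    ultimately have "q y - r\<^sup>2 > 0" by linarith
    then have "G y > 0" unfolding G_def by (rule hpos)
    then show ?thesis using hpos(1)[of "4 * r\<^sup>2 - q y"] by (simp add: F_def)
  qed
  define \<beta> where "\<beta> y = F y * inverse (F y + G y)" for y
  have o: "open {x::real. x \<noteq> 0}" by (rule open_Collect_neq) (auto intro: continuous_intros)
  have "smooth_on UNIV (\<lambda>y. inverse (F y + G y))"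
    by (rule smooth_on_compose[OF fd _ o _ smooth_on_real_inverse]) (use pos in \<open>auto intro: smooth_on_add F G\<close>)
  then have 1: "smooth_on UNIV \<beta>" unfolding \<beta>_def by (intro smooth_on_mult F open_UNIV)
  have 2: "\<beta> y = 1" if "norm (y - c) < r" for y
  proof -
    have "q y < r\<^sup>2" using that by (simp add: qn power_strict_mono)
    then have "G y = 0" by (simp add: G_def h_def)
    then show ?thesis using pos[of y] by (simp add: \<beta>_def)
  qed
  have 3: "\<beta> y = 0" if "norm (y - c) \<ge> 2 * r" for y
  proof -
    have "(2 * r)\<^sup>2 \<le> q y" unfolding qn using that assms by (intro power_mono) auto
    then have "F y = 0" by (simp add: F_def h_def)
    then show ?thesis by (simp add: \<beta>_def)
  qed
  show ?thesis using that[OF 1 2 3] by blast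
qed

text \<open>In the class \<open>real_inner\<close> closed bounded sets need not be compact, so the
  claim is reduced to the real line. The vectors whose coefficients in an orthonormal basis are
  bounded by \<open>r\<close> form a compact set, built up by adding one interval of coefficients at
  a time, and by Cauchy-Schwarz the ball is a closed part of it.\<close>

lemma finite_dimensional_compact_cball:
  fixes c :: "'a::real_inner"
  assumes "finite_dimensional TYPE('a)"
  shows "compact (cball c r)"
proof -
  obtain B :: "'a set" where B: "orthonormal_basis B"
    using finite_dimensional_orthonormal_basis[OF assms] .
  have box: "compact {\<Sum>b\<in>C. t b *\<^sub>R b |t. \<forall>b\<in>C. \<bar>t b\<bar> \<le> r}" if "finite C" for C :: "'a set"
    using that
  proof (induction C)
    case (insert a C)
    let ?K = "{\<Sum>b\<in>C. t b *\<^sub>R b |t. \<forall>b\<in>C. \<bar>t b\<bar> \<le> r}"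
    have "compact ((\<lambda>(s, k). s *\<^sub>R a + k) ` ({-r..r} \<times> ?K))"
      by (intro compact_continuous_image compact_Times insert.IH compact_Icc)
        (auto intro!: continuous_intros simp: case_prod_unfold)
    also have "(\<lambda>(s, k). s *\<^sub>R a + k) ` ({-r..r} \<times> ?K) =
        {\<Sum>b\<in>insert a C. t b *\<^sub>R b |t. \<forall>b\<in>insert a C. \<bar>t b\<bar> \<le> r}" (is "?L = ?R")
    proof
      show "?L \<subseteq> ?R"
      proof
        fix z assume "z \<in> ?L"
        then obtain s t where s: "s \<in> {-r..r}" and t: "\<forall>b\<in>C. \<bar>t b\<bar> \<le> r"
          and z: "z = s *\<^sub>R a + (\<Sum>b\<in>C. t b *\<^sub>R b)" by auto
        define u where "u = t(a := s)"
        have "(\<Sum>b\<in>C. u b *\<^sub>R b) = (\<Sum>b\<in>C. t b *\<^sub>R b)"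
          using insert.hyps by (intro sum.cong) (auto simp: u_def)
        then have "z = (\<Sum>b\<in>insert a C. u b *\<^sub>R b)"
          using insert.hyps z by (simp add: u_def)
        moreover have "\<forall>b\<in>insert a C. \<bar>u b\<bar> \<le> r" using s t by (auto simp: u_def)
        ultimately show "z \<in> ?R" by blast
      qed
      show "?R \<subseteq> ?L"
      proof safe
        fix t assume t: "\<forall>b\<in>insert a C. \<bar>t b\<bar> \<le> r"
        have "(t a, \<Sum>b\<in>C. t b *\<^sub>R b) \<in> {-r..r} \<times> ?K" using t by (auto simp: abs_le_iff)
        then show "(\<Sum>b\<in>insert a C. t b *\<^sub>R b) \<in> ?L" using insert.hyps
          by (intro image_eqI[where x="(t a, \<Sum>b\<in>C. t b *\<^sub>R b)"]) auto
      qed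
    qed
    finally show ?case .
  qed simp
  have "cball 0 r \<subseteq> {\<Sum>b\<in>B. t b *\<^sub>R b |t. \<forall>b\<in>B. \<bar>t b\<bar> \<le> r}"
  proof
    fix x :: 'a assume x: "x \<in> cball 0 r"
    have "\<bar>x \<bullet> b\<bar> \<le> r" if "b \<in> B" for b
    proof -
      have "norm b = 1" using orthonormal_basisD(3)[OF B that that] by (simp add: norm_eq_1)
      then show ?thesis using Cauchy_Schwarz_ineq2[of x b] x by simp
    qed
    then show "x \<in> {\<Sum>b\<in>B. t b *\<^sub>R b |t. \<forall>b\<in>B. \<bar>t b\<bar> \<le> r}"
      using orthonormal_basisD(2)[OF B, of x] by (auto intro!: exI[of _ "\<lambda>b. x \<bullet> b"])
  qed
  then have "compact (cball 0 r :: 'a set)"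
    using compact_Int_closed[OF box[OF orthonormal_basisD(1)[OF B]] closed_cball, of 0 r]
    by (simp add: Int_absorb1)
  then have "compact ((+) c ` cball 0 r)" by (rule compact_translation)
  then show ?thesis by (simp add: cball_translation)
qed

subsection \<open>Atlases and smooth maps\<close>

text \<open>The part of \<open>smooth_manifold\<close> that determines the chart topology. Bundle
  charts are shown to satisfy this much, which is enough to speak of smooth maps between total
  spaces.\<close>

definition pre_atlas :: "('m, 'e::real_inner) atlas \<Rightarrow> bool" where
  "pre_atlas N \<longleftrightarrow> (\<forall>(U, \<phi>)\<in>N. inj_on \<phi> U \<and> open (\<phi> ` U))"

lemma pre_atlasD: "pre_atlas N \<Longrightarrow> (U, \<phi>) \<in> N \<Longrightarrow> inj_on \<phi> U" "pre_atlas N \<Longrightarrow> (U, \<phi>) \<in> N \<Longrightarrow> open (\<phi> ` U)"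
  by (auto simp: pre_atlas_def)

lemma chart_points: "(U, \<phi>) \<in> N \<Longrightarrow> U \<subseteq> points N"
  by (auto simp: points_def)

lemma openin_atlas_topology:
  assumes "pre_atlas N"
  shows "openin (atlas_topology N) = atlas_open N"
  unfolding atlas_topology_def
  by (rule topology_inverse'[OF istopology_atlas_open]) (use assms in \<open>auto simp: pre_atlas_def\<close>)

lemma atlas_openD: "atlas_open N W \<Longrightarrow> (U, \<phi>) \<in> N \<Longrightarrow> open (\<phi> ` (W \<inter> U))"
  "atlas_open N W \<Longrightarrow> W \<subseteq> points N"
  by (auto simp: atlas_open_def)

lemma atlas_open_points: "pre_atlas N \<Longrightarrow> atlas_open N (points N)"
proof -
  assume N: "pre_atlas N"
  have "points N \<inter> U = U" if "(U, \<phi>) \<in> N" for U \<phi> using chart_points[OF that] by auto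
  then show ?thesis using N by (auto simp: atlas_open_def pre_atlas_def)
qed

lemma topspace_atlas_topology: "pre_atlas N \<Longrightarrow> topspace (atlas_topology N) = points N"
  by (metis atlas_openD(2) atlas_open_points openin_atlas_topology openin_subset openin_topspace subset_antisym)

lemma atlas_open_Int: "pre_atlas N \<Longrightarrow> atlas_open N S \<Longrightarrow> atlas_open N T \<Longrightarrow> atlas_open N (S \<inter> T)"
  by (metis openin_Int openin_atlas_topology)

lemma smooth_manifold_pre_atlas: "smooth_manifold N \<Longrightarrow> pre_atlas N"
  by (auto simp: smooth_manifold_def pre_atlas_def)

text \<open>Continuity comes for free: in a source chart the preimage of an open set is the union,
  over the target charts, of preimages under the coordinate expressions
  \<open>\<psi> \<circ> F \<circ> inv_into U \<phi>\<close>, which are continuous on open sets by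
  \<open>sm\<close> and \<open>op\<close>.\<close>

lemma smooth_mapI:
  fixes N :: "('m, 'e::real_inner) atlas" and P :: "('n, 'g::real_inner) atlas"
  assumes N: "pre_atlas N" and P: "pre_atlas P"
    and F: "\<And>p. p \<in> points N \<Longrightarrow> F p \<in> points P"
    and op: "\<And>U \<phi> V \<psi>. (U, \<phi>) \<in> N \<Longrightarrow> (V, \<psi>) \<in> P \<Longrightarrow> open (\<phi> ` (U \<inter> F -` V))"
    and sm: "\<And>U \<phi> V \<psi>. (U, \<phi>) \<in> N \<Longrightarrow> (V, \<psi>) \<in> P \<Longrightarrow>
       smooth_on (\<phi> ` (U \<inter> F -` V)) (\<psi> \<circ> F \<circ> inv_into U \<phi>)"
  shows "smooth_map N P F"
  unfolding smooth_map_def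
proof
  show "continuous_map (atlas_topology N) (atlas_topology P) F"
    unfolding continuous_map topspace_atlas_topology[OF N] topspace_atlas_topology[OF P]
      openin_atlas_topology[OF N] openin_atlas_topology[OF P]
  proof (intro conjI allI impI)
    show "F ` points N \<subseteq> points P" using F by auto
    fix W assume W: "atlas_open P W"
    show "atlas_open N {p \<in> points N. F p \<in> W}"
      unfolding atlas_open_def
    proof (intro conjI ballI)
      fix c assume "c \<in> N"
      then obtain U \<phi> where c: "c = (U, \<phi>)" "(U, \<phi>) \<in> N" by (cases c) auto
      note inj = pre_atlasD(1)[OF N c(2)]
      let ?O = "\<lambda>(V, \<psi>). {y \<in> \<phi> ` (U \<inter> F -` V). (\<psi> \<circ> F \<circ> inv_into U \<phi>) y \<in> \<psi> ` (W \<inter> V)}"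
      have "\<phi> ` ({p \<in> points N. F p \<in> W} \<inter> U) = (\<Union>d\<in>P. ?O d)"
      proof
        show "\<phi> ` ({p \<in> points N. F p \<in> W} \<inter> U) \<subseteq> (\<Union>d\<in>P. ?O d)"
        proof clarify
          fix p assume p: "p \<in> points N" "p \<in> U" "F p \<in> W"
          then obtain V \<psi> where V: "(V, \<psi>) \<in> P" "F p \<in> V" using F by (fastforce simp: points_def)
          then have "\<phi> p \<in> ?O (V, \<psi>)" using p inj by auto
          with V show "\<phi> p \<in> (\<Union>d\<in>P. ?O d)" by blast
        qed
        show "(\<Union>d\<in>P. ?O d) \<subseteq> \<phi> ` ({p \<in> points N. F p \<in> W} \<inter> U)"
        proof
          fix y assume "y \<in> (\<Union>d\<in>P. ?O d)"
          then obtain V \<psi> where V: "(V, \<psi>) \<in> P" and y: "y \<in> ?O (V, \<psi>)" by fast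
          then obtain p where p: "p \<in> U" "F p \<in> V" "y = \<phi> p" by auto
          with y obtain w where w: "w \<in> W" "w \<in> V" "\<psi> (F p) = \<psi> w" using inj by auto
          then have "F p = w" using pre_atlasD(1)[OF P V] p(2) by (auto dest: inj_onD)
          with w p chart_points[OF c(2)] show "y \<in> \<phi> ` ({p \<in> points N. F p \<in> W} \<inter> U)" by auto
        qed
      qed
      moreover have "open (?O d)" if "d \<in> P" for d
      proof -
        obtain V \<psi> where d: "d = (V, \<psi>)" by (cases d)
        with that have V: "(V, \<psi>) \<in> P" by simp
        show ?thesis unfolding d prod.case
          by (rule open_continuous_Int_vimage[OF smooth_on_continuous[OF sm[OF c(2) V]] op[OF c(2) V] atlas_openD(1)[OF W V]])
      qed
      ultimately show "case c of (U, \<phi>) \<Rightarrow> open (\<phi> ` ({p \<in> points N. F p \<in> W} \<inter> U))"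
        by (auto simp: c)
    qed auto
  qed
qed (use sm in auto)

lemma pre_atlas_euclid: "pre_atlas euclid"
  by (auto simp: pre_atlas_def euclid_def)

lemma points_euclid: "points euclid = UNIV"
  by (auto simp: points_def euclid_def)

lemma smooth_map_euclid_iff:
  fixes f :: "'m \<Rightarrow> 'g::real_inner"
  assumes "pre_atlas N"
  shows "smooth_map N euclid f \<longleftrightarrow> (\<forall>(U, \<phi>)\<in>N. smooth_on (\<phi> ` U) (f \<circ> inv_into U \<phi>))"
proof
  assume "smooth_map N euclid f"
  then have *: "smooth_on (\<phi> ` (U \<inter> f -` V)) (\<psi> \<circ> f \<circ> inv_into U \<phi>)"
    if "(U, \<phi>) \<in> N" "(V, \<psi>) \<in> euclid" for U \<phi> V \<psi>
    using that unfolding smooth_map_def by blast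
  have "smooth_on (\<phi> ` U) (f \<circ> inv_into U \<phi>)" if "(U, \<phi>) \<in> N" for U \<phi>
    using *[OF that, of UNIV id] by (simp add: euclid_def)
  then show "\<forall>(U, \<phi>)\<in>N. smooth_on (\<phi> ` U) (f \<circ> inv_into U \<phi>)" by blast
next
  assume *: "\<forall>(U, \<phi>)\<in>N. smooth_on (\<phi> ` U) (f \<circ> inv_into U \<phi>)"
  show "smooth_map N euclid f"
    by (rule smooth_mapI[OF assms pre_atlas_euclid])
      (use * assms in \<open>simp_all add: points_euclid, auto simp: euclid_def pre_atlas_def\<close>)
qed

lemma smooth_functions_iff:
  "pre_atlas N \<Longrightarrow> f \<in> smooth_functions N \<longleftrightarrow> (\<forall>(U, \<phi>)\<in>N. smooth_on (\<phi> ` U) (f \<circ> inv_into U \<phi>))"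
  by (simp add: smooth_functions_def smooth_map_euclid_iff)

lemma smooth_functionsD:
  "pre_atlas N \<Longrightarrow> f \<in> smooth_functions N \<Longrightarrow> (U, \<phi>) \<in> N \<Longrightarrow> smooth_on (\<phi> ` U) (f \<circ> inv_into U \<phi>)"
  by (auto simp: smooth_functions_iff)

lemma smooth_functions_cong:
  assumes "pre_atlas N" "f \<in> smooth_functions N" "\<And>p. p \<in> points N \<Longrightarrow> f p = g p"
  shows "g \<in> smooth_functions N"
  unfolding smooth_functions_iff[OF assms(1)]
proof safe
  fix U \<phi> assume c: "(U, \<phi>) \<in> N"
  have "(f \<circ> inv_into U \<phi>) y = (g \<circ> inv_into U \<phi>) y" if "y \<in> \<phi> ` U" for y
    using that assms(3) chart_points[OF c] inv_into_into[OF that] by auto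
  then show "smooth_on (\<phi> ` U) (g \<circ> inv_into U \<phi>)"
    using smooth_on_cong[OF pre_atlasD(2)[OF assms(1) c]] smooth_functionsD[OF assms(1,2) c] by blast
qed

lemma smooth_functions_const: "pre_atlas N \<Longrightarrow> (\<lambda>_. r) \<in> smooth_functions N"
  by (auto simp: smooth_functions_iff o_def smooth_on_const)

lemma smooth_functions_add:
  "pre_atlas N \<Longrightarrow> f \<in> smooth_functions N \<Longrightarrow> g \<in> smooth_functions N \<Longrightarrow> (\<lambda>p. f p + g p) \<in> smooth_functions N"
  by (auto simp: smooth_functions_iff o_def pre_atlasD intro!: smooth_on_add)

lemma smooth_functions_mult:
  "pre_atlas N \<Longrightarrow> f \<in> smooth_functions N \<Longrightarrow> g \<in> smooth_functions N \<Longrightarrow> (\<lambda>p. f p * g p) \<in> smooth_functions N"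
  by (auto simp: smooth_functions_iff o_def pre_atlasD intro!: smooth_on_mult)

lemma smooth_functions_sum:
  "pre_atlas N \<Longrightarrow> finite B \<Longrightarrow> (\<And>b. b \<in> B \<Longrightarrow> f b \<in> smooth_functions N) \<Longrightarrow> (\<lambda>p. \<Sum>b\<in>B. f b p) \<in> smooth_functions N"
  by (auto simp: smooth_functions_iff o_def pre_atlasD intro!: smooth_on_sum)

lemma smooth_functions_diff:
  "pre_atlas N \<Longrightarrow> f \<in> smooth_functions N \<Longrightarrow> g \<in> smooth_functions N \<Longrightarrow> (\<lambda>p. f p - g p) \<in> smooth_functions N"
  by (auto simp: smooth_functions_iff o_def pre_atlasD intro!: smooth_on_minus)

section \<open>Local smoothness and cutoff functions on a manifold\<close>

lemma smooth_manifold_transition: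
  assumes "smooth_manifold N" "(U, \<phi>) \<in> N" "(V, \<psi>) \<in> N"
  shows "open (\<phi> ` (U \<inter> V))" "smooth_on (\<phi> ` (U \<inter> V)) (\<psi> \<circ> inv_into U \<phi>)"
  using assms unfolding smooth_manifold_def by blast+

lemma smooth_manifold_fd: "smooth_manifold (N :: ('m, 'e::real_inner) atlas) \<Longrightarrow> finite_dimensional TYPE('e)"
  by (simp add: smooth_manifold_def)

text \<open>Openness has to be verified in every chart of the atlas; in another chart the set
  becomes a preimage under the continuous transition map.\<close>

lemma chart_preimage_open:
  assumes N: "smooth_manifold N" and c: "(U, \<phi>) \<in> N" and S: "open S"
  shows "atlas_open N {p \<in> U. \<phi> p \<in> S}"
  unfolding atlas_open_def
proof (intro conjI ballI)
  show "{p \<in> U. \<phi> p \<in> S} \<subseteq> points N" using chart_points[OF c] by auto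
  fix d assume "d \<in> N"
  then obtain V \<psi> where d: "d = (V, \<psi>)" "(V, \<psi>) \<in> N" by (cases d) auto
  have inj: "inj_on \<psi> V" using pre_atlasD(1)[OF smooth_manifold_pre_atlas[OF N] d(2)] .
  note t = smooth_manifold_transition[OF N d(2) c]
  have "\<psi> ` ({p \<in> U. \<phi> p \<in> S} \<inter> V) = {z \<in> \<psi> ` (V \<inter> U). (\<phi> \<circ> inv_into V \<psi>) z \<in> S}"
    using inj by (auto simp: image_iff)
  also have "open \<dots>" by (rule open_continuous_Int_vimage[OF smooth_on_continuous[OF t(2)] t(1) S])
  finally show "case d of (V, \<psi>) \<Rightarrow> open (\<psi> ` ({p \<in> U. \<phi> p \<in> S} \<inter> V))"
    by (simp add: d)
qed

lemma chart_domain_open: "smooth_manifold N \<Longrightarrow> (U, \<phi>) \<in> N \<Longrightarrow> atlas_open N U"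
  using chart_preimage_open[of N U \<phi> UNIV] by simp

text \<open>Smoothness of a germ, exhibited in a single chart; \<open>smooth_near_chart\<close>
  transfers it to every chart around the point. Functions patched together from pieces can thus be
  checked point by point, each piece in its own chart.\<close>

definition smooth_near :: "('m, 'e::real_inner) atlas \<Rightarrow> 'm \<Rightarrow> ('m \<Rightarrow> 'g::real_inner) \<Rightarrow> bool" where
  "smooth_near N p f \<longleftrightarrow>
     (\<exists>U \<phi> S. (U, \<phi>) \<in> N \<and> p \<in> U \<and> open S \<and> \<phi> p \<in> S \<and> S \<subseteq> \<phi> ` U \<and> smooth_on S (f \<circ> inv_into U \<phi>))"

lemma smooth_near_chart:
  assumes N: "smooth_manifold N" and c: "(V, \<psi>) \<in> N" "p \<in> V" and f: "smooth_near N p f"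
  shows "\<exists>S. open S \<and> \<psi> p \<in> S \<and> S \<subseteq> \<psi> ` V \<and> smooth_on S (f \<circ> inv_into V \<psi>)"
proof -
  obtain U \<phi> S where U: "(U, \<phi>) \<in> N" "p \<in> U" "open S" "\<phi> p \<in> S" "S \<subseteq> \<phi> ` U"
    "smooth_on S (f \<circ> inv_into U \<phi>)" using f by (auto simp: smooth_near_def)
  have iU: "inj_on \<phi> U" and iV: "inj_on \<psi> V"
    using pre_atlasD(1)[OF smooth_manifold_pre_atlas[OF N]] U c by auto
  note t = smooth_manifold_transition[OF N c(1) U(1)]
  define T where "T = {z \<in> \<psi> ` (V \<inter> U). (\<phi> \<circ> inv_into V \<psi>) z \<in> S}"
  have T: "open T" unfolding T_def by (rule open_continuous_Int_vimage[OF smooth_on_continuous[OF t(2)] t(1) U(3)])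
  have "smooth_on T (\<phi> \<circ> inv_into V \<psi>)" by (rule smooth_on_subset[OF t(2)]) (auto simp: T_def)
  then have "smooth_on T (\<lambda>z. (f \<circ> inv_into U \<phi>) ((\<phi> \<circ> inv_into V \<psi>) z))"
    by (rule smooth_on_compose[OF smooth_manifold_fd[OF N] T U(3) _ U(6)]) (auto simp: T_def)
  moreover have "(f \<circ> inv_into U \<phi>) ((\<phi> \<circ> inv_into V \<psi>) z) = (f \<circ> inv_into V \<psi>) z" if "z \<in> T" for z
    using that iU iV by (auto simp: T_def)
  ultimately have "smooth_on T (f \<circ> inv_into V \<psi>)" using smooth_on_cong[OF T] by metis
  moreover have "\<psi> p \<in> T" using U c iV by (auto simp: T_def)
  ultimately show ?thesis using T by (intro exI[of _ T]) (auto simp: T_def)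
qed

lemma smooth_functions_iff_near:
  assumes N: "smooth_manifold N"
  shows "f \<in> smooth_functions N \<longleftrightarrow> (\<forall>p\<in>points N. smooth_near N p f)"
proof
  assume f: "f \<in> smooth_functions N"
  show "\<forall>p\<in>points N. smooth_near N p f"
  proof
    fix p assume "p \<in> points N"
    then obtain U \<phi> where "(U, \<phi>) \<in> N" "p \<in> U" by (auto simp: points_def)
    then show "smooth_near N p f"
      using smooth_functionsD[OF _ f] pre_atlasD(2) smooth_manifold_pre_atlas[OF N]
      unfolding smooth_near_def by (intro exI[of _ U] exI[of _ \<phi>] exI[of _ "\<phi> ` U"]) auto
  qed
next
  assume f: "\<forall>p\<in>points N. smooth_near N p f"
  show "f \<in> smooth_functions N"
    unfolding smooth_functions_iff[OF smooth_manifold_pre_atlas[OF N]]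
  proof safe
    fix U \<phi> assume c: "(U, \<phi>) \<in> N"
    show "smooth_on (\<phi> ` U) (f \<circ> inv_into U \<phi>)"
    proof (rule smooth_on_local)
      fix y assume "y \<in> \<phi> ` U"
      then obtain p where "p \<in> U" "y = \<phi> p" by auto
      then show "\<exists>T. open T \<and> y \<in> T \<and> smooth_on T (f \<circ> inv_into U \<phi>)"
        using smooth_near_chart[OF N c, of p f] f chart_points[OF c] by blast
    qed
  qed
qed

lemma smooth_near_cong:
  assumes N: "smooth_manifold N" and W: "atlas_open N W" "p \<in> W" and fg: "\<And>q. q \<in> W \<Longrightarrow> f q = g q"
    and f: "smooth_near N p f"
  shows "smooth_near N p g"
proof -
  obtain U \<phi> S where U: "(U, \<phi>) \<in> N" "p \<in> U" "open S" "\<phi> p \<in> S" "S \<subseteq> \<phi> ` U"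
    "smooth_on S (f \<circ> inv_into U \<phi>)" using f by (auto simp: smooth_near_def)
  have iU: "inj_on \<phi> U" using pre_atlasD(1)[OF smooth_manifold_pre_atlas[OF N]] U by auto
  let ?T = "S \<inter> \<phi> ` (W \<inter> U)"
  have T: "open ?T" using U(3) atlas_openD(1)[OF W(1) U(1)] by auto
  have "smooth_on ?T (f \<circ> inv_into U \<phi>)" using smooth_on_subset[OF U(6)] by auto
  moreover have "(f \<circ> inv_into U \<phi>) z = (g \<circ> inv_into U \<phi>) z" if "z \<in> ?T" for z
    using that iU fg by auto
  ultimately have "smooth_on ?T (g \<circ> inv_into U \<phi>)" using smooth_on_cong[OF T] by metis
  then show ?thesis unfolding smooth_near_def using U W T
    by (intro exI[of _ U] exI[of _ \<phi>] exI[of _ ?T]) auto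
qed

lemma smooth_near_mult:
  fixes f g :: "'m \<Rightarrow> real"
  assumes N: "smooth_manifold N" and f: "smooth_near N p f" and g: "smooth_near N p g"
  shows "smooth_near N p (\<lambda>q. f q * g q)"
proof -
  obtain U \<phi> S where U: "(U, \<phi>) \<in> N" "p \<in> U" "open S" "\<phi> p \<in> S" "S \<subseteq> \<phi> ` U"
    "smooth_on S (f \<circ> inv_into U \<phi>)" using f by (auto simp: smooth_near_def)
  obtain T where T: "open T" "\<phi> p \<in> T" "smooth_on T (g \<circ> inv_into U \<phi>)"
    using smooth_near_chart[OF N U(1,2) g] by auto
  have "smooth_on (S \<inter> T) (\<lambda>z. (f \<circ> inv_into U \<phi>) z * (g \<circ> inv_into U \<phi>) z)"
    by (intro smooth_on_mult open_Int smooth_on_subset[OF U(6)] smooth_on_subset[OF T(3)] U(3) T(1)) auto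
  then show ?thesis unfolding smooth_near_def using U T
    by (intro exI[of _ U] exI[of _ \<phi>] exI[of _ "S \<inter> T"]) (auto simp: o_def)
qed

text \<open>The open sets \<open>W\<close> and the complement of \<open>K\<close> cover the
  manifold: on the first the function is a product of smooth functions, on the second it is
  zero.\<close>

lemma smooth_cutoff:
  fixes \<kappa> g :: "'m \<Rightarrow> real"
  assumes N: "smooth_manifold N" and \<kappa>: "\<kappa> \<in> smooth_functions N"
    and K: "closedin (atlas_topology N) K" "\<And>q. q \<in> points N - K \<Longrightarrow> \<kappa> q = 0"
    and W: "atlas_open N W" "K \<subseteq> W" and g: "\<And>p. p \<in> W \<Longrightarrow> smooth_near N p g"
  shows "(\<lambda>q. if q \<in> W then \<kappa> q * g q else 0) \<in> smooth_functions N" (is "?h \<in> _")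
  unfolding smooth_functions_iff_near[OF N]
proof
  note preN = smooth_manifold_pre_atlas[OF N]
  fix p assume p: "p \<in> points N"
  show "smooth_near N p ?h"
  proof (cases "p \<in> W")
    case True
    have "smooth_near N p (\<lambda>q. \<kappa> q * g q)"
      using smooth_near_mult[OF N] g[OF True] \<kappa> p smooth_functions_iff_near[OF N] by blast
    then show ?thesis by (rule smooth_near_cong[OF N W(1) True, rotated]) auto
  next
    case False
    have o: "atlas_open N (points N - K)"
      using K(1) openin_diff[OF openin_topspace K(1)] openin_atlas_topology[OF preN] topspace_atlas_topology[OF preN] by auto
    have "smooth_near N p (\<lambda>_. 0::real)"
      using smooth_functions_const[OF preN] p smooth_functions_iff_near[OF N] by blast
    then show ?thesis by (rule smooth_near_cong[OF N o, rotated 2]) (use False p W K in auto)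
  qed
qed

text \<open>A bump in a coordinate ball is extended by zero. Smoothness away from the chart domain
  requires the closed coordinate ball \<open>K\<close> to be closed in \<open>N\<close>; it is
  compact, hence closed because the atlas topology is Hausdorff.\<close>

lemma manifold_bump_exists:
  assumes N: "smooth_manifold (N :: ('m, 'e::real_inner) atlas)" and W: "atlas_open N W" "p \<in> W"
  obtains \<kappa> V K where "\<kappa> \<in> smooth_functions N" "atlas_open N V" "p \<in> V" "V \<subseteq> K" "K \<subseteq> W"
    "closedin (atlas_topology N) K" "\<And>q. q \<in> V \<Longrightarrow> \<kappa> q = 1" "\<And>q. q \<in> points N - K \<Longrightarrow> \<kappa> q = 0"
proof -
  note preN = smooth_manifold_pre_atlas[OF N]
  have fd: "finite_dimensional TYPE('e)" by (rule smooth_manifold_fd[OF N])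
  obtain U \<phi> where U: "(U, \<phi>) \<in> N" "p \<in> U" using W atlas_openD(2) by (fastforce simp: points_def)
  note inj = pre_atlasD(1)[OF preN U(1)]
  have o: "open (\<phi> ` (W \<inter> U))" by (rule atlas_openD(1)[OF W(1) U(1)])
  then obtain \<epsilon> where \<epsilon>: "\<epsilon> > 0" "ball (\<phi> p) \<epsilon> \<subseteq> \<phi> ` (W \<inter> U)"
  proof -
    have "\<phi> p \<in> \<phi> ` (W \<inter> U)" using W(2) U(2) by auto
    then show ?thesis using o that unfolding open_contains_ball by blast
  qed
  \<comment> \<open>The bump is supported in the closed ball of radius 2r; dividing by 3 keeps this
    ball inside the coordinate ball of radius \<epsilon>.\<close>
  define r where "r = \<epsilon> / 3"
  have r: "r > 0" "2 * r < \<epsilon>" using \<epsilon>(1) by (simp_all add: r_def)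
  obtain \<beta> where \<beta>: "smooth_on UNIV \<beta>" "\<And>y. norm (y - \<phi> p) < r \<Longrightarrow> \<beta> y = 1"
    "\<And>y. norm (y - \<phi> p) \<ge> 2 * r \<Longrightarrow> \<beta> y = (0::real)" by (rule smooth_bump_exists[OF r(1)]) (rule that)
  let ?B = "cball (\<phi> p) (2 * r)"
  define K where "K = inv_into U \<phi> ` ?B"
  have BU: "?B \<subseteq> \<phi> ` (W \<inter> U)" using \<epsilon> r by (auto simp: subset_iff)
  then have BU': "?B \<subseteq> \<phi> ` U" by auto
  have KW: "K \<subseteq> W \<inter> U" using BU inj by (auto simp: K_def)
  \<comment> \<open>The inverse chart is continuous for the atlas topology, so it carries the
    compact coordinate ball to a compact set.\<close>
  have "continuous_map (top_of_set (\<phi> ` U)) (atlas_topology N) (inv_into U \<phi>)"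
    unfolding continuous_map topspace_atlas_topology[OF preN] openin_atlas_topology[OF preN]
  proof (intro conjI allI impI)
    show "inv_into U \<phi> ` topspace (top_of_set (\<phi> ` U)) \<subseteq> points N"
      using chart_points[OF U(1)] inj by auto
    fix Q assume "atlas_open N Q"
    then have "open (\<phi> ` (Q \<inter> U))" using atlas_openD(1) U(1) by blast
    moreover have "{x \<in> topspace (top_of_set (\<phi> ` U)). inv_into U \<phi> x \<in> Q} = \<phi> ` U \<inter> \<phi> ` (Q \<inter> U)"
      using inj by auto
    ultimately show "openin (top_of_set (\<phi> ` U)) {x \<in> topspace (top_of_set (\<phi> ` U)). inv_into U \<phi> x \<in> Q}"
      by (metis openin_open_Int)
  qed
  moreover have "compactin (top_of_set (\<phi> ` U)) ?B"
    using finite_dimensional_compact_cball[OF fd] BU' by (simp add: compactin_subtopology)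
  ultimately have "compactin (atlas_topology N) K" unfolding K_def by (rule image_compactin[rotated])
  moreover have "Hausdorff_space (atlas_topology N)" using N by (simp add: smooth_manifold_def)
  ultimately have cl: "closedin (atlas_topology N) K" by (rule compactin_imp_closedin[rotated])
  define \<kappa> where "\<kappa> q = (if q \<in> U then \<beta> (\<phi> q) else 0)" for q
  have Uo: "atlas_open N U" by (rule chart_domain_open[OF N U(1)])
  have s1: "smooth_near N q \<kappa>" if "q \<in> U" for q
  proof -
    have oU: "open (\<phi> ` U)" by (rule pre_atlasD(2)[OF preN U(1)])
    have "smooth_on (\<phi> ` U) (\<kappa> \<circ> inv_into U \<phi>)"
      using smooth_on_subset[OF \<beta>(1), of "\<phi> ` U"] inj
      by (subst smooth_on_cong[OF oU, of _ \<beta>]) (auto simp: \<kappa>_def)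
    then show ?thesis unfolding smooth_near_def using U(1) that oU
      by (intro exI[of _ U] exI[of _ \<phi>] exI[of _ "\<phi> ` U"]) auto
  qed
  have z: "\<kappa> q = 0" if "q \<in> points N - K" for q
  proof (cases "q \<in> U")
    case True
    then have "\<phi> q \<notin> ?B" using that inj by (force simp: K_def)
    then show ?thesis using \<beta>(3)[of "\<phi> q"] True by (simp add: \<kappa>_def dist_norm norm_minus_commute)
  qed (simp add: \<kappa>_def)
  have "\<kappa> \<in> smooth_functions N"
    unfolding smooth_functions_iff_near[OF N]
  proof
    fix q assume q: "q \<in> points N"
    show "smooth_near N q \<kappa>"
    proof (cases "q \<in> U")
      case False
      have o: "atlas_open N (points N - K)"
        using openin_diff[OF openin_topspace cl] openin_atlas_topology[OF preN] topspace_atlas_topology[OF preN] by auto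
      have "smooth_near N q (\<lambda>_. 0::real)"
        using smooth_functions_const[OF preN] q smooth_functions_iff_near[OF N] by blast
      then show ?thesis by (rule smooth_near_cong[OF N o, rotated 2]) (use False q KW z in auto)
    qed (rule s1)
  qed
  moreover define V where "V = {q \<in> U. \<phi> q \<in> ball (\<phi> p) r}"
  moreover have "atlas_open N V" unfolding V_def by (rule chart_preimage_open[OF N U(1) open_ball])
  moreover have "p \<in> V" using U r by (simp add: V_def)
  moreover have "V \<subseteq> K"
  proof
    fix q assume q: "q \<in> V"
    then have "\<phi> q \<in> ?B" using r by (auto simp: V_def)
    moreover have "q = inv_into U \<phi> (\<phi> q)" using q inj by (simp add: V_def)
    ultimately show "q \<in> K" unfolding K_def by blast
  qed
  moreover have "\<kappa> q = 1" if "q \<in> V" for q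
    using that \<beta>(2)[of "\<phi> q"] by (auto simp: V_def \<kappa>_def dist_norm norm_minus_commute)
  ultimately show ?thesis using that[of \<kappa> V K] KW cl z by blast
qed

subsection \<open>Tangent vectors and differentials\<close>

text \<open>Chain rule through the transition map, which represents \<open>f\<close> only near
  \<open>snd c p\<close>. The target is an arbitrary normed space so that \<open>f\<close> may
  itself be a chart map; this gives the cocycle rule for derivatives of transition maps.\<close>

lemma chart_change_derivative:
  fixes N :: "('m, 'e::real_inner) atlas" and f :: "'m \<Rightarrow> 'g::real_normed_vector"
  assumes N: "smooth_manifold N" and c: "c \<in> N" "p \<in> fst c" and d: "d \<in> N" "p \<in> fst d"
    and f: "(f \<circ> chart_inv d) differentiable (at (snd d p))"
  shows "((f \<circ> chart_inv c) has_derivative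
      (\<lambda>u. frechet_derivative (f \<circ> chart_inv d) (at (snd d p))
        (frechet_derivative (snd d \<circ> chart_inv c) (at (snd c p)) u))) (at (snd c p))"
proof -
  obtain U \<phi> V \<psi> where cd: "c = (U, \<phi>)" "d = (V, \<psi>)" by (cases c, cases d)
  have U: "(U, \<phi>) \<in> N" "p \<in> U" and V: "(V, \<psi>) \<in> N" "p \<in> V" using c d cd by auto
  note inj = pre_atlasD(1)[OF smooth_manifold_pre_atlas[OF N] U(1)] pre_atlasD(1)[OF smooth_manifold_pre_atlas[OF N] V(1)]
  note t = smooth_manifold_transition[OF N U(1) V(1)]
  have px: "\<phi> p \<in> \<phi> ` (U \<inter> V)" using U V by auto
  have g: "((\<psi> \<circ> inv_into U \<phi>) has_derivative frechet_derivative (\<psi> \<circ> inv_into U \<phi>) (at (\<phi> p))) (at (\<phi> p))"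
    by (rule smooth_on_has_derivative[OF t(2) px])
  have p: "(\<psi> \<circ> inv_into U \<phi>) (\<phi> p) = \<psi> p" using U inj by simp
  have h: "((f \<circ> inv_into V \<psi>) has_derivative frechet_derivative (f \<circ> inv_into V \<psi>) (at (\<psi> p))) (at ((\<psi> \<circ> inv_into U \<phi>) (\<phi> p)))"
    using f unfolding p by (simp add: cd frechet_derivative_works)
  have "((\<lambda>z. (f \<circ> inv_into V \<psi>) ((\<psi> \<circ> inv_into U \<phi>) z)) has_derivative
      (\<lambda>u. frechet_derivative (f \<circ> inv_into V \<psi>) (at (\<psi> p)) (frechet_derivative (\<psi> \<circ> inv_into U \<phi>) (at (\<phi> p)) u))) (at (\<phi> p))"
    by (rule has_derivative_compose[OF g h])
  then have "((f \<circ> inv_into U \<phi>) has_derivative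
      (\<lambda>u. frechet_derivative (f \<circ> inv_into V \<psi>) (at (\<psi> p)) (frechet_derivative (\<psi> \<circ> inv_into U \<phi>) (at (\<phi> p)) u))) (at (\<phi> p))"
    by (rule has_derivative_transform_within_open[OF _ t(1) px]) (use inj in auto)
  then show ?thesis by (simp add: cd)
qed

lemma smooth_functions_chart_differentiable:
  assumes N: "smooth_manifold N" and f: "f \<in> smooth_functions N" and c: "c \<in> N" "p \<in> fst c"
  shows "(f \<circ> chart_inv c) differentiable (at (snd c p))"
proof -
  have "(fst c, snd c) \<in> N" using c by simp
  from smooth_functionsD[OF smooth_manifold_pre_atlas[OF N] f this] show ?thesis
    by (rule smooth_on_differentiable) (use c in auto)
qed

lemma chart_transition_differentiable:
  assumes N: "smooth_manifold N" and c: "c \<in> N" "p \<in> fst c" and d: "d \<in> N" "p \<in> fst d"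
  shows "(snd d \<circ> chart_inv c) differentiable (at (snd c p))"
proof -
  have "(fst c, snd c) \<in> N" "(fst d, snd d) \<in> N" using c d by auto
  from smooth_manifold_transition(2)[OF N this] show ?thesis
    by (rule smooth_on_differentiable) (use c d in auto)
qed

lemma chart_derivative_linear:
  "f differentiable (at x) \<Longrightarrow> linear (frechet_derivative f (at x))"
  by (simp add: linear_frechet_derivative)

lemma tangent_spaceD:
  assumes "v \<in> tangent_space N p" "c \<in> N" "p \<in> fst c" "d \<in> N" "p \<in> fst d"
  shows "v d = frechet_derivative (snd d \<circ> chart_inv c) (at (snd c p)) (v c)"
  using assms unfolding tangent_space_def by blast

text \<open>The compatibility condition on tangent vectors cancels against the chain rule, so the
  chart picked by \<open>SOME\<close> in \<open>differential\<close> can be replaced by any chart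
  around the point.\<close>

lemma differential_chart:
  assumes N: "smooth_manifold N" and f: "f \<in> smooth_functions N" and c: "c \<in> N" "p \<in> fst c"
    and v: "v \<in> tangent_space N p"
  shows "differential N f p v = frechet_derivative (f \<circ> chart_inv c) (at (snd c p)) (v c)"
proof -
  define d where "d = (SOME c. c \<in> N \<and> p \<in> fst c)"
  have d: "d \<in> N" "p \<in> fst d" using someI[of "\<lambda>c. c \<in> N \<and> p \<in> fst c" c] c by (auto simp: d_def)
  have "differential N f p v = frechet_derivative (f \<circ> chart_inv d) (at (snd d p)) (v d)"
    using v by (simp add: differential_def d_def Let_def)
  also have "v d = frechet_derivative (snd d \<circ> chart_inv c) (at (snd c p)) (v c)"
    by (rule tangent_spaceD[OF v c d])
  also have "frechet_derivative (f \<circ> chart_inv d) (at (snd d p)) \<dots> = frechet_derivative (f \<circ> chart_inv c) (at (snd c p)) (v c)"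
    using frechet_derivative_at[OF chart_change_derivative[OF N c d smooth_functions_chart_differentiable[OF N f d]]]
    by metis
  finally show ?thesis .
qed

lemma points_chart:
  assumes "p \<in> points N" obtains c where "c \<in> N" "p \<in> fst c"
  using assms by (auto simp: points_def)

lemma differential_outside: "v \<notin> tangent_space N p \<Longrightarrow> differential N f p v = 0"
  by (simp add: differential_def)

lemma differential_eqI_chart:
  assumes N: "smooth_manifold N" and f: "f \<in> smooth_functions N" and g: "g \<in> smooth_functions N"
    and c: "c \<in> N" "p \<in> fst c"
    and eq: "frechet_derivative (f \<circ> chart_inv c) (at (snd c p)) = frechet_derivative (g \<circ> chart_inv c) (at (snd c p))"
  shows "differential N f p = differential N g p"
proof
  fix v show "differential N f p v = differential N g p v"
    using differential_chart[OF N f c] differential_chart[OF N g c] eq differential_outside[of v N p]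
    by (cases "v \<in> tangent_space N p") auto
qed

lemma differential_cong:
  assumes N: "smooth_manifold N" and f: "f \<in> smooth_functions N" and p: "p \<in> points N"
    and fg: "\<And>q. q \<in> points N \<Longrightarrow> f q = g q"
  shows "differential N f p = differential N g p"
proof -
  note preN = smooth_manifold_pre_atlas[OF N]
  obtain c where c: "c \<in> N" "p \<in> fst c" using points_chart[OF p] .
  then have c': "(fst c, snd c) \<in> N" by simp
  have g: "g \<in> smooth_functions N" by (rule smooth_functions_cong[OF preN f fg])
  show ?thesis
  proof (rule differential_eqI_chart[OF N f g c], rule frechet_derivative_cong_open)
    show "open (snd c ` fst c)" by (rule pre_atlasD(2)[OF preN c'])
    show "snd c p \<in> snd c ` fst c" using c by auto
    fix y assume "y \<in> snd c ` fst c"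
    then show "(f \<circ> chart_inv c) y = (g \<circ> chart_inv c) y"
      using fg chart_points[OF c'] inv_into_into[of y "snd c" "fst c"] by auto
  qed
qed

section \<open>Algebraic rules for differentials and tangent vectors\<close>

lemma differential_mult:
  assumes N: "smooth_manifold N" and f: "f \<in> smooth_functions N" and g: "g \<in> smooth_functions N" and p: "p \<in> points N"
  shows "differential N (\<lambda>x. f x * g x) p = (\<lambda>v. f p * differential N g p v + g p * differential N f p v)"
proof
  fix v
  note preN = smooth_manifold_pre_atlas[OF N]
  obtain c where c: "c \<in> N" "p \<in> fst c" using points_chart[OF p] .
  then have c': "(fst c, snd c) \<in> N" by simp
  have pp: "chart_inv c (snd c p) = p" using pre_atlasD(1)[OF preN c'] c by simp
  note df = smooth_functions_chart_differentiable[OF N f c] smooth_functions_chart_differentiable[OF N g c]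
  show "differential N (\<lambda>x. f x * g x) p v = f p * differential N g p v + g p * differential N f p v"
  proof (cases "v \<in> tangent_space N p")
    case True
    have "((\<lambda>y. (f \<circ> chart_inv c) y * (g \<circ> chart_inv c) y) has_derivative
       (\<lambda>h. (f \<circ> chart_inv c) (snd c p) * frechet_derivative (g \<circ> chart_inv c) (at (snd c p)) h +
          frechet_derivative (f \<circ> chart_inv c) (at (snd c p)) h * (g \<circ> chart_inv c) (snd c p))) (at (snd c p))"
      by (rule has_derivative_mult; rule df[unfolded frechet_derivative_works])
    from frechet_derivative_at[OF this, symmetric] show ?thesis
      by (simp add: differential_chart[OF N _ c True] f g smooth_functions_mult[OF preN f g] o_def pp)
  qed (simp add: differential_outside)
qed

text \<open>The coefficients \<open>1\<close> are kept so that the right-hand side has the shape of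
  the linear combinations in \<open>is_bivector_field\<close>, and \<Lambda> can be expanded by
  instantiation.\<close>

lemma differential_add:
  assumes N: "smooth_manifold N" and f: "f \<in> smooth_functions N" and g: "g \<in> smooth_functions N" and p: "p \<in> points N"
  shows "differential N (\<lambda>x. f x + g x) p = (\<lambda>v. 1 * differential N f p v + 1 * differential N g p v)"
proof
  fix v
  note preN = smooth_manifold_pre_atlas[OF N]
  obtain c where c: "c \<in> N" "p \<in> fst c" using points_chart[OF p] .
  note df = smooth_functions_chart_differentiable[OF N f c] smooth_functions_chart_differentiable[OF N g c]
  show "differential N (\<lambda>x. f x + g x) p v = 1 * differential N f p v + 1 * differential N g p v"
  proof (cases "v \<in> tangent_space N p")
    case True
    have "((\<lambda>y. (f \<circ> chart_inv c) y + (g \<circ> chart_inv c) y) has_derivative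
       (\<lambda>h. frechet_derivative (f \<circ> chart_inv c) (at (snd c p)) h +
          frechet_derivative (g \<circ> chart_inv c) (at (snd c p)) h)) (at (snd c p))"
      by (rule has_derivative_add; rule df[unfolded frechet_derivative_works])
    from frechet_derivative_at[OF this, symmetric] show ?thesis
      by (simp add: differential_chart[OF N _ c True] f g smooth_functions_add[OF preN f g] o_def)
  qed (simp add: differential_outside)
qed

lemma differential_const:
  assumes N: "smooth_manifold N" and p: "p \<in> points N"
  shows "differential N (\<lambda>_. r) p = (\<lambda>_. 0)"
proof
  fix v
  note preN = smooth_manifold_pre_atlas[OF N]
  obtain c where c: "c \<in> N" "p \<in> fst c" using points_chart[OF p] .
  show "differential N (\<lambda>_. r) p v = 0"
  proof (cases "v \<in> tangent_space N p")
    case True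
    show ?thesis
      by (simp add: differential_chart[OF N smooth_functions_const[OF preN] c True] o_def frechet_derivative_const)
  qed (simp add: differential_outside)
qed

lemma tangent_spaceI:
  assumes "\<And>c. \<not> (c \<in> N \<and> p \<in> fst c) \<Longrightarrow> v c = 0"
    and "\<And>c d. c \<in> N \<Longrightarrow> d \<in> N \<Longrightarrow> p \<in> fst c \<Longrightarrow> p \<in> fst d \<Longrightarrow>
        v d = frechet_derivative (snd d \<circ> chart_inv c) (at (snd c p)) (v c)"
  shows "v \<in> tangent_space N p"
  unfolding tangent_space_def using assms by blast

lemma tangent_space_outside: "v \<in> tangent_space N p \<Longrightarrow> \<not> (c \<in> N \<and> p \<in> fst c) \<Longrightarrow> v c = 0"
  unfolding tangent_space_def by blast

lemma tangent_space_add: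
  assumes N: "smooth_manifold N" and v: "v \<in> tangent_space N p" and w: "w \<in> tangent_space N p"
  shows "(\<lambda>c. v c + w c) \<in> tangent_space N p"
proof (rule tangent_spaceI)
  fix c d assume c: "c \<in> N" "d \<in> N" "p \<in> fst c" "p \<in> fst d"
  show "v d + w d = frechet_derivative (snd d \<circ> chart_inv c) (at (snd c p)) (v c + w c)"
    using linear_add[OF chart_derivative_linear[OF chart_transition_differentiable[OF N c(1,3,2,4)]]]
      tangent_spaceD[OF v c(1,3,2,4)] tangent_spaceD[OF w c(1,3,2,4)] by metis
qed (simp add: tangent_space_outside[OF v] tangent_space_outside[OF w])

lemma tangent_space_scale:
  assumes N: "smooth_manifold N" and v: "v \<in> tangent_space N p"
  shows "(\<lambda>c. r *\<^sub>R v c) \<in> tangent_space N p"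
proof (rule tangent_spaceI)
  fix c d assume c: "c \<in> N" "d \<in> N" "p \<in> fst c" "p \<in> fst d"
  show "r *\<^sub>R v d = frechet_derivative (snd d \<circ> chart_inv c) (at (snd c p)) (r *\<^sub>R v c)"
    using linear_cmul[OF chart_derivative_linear[OF chart_transition_differentiable[OF N c(1,3,2,4)]]]
      tangent_spaceD[OF v c(1,3,2,4)] by metis
qed (simp add: tangent_space_outside[OF v])

lemma differential_vector_add:
  assumes N: "smooth_manifold N" and f: "f \<in> smooth_functions N" and p: "p \<in> points N"
    and v: "v \<in> tangent_space N p" and w: "w \<in> tangent_space N p"
  shows "differential N f p (\<lambda>c. v c + w c) = differential N f p v + differential N f p w"
proof -
  obtain c where c: "c \<in> N" "p \<in> fst c" using points_chart[OF p] .
  show ?thesis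
    using chart_derivative_linear[OF smooth_functions_chart_differentiable[OF N f c]]
    by (simp add: differential_chart[OF N f c] v w tangent_space_add[OF N v w] linear_add)
qed

lemma differential_vector_scale:
  assumes N: "smooth_manifold N" and f: "f \<in> smooth_functions N" and p: "p \<in> points N"
    and v: "v \<in> tangent_space N p"
  shows "differential N f p (\<lambda>c. r *\<^sub>R v c) = r * differential N f p v"
proof -
  obtain c where c: "c \<in> N" "p \<in> fst c" using points_chart[OF p] .
  show ?thesis
    using chart_derivative_linear[OF smooth_functions_chart_differentiable[OF N f c]]
    by (simp add: differential_chart[OF N f c] v tangent_space_scale[OF N v] linear_cmul)
qed

lemma differential_cotangent:
  assumes N: "smooth_manifold N" and f: "f \<in> smooth_functions N" and p: "p \<in> points N"
  shows "differential N f p \<in> cotangent_space N p"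
  using differential_vector_add[OF assms] differential_vector_scale[OF assms]
  by (auto simp: cotangent_space_def differential_outside)

lemma zero_cotangent: "(\<lambda>_. 0) \<in> cotangent_space N p"
  by (simp add: cotangent_space_def)

text \<open>The coordinate vector is prescribed in \<open>c\<close> and pushed to the other charts
  by the derivatives of the transition maps; compatibility among those charts is the cocycle
  rule.\<close>

lemma tangent_vector_of_coordinates:
  assumes N: "smooth_manifold N" and c: "c \<in> N" "p \<in> fst c"
  shows "\<exists>v\<in>tangent_space N p. v c = u"
proof -
  define v where "v d = (if d \<in> N \<and> p \<in> fst d then frechet_derivative (snd d \<circ> chart_inv c) (at (snd c p)) u else 0)" for d
  have 1: "v e = frechet_derivative (snd e \<circ> chart_inv d) (at (snd d p)) (v d)"
    if "d \<in> N" "p \<in> fst d" "e \<in> N" "p \<in> fst e" for d e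
    using fun_cong[OF frechet_derivative_at[OF chart_change_derivative[OF N c that(1,2) chart_transition_differentiable[OF N that]]], of u]
    by (simp add: v_def that)
  have c': "(fst c, snd c) \<in> N" using c by simp
  have "(snd c \<circ> chart_inv c) y = y" if "y \<in> snd c ` fst c" for y
    using that by (simp add: f_inv_into_f)
  then have "frechet_derivative (snd c \<circ> chart_inv c) (at (snd c p)) = frechet_derivative (\<lambda>y. y) (at (snd c p))"
    by (intro frechet_derivative_cong_open[OF pre_atlasD(2)[OF smooth_manifold_pre_atlas[OF N] c']]) (use c in auto)
  then have "v c = u" using c by (simp add: v_def frechet_derivative_at[OF has_derivative_ident, symmetric])
  moreover have "v \<in> tangent_space N p" 
  proof (rule tangent_spaceI)
    show "v d = 0" if "\<not> (d \<in> N \<and> p \<in> fst d)" for d using that unfolding v_def by (rule if_not_P)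
  qed (rule 1)
  ultimately show ?thesis by blast
qed

lemma tangent_space_chart_eqI:
  assumes v: "v \<in> tangent_space N p" and w: "w \<in> tangent_space N p" and c: "c \<in> N" "p \<in> fst c"
    and eq: "v c = w c"
  shows "v = w"
proof
  fix d show "v d = w d"
  proof (cases "d \<in> N \<and> p \<in> fst d")
    case True
    then show ?thesis using tangent_spaceD[OF v c] tangent_spaceD[OF w c] eq by metis
  qed (simp add: tangent_space_outside[OF v] tangent_space_outside[OF w])
qed

text \<open>Tangent vectors and vector fields are tested on globally defined functions, so the
  linear coordinates of a chart are cut off. The neighbourhood \<open>V\<close> on which they remain
  unchanged is the same for all \<open>b\<close>.\<close>

lemma chart_coordinate_functions:
  fixes N :: "('m, 'e::real_inner) atlas"
  assumes N: "smooth_manifold N" and c: "c \<in> N" "p \<in> fst c"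
  obtains V F where "atlas_open N V" "p \<in> V" "V \<subseteq> fst c" "\<And>b. F b \<in> smooth_functions N"
    "\<And>b q. q \<in> V \<Longrightarrow> F b q = b \<bullet> snd c q"
proof -
  note preN = smooth_manifold_pre_atlas[OF N]
  have c': "(fst c, snd c) \<in> N" using c by simp
  have Uo: "atlas_open N (fst c)" by (rule chart_domain_open[OF N c'])
  obtain \<kappa> V K where k: "\<kappa> \<in> smooth_functions N" "atlas_open N V" "p \<in> V" "V \<subseteq> K" "K \<subseteq> fst c"
    "closedin (atlas_topology N) K" "\<And>q. q \<in> V \<Longrightarrow> \<kappa> q = 1" "\<And>q. q \<in> points N - K \<Longrightarrow> \<kappa> q = 0"
    by (rule manifold_bump_exists[OF N Uo c(2)]) (rule that)
  define F where "F b q = (if q \<in> fst c then \<kappa> q * (b \<bullet> snd c q) else 0)" for b q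
  have oc: "open (snd c ` fst c)" by (rule pre_atlasD(2)[OF preN c'])
  have "smooth_near N q (\<lambda>q. b \<bullet> snd c q)" if "q \<in> fst c" for b q
  proof -
    have "smooth_on (snd c ` fst c) (\<lambda>y. b \<bullet> y)" by (rule smooth_on_bounded_linear[OF bounded_linear_inner_right])
    then have "smooth_on (snd c ` fst c) ((\<lambda>q. b \<bullet> snd c q) \<circ> chart_inv c)"
      by (subst smooth_on_cong[OF oc]) (auto simp: f_inv_into_f)
    then show ?thesis unfolding smooth_near_def using c' that oc
      by (intro exI[of _ "fst c"] exI[of _ "snd c"] exI[of _ "snd c ` fst c"]) auto
  qed
  then have "F b \<in> smooth_functions N" for b
    unfolding F_def[abs_def] by (intro smooth_cutoff[OF N k(1,6,8) Uo k(5)])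
  moreover have "F b q = b \<bullet> snd c q" if "q \<in> V" for b q using that k by (auto simp: F_def)
  ultimately show ?thesis using that[of V F] k by auto
qed

lemma coordinate_function_derivative:
  assumes N: "smooth_manifold N" and c: "c \<in> N" "p \<in> fst c" and d: "d \<in> N" "p \<in> fst d"
    and V: "atlas_open N V" "p \<in> V" "V \<subseteq> fst c" and F: "\<And>q. q \<in> V \<Longrightarrow> F q = b \<bullet> snd c q"
  shows "frechet_derivative (F \<circ> chart_inv d) (at (snd d p)) u =
     b \<bullet> frechet_derivative (snd c \<circ> chart_inv d) (at (snd d p)) u"
proof -
  have d': "(fst d, snd d) \<in> N" using d by simp
  have o: "open (snd d ` (V \<inter> fst d))" by (rule atlas_openD(1)[OF V(1) d'])
  note inj = pre_atlasD(1)[OF smooth_manifold_pre_atlas[OF N] d']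
  have "frechet_derivative (F \<circ> chart_inv d) (at (snd d p)) =
      frechet_derivative (\<lambda>y. b \<bullet> (snd c \<circ> chart_inv d) y) (at (snd d p))"
    by (rule frechet_derivative_cong_open[OF o]) (use V d inj F in auto)
  also have "\<dots> = (\<lambda>u. b \<bullet> frechet_derivative (snd c \<circ> chart_inv d) (at (snd d p)) u)"
    by (intro frechet_derivative_at[symmetric] has_derivative_inner_right
        chart_transition_differentiable[OF N d c, unfolded frechet_derivative_works])
  finally show ?thesis by simp
qed

lemma coordinate_function_derivative_same:
  assumes N: "smooth_manifold N" and c: "c \<in> N" "p \<in> fst c"
    and V: "atlas_open N V" "p \<in> V" "V \<subseteq> fst c" and F: "\<And>q. q \<in> V \<Longrightarrow> F q = b \<bullet> snd c q"
  shows "frechet_derivative (F \<circ> chart_inv c) (at (snd c p)) u = b \<bullet> u"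
proof -
  obtain v where v: "v \<in> tangent_space N p" "v c = u" using tangent_vector_of_coordinates[OF N c] by blast
  have "frechet_derivative (snd c \<circ> chart_inv c) (at (snd c p)) u = u"
    using tangent_spaceD[OF v(1) c c] v(2) by simp
  then show ?thesis using coordinate_function_derivative[OF N c c V F] by simp
qed

lemma coordinate_function_differential:
  assumes N: "smooth_manifold N" and c: "c \<in> N" "p \<in> fst c"
    and V: "atlas_open N V" "p \<in> V" "V \<subseteq> fst c" and F: "\<And>q. q \<in> V \<Longrightarrow> F q = b \<bullet> snd c q"
    and sm: "F \<in> smooth_functions N" and v: "v \<in> tangent_space N p"
  shows "differential N F p v = b \<bullet> v c"
  using differential_chart[OF N sm c v] coordinate_function_derivative_same[OF N c V F] by simp

text \<open>Testing on cut-off coordinates recovers the inner product of the coordinate vector with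
  every \<open>b\<close>, and these inner products determine it.\<close>

lemma tangent_vector_eqI:
  assumes N: "smooth_manifold N" and p: "p \<in> points N"
    and v: "v \<in> tangent_space N p" and w: "w \<in> tangent_space N p"
    and eq: "\<And>f. f \<in> smooth_functions N \<Longrightarrow> differential N f p v = differential N f p w"
  shows "v = w"
proof -
  obtain c where c: "c \<in> N" "p \<in> fst c" using points_chart[OF p] .
  obtain V F where F: "atlas_open N V" "p \<in> V" "V \<subseteq> fst c" "\<And>b. F b \<in> smooth_functions N"
    "\<And>b q. q \<in> V \<Longrightarrow> F b q = b \<bullet> snd c q" by (rule chart_coordinate_functions[OF N c]) (rule that)
  have "b \<bullet> v c = b \<bullet> w c" for b
    using eq[OF F(4)[of b]] coordinate_function_differential[OF N c F(1-3,5,4)] v w by metis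
  then have "v c = w c" using vector_eq_ldot[of "v c" "w c"] by (simp add: inner_commute)
  then show ?thesis by (rule tangent_space_chart_eqI[OF v w c])
qed

text \<open>It suffices to represent the functional by a coordinate vector in each chart separately:
  compatibility of these vectors is forced by testing on coordinate functions.\<close>

lemma tangent_vector_of_functional:
  assumes N: "smooth_manifold N" and p: "p \<in> points N"
    and T: "\<And>c. c \<in> N \<Longrightarrow> p \<in> fst c \<Longrightarrow> \<exists>w. \<forall>f\<in>smooth_functions N.
      T f = frechet_derivative (f \<circ> chart_inv c) (at (snd c p)) w"
  shows "\<exists>v\<in>tangent_space N p. \<forall>f\<in>smooth_functions N. T f = differential N f p v"
proof -
  obtain c where c: "c \<in> N" "p \<in> fst c" using points_chart[OF p] .
  obtain w where w: "\<And>f. f \<in> smooth_functions N \<Longrightarrow> T f = frechet_derivative (f \<circ> chart_inv c) (at (snd c p)) w"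
    using T[OF c] by blast
  obtain v where v: "v \<in> tangent_space N p" "v c = w" using tangent_vector_of_coordinates[OF N c] by blast
  show ?thesis using differential_chart[OF N _ c v(1)] w v by (intro bexI[of _ v]) auto
qed

subsection \<open>Sections in local trivializations\<close>

text \<open>Collects what makes the maps in \<open>total_atlas\<close> injective with open image, so
  that sections and functions on the total space can be described in local trivializations. Both
  \<open>Aplus M A\<close> and the tangent bundle are handled through it.\<close>

definition pre_bundle ::
  "('m, 'e::real_inner) atlas \<Rightarrow> ('x, 'm, 'f::real_inner, 'z) fibre_bundle_scheme \<Rightarrow> bool" where
  "pre_bundle M B \<longleftrightarrow> smooth_manifold M \<and> finite_dimensional TYPE('f) \<and>
     proj B ` total_space B \<subseteq> points M \<and> points M = (\<Union>t\<in>trivs B. fst t) \<and>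
     (\<forall>(W, \<Phi>)\<in>trivs B. atlas_open M W \<and> (\<forall>p\<in>W. bij_betw \<Phi> (fibre B p) UNIV))"

lemma is_fibre_bundle_pre_bundle: "is_fibre_bundle M B \<Longrightarrow> pre_bundle M B"
  unfolding is_fibre_bundle_def pre_bundle_def
  using openin_atlas_topology smooth_manifold_pre_atlas by (metis (mono_tags, lifting) case_prodD case_prodI2)

lemma pre_bundleD:
  assumes "pre_bundle M (B :: ('x, 'm, 'f::real_inner, 'z) fibre_bundle_scheme)"
  shows "smooth_manifold M" "x \<in> total_space B \<Longrightarrow> proj B x \<in> points M"
    "(W, \<Phi>) \<in> trivs B \<Longrightarrow> atlas_open M W" "(W, \<Phi>) \<in> trivs B \<Longrightarrow> p \<in> W \<Longrightarrow> bij_betw \<Phi> (fibre B p) UNIV"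
    "p \<in> points M \<Longrightarrow> \<exists>W \<Phi>. (W, \<Phi>) \<in> trivs B \<and> p \<in> W" "finite_dimensional TYPE('f)"
  using assms unfolding pre_bundle_def by fastforce+

lemma triv_image:
  assumes B: "pre_bundle M B" and t: "(W, \<Phi>) \<in> trivs B" and O: "Q \<subseteq> W"
  shows "(\<lambda>x. (\<phi> (proj B x), \<Phi> x)) ` {x \<in> total_space B. proj B x \<in> Q} = \<phi> ` Q \<times> UNIV"
proof
  show "\<phi> ` Q \<times> UNIV \<subseteq> (\<lambda>x. (\<phi> (proj B x), \<Phi> x)) ` {x \<in> total_space B. proj B x \<in> Q}"
  proof clarify
    fix p w assume p: "p \<in> Q"
    then have "bij_betw \<Phi> (fibre B p) UNIV" using pre_bundleD(4)[OF B t] O by auto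
    then obtain x where "x \<in> fibre B p" "\<Phi> x = w" unfolding bij_betw_def by (metis UNIV_I imageE)
    then show "(\<phi> p, w) \<in> (\<lambda>x. (\<phi> (proj B x), \<Phi> x)) ` {x \<in> total_space B. proj B x \<in> Q}"
      using p by (auto simp: fibre_def intro!: image_eqI[of _ _ x])
  qed
qed auto

lemma triv_inj:
  assumes B: "pre_bundle M B" and t: "(W, \<Phi>) \<in> trivs B" and c: "(U, \<phi>) \<in> M"
  shows "inj_on (\<lambda>x. (\<phi> (proj B x), \<Phi> x)) {x \<in> total_space B. proj B x \<in> U \<inter> W}"
proof (rule inj_onI)
  fix x y assume x: "x \<in> {x \<in> total_space B. proj B x \<in> U \<inter> W}" and y: "y \<in> {x \<in> total_space B. proj B x \<in> U \<inter> W}"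
    and eq: "(\<phi> (proj B x), \<Phi> x) = (\<phi> (proj B y), \<Phi> y)"
  have "proj B x = proj B y"
    using pre_atlasD(1)[OF smooth_manifold_pre_atlas[OF pre_bundleD(1)[OF B]] c] eq x y by (auto dest: inj_onD)
  then have "x \<in> fibre B (proj B x)" "y \<in> fibre B (proj B x)" using x y by (auto simp: fibre_def)
  then show "x = y" using pre_bundleD(4)[OF B t, of "proj B x"] x eq by (auto simp: bij_betw_def dest: inj_onD)
qed

lemma total_atlasI: "(U, \<phi>) \<in> M \<Longrightarrow> (W, \<Phi>) \<in> trivs B \<Longrightarrow>
    ({x \<in> total_space B. proj B x \<in> U \<inter> W}, \<lambda>x. (\<phi> (proj B x), \<Phi> x)) \<in> total_atlas M B"
  unfolding total_atlas_def by blast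

lemma total_atlasE:
  assumes "(V, \<psi>) \<in> total_atlas M B"
  obtains U \<phi> W \<Phi> where "(U, \<phi>) \<in> M" "(W, \<Phi>) \<in> trivs B"
    "V = {x \<in> total_space B. proj B x \<in> U \<inter> W}" "\<psi> = (\<lambda>x. (\<phi> (proj B x), \<Phi> x))"
  using assms unfolding total_atlas_def by blast

lemma pre_atlas_total_atlas:
  assumes B: "pre_bundle M B"
  shows "pre_atlas (total_atlas M B)"
  unfolding pre_atlas_def
proof safe
  fix V \<psi> assume "(V, \<psi>) \<in> total_atlas M B"
  then obtain U \<phi> W \<Phi> where c: "(U, \<phi>) \<in> M" "(W, \<Phi>) \<in> trivs B"
    "V = {x \<in> total_space B. proj B x \<in> U \<inter> W}" "\<psi> = (\<lambda>x. (\<phi> (proj B x), \<Phi> x))" by (rule total_atlasE)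
  show "inj_on \<psi> V" unfolding c(3,4) by (rule triv_inj[OF B c(2,1)])
  have "open (\<phi> ` (W \<inter> U))" by (rule atlas_openD(1)[OF pre_bundleD(3)[OF B c(2)] c(1)])
  then show "open (\<psi> ` V)" unfolding c(3,4) using triv_image[OF B c(2), of "U \<inter> W" \<phi>]
    by (simp add: Int_commute open_Times)
qed

lemma points_total_atlas:
  assumes B: "pre_bundle M B"
  shows "points (total_atlas M B) = total_space B"
proof
  show "points (total_atlas M B) \<subseteq> total_space B" by (auto simp: points_def total_atlas_def)
  show "total_space B \<subseteq> points (total_atlas M B)"
  proof
    fix x assume x: "x \<in> total_space B"
    obtain c where c: "c \<in> M" "proj B x \<in> fst c" by (rule points_chart[OF pre_bundleD(2)[OF B x]])
    obtain W \<Phi> where t: "(W, \<Phi>) \<in> trivs B" "proj B x \<in> W" using pre_bundleD(5)[OF B pre_bundleD(2)[OF B x]] by blast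
    have c': "(fst c, snd c) \<in> M" using c by simp
    have "x \<in> {x \<in> total_space B. proj B x \<in> fst c \<inter> W}" using c t x by auto
    then show "x \<in> points (total_atlas M B)" using chart_points[OF total_atlasI[OF c' t(1)]] by blast
  qed
qed

lemma total_chart_inv:
  assumes B: "pre_bundle M B" and t: "(W, \<Phi>) \<in> trivs B" and c: "(U, \<phi>) \<in> M" and p: "p \<in> U" "p \<in> W"
  shows "inv_into {x \<in> total_space B. proj B x \<in> U \<inter> W} (\<lambda>x. (\<phi> (proj B x), \<Phi> x)) (\<phi> p, w) = inv_into (fibre B p) \<Phi> w"
    (is "?l = ?r")
proof -
  have b: "bij_betw \<Phi> (fibre B p) UNIV" by (rule pre_bundleD(4)[OF B t p(2)])
  then have r: "?r \<in> fibre B p" "\<Phi> ?r = w"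
    by (metis UNIV_I bij_betw_def inv_into_into) (metis UNIV_I b bij_betw_inv_into_right)
  then have "?r \<in> {x \<in> total_space B. proj B x \<in> U \<inter> W}" using p by (auto simp: fibre_def)
  from inv_into_f_f[OF triv_inj[OF B t c] this] show ?thesis using r by (simp add: fibre_def)
qed

text \<open>A bundle chart consists of a base chart and a fibre coordinate. Along a section the base
  component is merely a change of charts of \<open>M\<close>, so the fibre coordinate carries the
  whole smoothness condition.\<close>

lemma sections_iff:
  fixes M :: "('m, 'e::real_inner) atlas" and B :: "('x, 'm, 'f::real_inner, 'z) fibre_bundle_scheme"
  assumes B: "pre_bundle M B"
  shows "s \<in> sections M B \<longleftrightarrow> s \<in> extensional (points M) \<and> (\<forall>p\<in>points M. s p \<in> fibre B p) \<and>
     (\<forall>(U, \<phi>)\<in>M. \<forall>(W, \<Phi>)\<in>trivs B. smooth_on (\<phi> ` (U \<inter> W)) (\<Phi> \<circ> s \<circ> inv_into U \<phi>))"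
proof
  note M = pre_bundleD(1)[OF B]
  note preM = smooth_manifold_pre_atlas[OF M]
  assume s: "s \<in> sections M B"
  then have sm: "smooth_map M (total_atlas M B) s" and pr: "\<And>p. p \<in> points M \<Longrightarrow> proj B (s p) = p"
    and ex: "s \<in> extensional (points M)" by (auto simp: sections_def)
  have tot: "s p \<in> total_space B" if "p \<in> points M" for p
    using sm that unfolding smooth_map_def continuous_map topspace_atlas_topology[OF preM]
      topspace_atlas_topology[OF pre_atlas_total_atlas[OF B]] points_total_atlas[OF B] by auto
  have "smooth_on (\<phi> ` (U \<inter> W)) (\<Phi> \<circ> s \<circ> inv_into U \<phi>)" if c: "(U, \<phi>) \<in> M" and t: "(W, \<Phi>) \<in> trivs B" for U \<phi> W \<Phi>
  proof -
    have "smooth_on (\<phi> ` (U \<inter> s -` {x \<in> total_space B. proj B x \<in> U \<inter> W})) ((\<lambda>x. (\<phi> (proj B x), \<Phi> x)) \<circ> s \<circ> inv_into U \<phi>)"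
      using sm c total_atlasI[OF c t] unfolding smooth_map_def by blast
    moreover have "U \<inter> s -` {x \<in> total_space B. proj B x \<in> U \<inter> W} = U \<inter> W"
      using pr tot chart_points[OF c] by auto
    ultimately have "smooth_on (\<phi> ` (U \<inter> W)) ((\<lambda>x. (\<phi> (proj B x), \<Phi> x)) \<circ> s \<circ> inv_into U \<phi>)" by simp
    moreover have "open (\<phi> ` (U \<inter> W))"
      using atlas_openD(1)[OF pre_bundleD(3)[OF B t] c] by (simp add: Int_commute)
    ultimately have "smooth_on (\<phi> ` (U \<inter> W)) (\<lambda>y. snd (((\<lambda>x. (\<phi> (proj B x), \<Phi> x)) \<circ> s \<circ> inv_into U \<phi>) y))"
      by (intro smooth_on_snd)
    then show ?thesis by (simp add: o_def)
  qed
  with ex tot pr show "s \<in> extensional (points M) \<and> (\<forall>p\<in>points M. s p \<in> fibre B p) \<and>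
     (\<forall>(U, \<phi>)\<in>M. \<forall>(W, \<Phi>)\<in>trivs B. smooth_on (\<phi> ` (U \<inter> W)) (\<Phi> \<circ> s \<circ> inv_into U \<phi>))"
    by (auto simp: fibre_def)
next
  note M = pre_bundleD(1)[OF B]
  note preM = smooth_manifold_pre_atlas[OF M]
  assume s: "s \<in> extensional (points M) \<and> (\<forall>p\<in>points M. s p \<in> fibre B p) \<and>
     (\<forall>(U, \<phi>)\<in>M. \<forall>(W, \<Phi>)\<in>trivs B. smooth_on (\<phi> ` (U \<inter> W)) (\<Phi> \<circ> s \<circ> inv_into U \<phi>))"
  then have sf: "\<And>p. p \<in> points M \<Longrightarrow> s p \<in> total_space B \<and> proj B (s p) = p"
    and sm: "\<And>U \<phi> W \<Phi>. (U, \<phi>) \<in> M \<Longrightarrow> (W, \<Phi>) \<in> trivs B \<Longrightarrow> smooth_on (\<phi> ` (U \<inter> W)) (\<Phi> \<circ> s \<circ> inv_into U \<phi>)"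
    by (auto simp: fibre_def)
  have "smooth_map M (total_atlas M B) s"
  proof (rule smooth_mapI[OF preM pre_atlas_total_atlas[OF B]])
    show "s p \<in> points (total_atlas M B)" if "p \<in> points M" for p
      using sf that points_total_atlas[OF B] by auto
    fix U \<phi> V \<psi> assume c: "(U, \<phi>) \<in> M" and "(V, \<psi>) \<in> total_atlas M B"
    from this(2) obtain U' \<phi>' W \<Phi> where d: "(U', \<phi>') \<in> M" "(W, \<Phi>) \<in> trivs B"
      "V = {x \<in> total_space B. proj B x \<in> U' \<inter> W}" "\<psi> = (\<lambda>x. (\<phi>' (proj B x), \<Phi> x))" by (rule total_atlasE)
    \<comment> \<open>The target chart may be built on a different base chart, so both
      \<open>U\<close> and \<open>U'\<close> occur and the base component is a transition
      map.\<close>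
    have eq: "U \<inter> s -` V = U \<inter> U' \<inter> W" using sf chart_points[OF c] d(3) by auto
    have "\<phi> ` (U \<inter> U' \<inter> W) = \<phi> ` (U \<inter> U') \<inter> \<phi> ` (W \<inter> U)"
      using pre_atlasD(1)[OF preM c] by (auto dest: inj_onD)
    then have o: "open (\<phi> ` (U \<inter> U' \<inter> W))"
      using smooth_manifold_transition(1)[OF M c d(1)] atlas_openD(1)[OF pre_bundleD(3)[OF B d(2)] c] by auto
    then show "open (\<phi> ` (U \<inter> s -` V))" by (simp add: eq)
    have "smooth_on (\<phi> ` (U \<inter> U' \<inter> W)) (\<lambda>y. ((\<phi>' \<circ> inv_into U \<phi>) y, (\<Phi> \<circ> s \<circ> inv_into U \<phi>) y))"
      by (intro smooth_on_Pair o smooth_on_subset[OF smooth_manifold_transition(2)[OF M c d(1)]]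
          smooth_on_subset[OF sm[OF c d(2)]]) auto
    moreover have "((\<phi>' \<circ> inv_into U \<phi>) y, (\<Phi> \<circ> s \<circ> inv_into U \<phi>) y) = (\<psi> \<circ> s \<circ> inv_into U \<phi>) y"
      if y: "y \<in> \<phi> ` (U \<inter> U' \<inter> W)" for y
    proof -
      obtain q where q: "q \<in> U" "q \<in> U'" "q \<in> W" "y = \<phi> q" using y by auto
      then show ?thesis using sf[of q] chart_points[OF c] pre_atlasD(1)[OF preM c] by (auto simp: d(4))
    qed
    ultimately show "smooth_on (\<phi> ` (U \<inter> s -` V)) (\<psi> \<circ> s \<circ> inv_into U \<phi>)"
      unfolding eq by (rule smooth_on_transform[OF _ o])
  qed
  then show "s \<in> sections M B" using s sf by (auto simp: sections_def)
qed

section \<open>The tangent bundle and vector fields\<close>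

lemma pre_bundle_tangent_bundle:
  assumes N: "smooth_manifold N"
  shows "pre_bundle N (tangent_bundle N)"
  unfolding pre_bundle_def
proof (intro conjI)
  show "\<forall>(W, \<Phi>)\<in>trivs (tangent_bundle N).
       atlas_open N W \<and> (\<forall>p\<in>W. bij_betw \<Phi> (fibre (tangent_bundle N) p) UNIV)"
  proof clarify
    fix W \<Phi> assume "(W, \<Phi>) \<in> trivs (tangent_bundle N)"
    then obtain c where c: "c \<in> N" "W = fst c" "\<Phi> = (\<lambda>(p, v). v c)" by (auto simp: tangent_bundle_def)
    then have c': "(fst c, snd c) \<in> N" by simp
    have "bij_betw \<Phi> (fibre (tangent_bundle N) p) UNIV" if p: "p \<in> W" for p
    proof -
      have pp: "p \<in> points N" using p c chart_points[OF c'] by auto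
      have fib: "fibre (tangent_bundle N) p = {p} \<times> tangent_space N p"
        using pp by (auto simp: fibre_def tangent_bundle_def)
      have cp: "p \<in> fst c" using p c by simp
      show ?thesis unfolding fib c(3) bij_betw_def
      proof
        show "inj_on (\<lambda>(p, v). v c) ({p} \<times> tangent_space N p)"
          using tangent_space_chart_eqI[OF _ _ c(1) cp] by (auto intro!: inj_onI)
        show "(\<lambda>(p, v). v c) ` ({p} \<times> tangent_space N p) = UNIV"
        proof safe
          fix u :: 'b
          obtain v where "v \<in> tangent_space N p" "v c = u" using tangent_vector_of_coordinates[OF N c(1) cp] by blast
          then show "u \<in> (\<lambda>(p, v). v c) ` ({p} \<times> tangent_space N p)" by (intro image_eqI[of _ _ "(p, v)"]) auto
        qed auto
      qed
    qed
    then show "atlas_open N W \<and> (\<forall>p\<in>W. bij_betw \<Phi> (fibre (tangent_bundle N) p) UNIV)"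
      using chart_domain_open[OF N c'] c by auto
  qed
  show "points N = (\<Union>t\<in>trivs (tangent_bundle N). fst t)"
    by (auto simp: tangent_bundle_def points_def) blast
qed (use N smooth_manifold_fd[OF N] in \<open>auto simp: tangent_bundle_def\<close>)

lemma fibre_tangent_bundle: "p \<in> points N \<Longrightarrow> fibre (tangent_bundle N) p = {p} \<times> tangent_space N p"
  by (auto simp: fibre_def tangent_bundle_def)

text \<open>Near any point the coordinate vector of \<open>X\<close> in a chart is the sum of
  \<open>X(F b)\<close> times \<open>b\<close> over an orthonormal basis, where the
  \<open>F b\<close> are cut-off coordinates. Smoothness of \<open>X\<close> thus follows from
  smoothness of its action on global functions.\<close>

lemma vector_fieldsI:
  fixes N :: "('m, 'e::real_inner) atlas"
  assumes N: "smooth_manifold N" and ext: "X \<in> extensional (points N)"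
    and X: "\<And>p. p \<in> points N \<Longrightarrow> fst (X p) = p \<and> snd (X p) \<in> tangent_space N p"
    and sm: "\<And>f. f \<in> smooth_functions N \<Longrightarrow> vf_apply N X f \<in> smooth_functions N"
  shows "X \<in> vector_fields N"
  unfolding sections_iff[OF pre_bundle_tangent_bundle[OF N]]
proof (intro conjI)
  note preN = smooth_manifold_pre_atlas[OF N]
  obtain B :: "'e set" where B: "orthonormal_basis B"
    using finite_dimensional_orthonormal_basis[OF smooth_manifold_fd[OF N]] .
  show "\<forall>(U, \<phi>)\<in>N. \<forall>(W, \<Phi>)\<in>trivs (tangent_bundle N). smooth_on (\<phi> ` (U \<inter> W)) (\<Phi> \<circ> X \<circ> inv_into U \<phi>)"
  proof clarify
    fix U \<phi> W \<Phi> assume U: "(U, \<phi>) \<in> N" and "(W, \<Phi>) \<in> trivs (tangent_bundle N)"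
    then obtain c where c: "c \<in> N" "W = fst c" "\<Phi> = (\<lambda>(p, v). v c)" by (auto simp: tangent_bundle_def)
    note inj = pre_atlasD(1)[OF preN U]
    show "smooth_on (\<phi> ` (U \<inter> W)) (\<Phi> \<circ> X \<circ> inv_into U \<phi>)"
    proof (rule smooth_on_local)
      fix y assume "y \<in> \<phi> ` (U \<inter> W)"
      then obtain p where p: "p \<in> U" "p \<in> fst c" "y = \<phi> p" using c by auto
      obtain V F where F: "atlas_open N V" "p \<in> V" "V \<subseteq> fst c" "\<And>b. F b \<in> smooth_functions N"
        "\<And>b q. q \<in> V \<Longrightarrow> F b q = b \<bullet> snd c q" by (rule chart_coordinate_functions[OF N c(1) p(2)]) (rule that)
      let ?T = "\<phi> ` (V \<inter> U)"
      have o: "open ?T" by (rule atlas_openD(1)[OF F(1) U])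
      have "smooth_on ?T (\<lambda>y. \<Sum>b\<in>B. (vf_apply N X (F b) \<circ> inv_into U \<phi>) y *\<^sub>R b)"
        by (intro smooth_on_sum o orthonormal_basisD(1)[OF B] smooth_on_scaleR smooth_on_const
            smooth_on_subset[OF smooth_functionsD[OF preN sm[OF F(4)] U]]) auto
      moreover have "(\<Sum>b\<in>B. (vf_apply N X (F b) \<circ> inv_into U \<phi>) y *\<^sub>R b) = (\<Phi> \<circ> X \<circ> inv_into U \<phi>) y" if "y \<in> ?T" for y
      proof -
        obtain q where q: "q \<in> U" "q \<in> V" "y = \<phi> q" using \<open>y \<in> ?T\<close> by auto
        have qN: "q \<in> points N" using chart_points[OF U] q by auto
        have "vf_apply N X (F b) q = b \<bullet> snd (X q) c" for b
          unfolding vf_apply_def using F(3) q X[OF qN]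
          by (intro coordinate_function_differential[OF N c(1) _ F(1) q(2) F(3) F(5) F(4)]) auto
        then have "(\<Sum>b\<in>B. (vf_apply N X (F b) \<circ> inv_into U \<phi>) y *\<^sub>R b) = (\<Sum>b\<in>B. (snd (X q) c \<bullet> b) *\<^sub>R b)"
          using q inj by (simp add: inner_commute)
        also have "\<dots> = snd (X q) c" by (rule orthonormal_basisD(2)[OF B])
        finally show ?thesis using q inj by (simp add: c(3) case_prod_unfold)
      qed
      ultimately have "smooth_on ?T (\<Phi> \<circ> X \<circ> inv_into U \<phi>)" by (rule smooth_on_transform[OF _ o])
      moreover have "y \<in> ?T" using F p by auto
      ultimately show "\<exists>T. open T \<and> y \<in> T \<and> smooth_on T (\<Phi> \<circ> X \<circ> inv_into U \<phi>)" using o by blast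
    qed
  qed
  show "\<forall>p\<in>points N. X p \<in> fibre (tangent_bundle N) p"
    using X by (auto simp: fibre_tangent_bundle mem_Times_iff)
qed (rule ext)

lemma vector_field_eqI:
  assumes N: "smooth_manifold N" and X: "X \<in> vector_fields N" and Y: "Y \<in> vector_fields N"
    and eq: "\<And>f p. f \<in> smooth_functions N \<Longrightarrow> p \<in> points N \<Longrightarrow> vf_apply N X f p = vf_apply N Y f p"
  shows "X = Y"
proof (rule extensionalityI)
  note b = sections_iff[OF pre_bundle_tangent_bundle[OF N]]
  show "X \<in> extensional (points N)" "Y \<in> extensional (points N)" using X Y b by auto
  fix p assume p: "p \<in> points N"
  then have f: "X p \<in> {p} \<times> tangent_space N p" "Y p \<in> {p} \<times> tangent_space N p"
    using X Y b fibre_tangent_bundle[OF p] by auto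
  have "snd (X p) = snd (Y p)"
    by (rule tangent_vector_eqI[OF N p]) (use f eq p in \<open>auto simp: vf_apply_def\<close>)
  with f show "X p = Y p" by (auto simp: prod_eq_iff)
qed

subsection \<open>Functions on the total space of a bundle\<close>

text \<open>A bundle chart is inverted in two stages, first in the base and then in a single fibre;
  in this form the base variable and the fibre variable can be treated separately.\<close>

lemma smooth_total_iff:
  fixes M :: "('m, 'e::real_inner) atlas" and B :: "('x, 'm, 'f::real_inner, 'z) fibre_bundle_scheme"
  assumes B: "pre_bundle M B"
  shows "h \<in> smooth_functions (total_atlas M B) \<longleftrightarrow>
    (\<forall>(U, \<phi>)\<in>M. \<forall>(W, \<Phi>)\<in>trivs B. smooth_on (\<phi> ` (U \<inter> W) \<times> UNIV)
       (\<lambda>z. h (inv_into (fibre B (inv_into U \<phi> (fst z))) \<Phi> (snd z))))"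
proof -
  note preM = smooth_manifold_pre_atlas[OF pre_bundleD(1)[OF B]]
  have eq: "smooth_on ((\<lambda>x. (\<phi> (proj B x), \<Phi> x)) ` {x \<in> total_space B. proj B x \<in> U \<inter> W})
        (h \<circ> inv_into {x \<in> total_space B. proj B x \<in> U \<inter> W} (\<lambda>x. (\<phi> (proj B x), \<Phi> x))) \<longleftrightarrow>
      smooth_on (\<phi> ` (U \<inter> W) \<times> UNIV) (\<lambda>z. h (inv_into (fibre B (inv_into U \<phi> (fst z))) \<Phi> (snd z)))"
    if c: "(U, \<phi>) \<in> M" and t: "(W, \<Phi>) \<in> trivs B" for U \<phi> W \<Phi>
    unfolding triv_image[OF B t Int_lower2[of U W]]
  proof (rule smooth_on_cong)
    show "open (\<phi> ` (U \<inter> W) \<times> UNIV)"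
      using atlas_openD(1)[OF pre_bundleD(3)[OF B t] c] by (simp add: Int_commute open_Times)
    fix z :: "'e \<times> 'f" assume "z \<in> \<phi> ` (U \<inter> W) \<times> UNIV"
    then obtain p w where z: "z = (\<phi> p, w)" "p \<in> U" "p \<in> W" by auto
    show "(h \<circ> inv_into {x \<in> total_space B. proj B x \<in> U \<inter> W} (\<lambda>x. (\<phi> (proj B x), \<Phi> x))) z =
        h (inv_into (fibre B (inv_into U \<phi> (fst z))) \<Phi> (snd z))"
      using total_chart_inv[OF B t c z(2,3)] pre_atlasD(1)[OF preM c] z by simp
  qed
  show ?thesis
    unfolding smooth_functions_iff[OF pre_atlas_total_atlas[OF B]]
  proof safe
    fix U \<phi> W \<Phi> assume h: "\<forall>(U, \<phi>)\<in>total_atlas M B. smooth_on (\<phi> ` U) (h \<circ> inv_into U \<phi>)"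
      and c: "(U, \<phi>) \<in> M" and t: "(W, \<Phi>) \<in> trivs B"
    from h total_atlasI[OF c t] show "smooth_on (\<phi> ` (U \<inter> W) \<times> UNIV)
       (\<lambda>z. h (inv_into (fibre B (inv_into U \<phi> (fst z))) \<Phi> (snd z)))"
      unfolding eq[OF c t, symmetric] by blast
  next
    fix V \<psi> assume h: "\<forall>(U, \<phi>)\<in>M. \<forall>(W, \<Phi>)\<in>trivs B. smooth_on (\<phi> ` (U \<inter> W) \<times> UNIV)
       (\<lambda>z. h (inv_into (fibre B (inv_into U \<phi> (fst z))) \<Phi> (snd z)))" and "(V, \<psi>) \<in> total_atlas M B"
    from this(2) obtain U \<phi> W \<Phi> where c: "(U, \<phi>) \<in> M" "(W, \<Phi>) \<in> trivs B"
      "V = {x \<in> total_space B. proj B x \<in> U \<inter> W}" "\<psi> = (\<lambda>x. (\<phi> (proj B x), \<Phi> x))" by (rule total_atlasE)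
    show "smooth_on (\<psi> ` V) (h \<circ> inv_into V \<psi>)"
      unfolding c(3,4) eq[OF c(1,2)] using h c by blast
  qed
qed

lemma smooth_functions_proj:
  assumes B: "pre_bundle M (B :: ('x, 'm, 'f::real_inner, 'z) fibre_bundle_scheme)" and f: "f \<in> smooth_functions M"
  shows "f \<circ> proj B \<in> smooth_functions (total_atlas M B)"
  unfolding smooth_total_iff[OF B]
proof safe
  note M = pre_bundleD(1)[OF B]
  note preM = smooth_manifold_pre_atlas[OF M]
  fix U \<phi> W \<Phi> assume c: "(U, \<phi>) \<in> M" and t: "(W, \<Phi>) \<in> trivs B"
  have o: "open (\<phi> ` (U \<inter> W))"
    using atlas_openD(1)[OF pre_bundleD(3)[OF B t] c] by (simp add: Int_commute)
  have o2: "open (\<phi> ` (U \<inter> W) \<times> (UNIV :: 'f set))" by (intro open_Times o open_UNIV)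
  have sf: "smooth_on (\<phi> ` (U \<inter> W)) (f \<circ> inv_into U \<phi>)" by (rule smooth_on_subset[OF smooth_functionsD[OF preM f c]]) auto
  have "smooth_on (\<phi> ` (U \<inter> W) \<times> (UNIV :: 'f set)) (\<lambda>z. (f \<circ> inv_into U \<phi>) (fst z))"
    by (rule smooth_on_compose[OF smooth_manifold_fd[OF M] o2 o smooth_on_bounded_linear[OF bounded_linear_fst] sf]) auto
  then show "smooth_on (\<phi> ` (U \<inter> W) \<times> UNIV) (\<lambda>z. (f \<circ> proj B) (inv_into (fibre B (inv_into U \<phi> (fst z))) \<Phi> (snd z)))"
  proof (rule smooth_on_transform[OF _ o2])
    fix z :: "_ \<times> 'f" assume "z \<in> \<phi> ` (U \<inter> W) \<times> UNIV"
    then obtain p where p: "fst z = \<phi> p" "p \<in> U" "p \<in> W" by auto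
    have "inv_into (fibre B p) \<Phi> (snd z) \<in> fibre B p"
      using pre_bundleD(4)[OF B t p(3)] by (metis UNIV_I bij_betw_def inv_into_into)
    then show "(f \<circ> inv_into U \<phi>) (fst z) = (f \<circ> proj B) (inv_into (fibre B (inv_into U \<phi> (fst z))) \<Phi> (snd z))"
      using p pre_atlasD(1)[OF preM c] by (simp add: fibre_def)
  qed
qed

lemma triv_inverse:
  assumes B: "pre_bundle M B" and t: "(W, \<Phi>) \<in> trivs B" and p: "p \<in> W"
  shows "inv_into (fibre B p) \<Phi> w \<in> fibre B p" "\<Phi> (inv_into (fibre B p) \<Phi> w) = w"
    "x \<in> fibre B p \<Longrightarrow> inv_into (fibre B p) \<Phi> (\<Phi> x) = x"
proof -
  have b: "bij_betw \<Phi> (fibre B p) UNIV" by (rule pre_bundleD(4)[OF B t p])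
  then show "inv_into (fibre B p) \<Phi> w \<in> fibre B p" by (metis UNIV_I bij_betw_def inv_into_into)
  show "\<Phi> (inv_into (fibre B p) \<Phi> w) = w" using b by (metis UNIV_I bij_betw_inv_into_right)
  show "x \<in> fibre B p \<Longrightarrow> inv_into (fibre B p) \<Phi> (\<Phi> x) = x" using b by (metis bij_betw_inv_into_left)
qed

lemma fibre_nonempty: "pre_bundle M B \<Longrightarrow> p \<in> points M \<Longrightarrow> \<exists>x. x \<in> fibre B p"
  using pre_bundleD(5)[of M B p] triv_inverse(1)[of M B] by blast

text \<open>Locally the descended function is \<open>h\<close> along the section of fibre coordinate
  0, which is smooth in its trivialization; constancy on the fibres makes the result independent of
  that section.\<close>

lemma smooth_functions_descend:
  assumes B: "pre_bundle M (B :: ('x, 'm, 'f::real_inner, 'z) fibre_bundle_scheme)"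
    and h: "h \<in> smooth_functions (total_atlas M B)"
    and const: "\<And>p x y. p \<in> points M \<Longrightarrow> x \<in> fibre B p \<Longrightarrow> y \<in> fibre B p \<Longrightarrow> h x = h y"
  shows "\<exists>f\<in>smooth_functions M. \<forall>x\<in>total_space B. h x = f (proj B x)"
proof -
  note M = pre_bundleD(1)[OF B]
  note preM = smooth_manifold_pre_atlas[OF M]
  define f where "f p = h (SOME x. x \<in> fibre B p)" for p
  have f: "f p = h x" if "p \<in> points M" "x \<in> fibre B p" for p x
    unfolding f_def by (rule const[OF that(1) someI that(2)]) (rule that(2))
  have "f \<in> smooth_functions M"
    unfolding smooth_functions_iff_near[OF M]
  proof
    fix p assume p: "p \<in> points M"
    obtain W \<Phi> where t: "(W, \<Phi>) \<in> trivs B" "p \<in> W" using pre_bundleD(5)[OF B p] by blast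
    obtain c where c: "c \<in> M" "p \<in> fst c" by (rule points_chart[OF p])
    define U \<phi> where "U = fst c" and "\<phi> = snd c"
    have U: "(U, \<phi>) \<in> M" "p \<in> U" using c by (auto simp: U_def \<phi>_def)
    have o: "open (\<phi> ` (U \<inter> W))"
      using atlas_openD(1)[OF pre_bundleD(3)[OF B t(1)] U(1)] by (simp add: Int_commute)
    have o2: "open (\<phi> ` (U \<inter> W) \<times> (UNIV :: 'f set))" by (intro open_Times o open_UNIV)
    have sh: "smooth_on (\<phi> ` (U \<inter> W) \<times> UNIV) (\<lambda>z. h (inv_into (fibre B (inv_into U \<phi> (fst z))) \<Phi> (snd z)))"
      using h U(1) t(1) unfolding smooth_total_iff[OF B] by blast
    have "smooth_on (\<phi> ` (U \<inter> W)) (\<lambda>y. h (inv_into (fibre B (inv_into U \<phi> (fst (y, 0::'f)))) \<Phi> (snd (y, 0::'f))))"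
      by (rule smooth_on_compose[OF _ o o2 _ sh])
        (auto intro!: finite_dimensional_prod smooth_manifold_fd[OF M] pre_bundleD(6)[OF B] smooth_on_Pair o smooth_on_id smooth_on_const)
    then have "smooth_on (\<phi> ` (U \<inter> W)) (f \<circ> inv_into U \<phi>)"
    proof (rule smooth_on_transform[OF _ o])
      fix y assume "y \<in> \<phi> ` (U \<inter> W)"
      then obtain q where q: "y = \<phi> q" "q \<in> U" "q \<in> W" by auto
      then show "h (inv_into (fibre B (inv_into U \<phi> (fst (y, 0::'f)))) \<Phi> (snd (y, 0::'f))) = (f \<circ> inv_into U \<phi>) y"
        using f[of q, OF _ triv_inverse(1)[OF B t(1) q(3), of 0]] chart_points[OF U(1)] pre_atlasD(1)[OF preM U(1)] by auto
    qed
    then show "smooth_near M p f" unfolding smooth_near_def using U t o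
      by (intro exI[of _ U] exI[of _ \<phi>] exI[of _ "\<phi> ` (U \<inter> W)"]) auto
  qed
  moreover have "h x = f (proj B x)" if "x \<in> total_space B" for x
    using f[OF pre_bundleD(2)[OF B that], of x] that by (simp add: fibre_def)
  ultimately show ?thesis by blast
qed

lemma atlas_open_proj_vimage:
  assumes B: "pre_bundle M B" and V: "atlas_open M V"
  shows "atlas_open (total_atlas M B) {x \<in> total_space B. proj B x \<in> V}"
  unfolding atlas_open_def points_total_atlas[OF B]
proof safe
  fix V' \<psi> assume "(V', \<psi>) \<in> total_atlas M B"
  then obtain U \<phi> W \<Phi> where c: "(U, \<phi>) \<in> M" "(W, \<Phi>) \<in> trivs B"
      "V' = {x \<in> total_space B. proj B x \<in> U \<inter> W}" "\<psi> = (\<lambda>x. (\<phi> (proj B x), \<Phi> x))" by (rule total_atlasE)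
  have "{x \<in> total_space B. proj B x \<in> V} \<inter> V' = {x \<in> total_space B. proj B x \<in> V \<inter> W \<inter> U}" using c(3) by auto
  then have "\<psi> ` ({x \<in> total_space B. proj B x \<in> V} \<inter> V') = \<phi> ` (V \<inter> W \<inter> U) \<times> UNIV"
    using triv_image[OF B c(2), of "V \<inter> W \<inter> U" \<phi>] c(4) by auto
  moreover have "open (\<phi> ` (V \<inter> W \<inter> U))"
    using atlas_openD(1)[OF atlas_open_Int[OF smooth_manifold_pre_atlas[OF pre_bundleD(1)[OF B]] V pre_bundleD(3)[OF B c(2)]] c(1)] .
  ultimately show "open (\<psi> ` ({x \<in> total_space B. proj B x \<in> V} \<inter> V'))" by (simp add: open_Times)
qed

text \<open>Turns the transition condition of \<open>is_fibre_bundle\<close>, phrased with a product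
  atlas, into smoothness on an open subset of the product of the model spaces, where the calculus of
  \<open>smooth_on\<close> applies.\<close>

lemma smooth_map_restrict_prod_iff:
  fixes F :: "'m \<times> 'g::real_inner \<Rightarrow> 'h::real_inner"
  assumes M: "smooth_manifold M" and Q: "atlas_open M Q"
  shows "smooth_map (prod_atlas (restrict_atlas M Q) (euclid :: ('g, 'g) atlas)) euclid F \<longleftrightarrow>
    (\<forall>(U, \<phi>)\<in>M. smooth_on (\<phi> ` (U \<inter> Q) \<times> UNIV) (\<lambda>z. F (inv_into U \<phi> (fst z), snd z)))"
proof -
  let ?P = "prod_atlas (restrict_atlas M Q) (euclid :: ('g, 'g) atlas)"
  note preM = smooth_manifold_pre_atlas[OF M]
  have P: "?P = (\<lambda>(U, \<phi>). ((U \<inter> Q) \<times> UNIV, map_prod \<phi> id)) ` M"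
  proof (intro set_eqI iffI)
    fix x assume "x \<in> ?P"
    then obtain U' \<phi> where x: "(U', \<phi>) \<in> restrict_atlas M Q" "x = (U' \<times> UNIV, map_prod \<phi> id)"
      unfolding prod_atlas_def euclid_def by blast
    from x(1) obtain U where "(U, \<phi>) \<in> M" "U' = U \<inter> Q" by (auto simp: restrict_atlas_def)
    with x(2) show "x \<in> (\<lambda>(U, \<phi>). ((U \<inter> Q) \<times> UNIV, map_prod \<phi> id)) ` M"
      by (intro image_eqI[of _ _ "(U, \<phi>)"]) auto
  next
    fix x assume "x \<in> (\<lambda>(U, \<phi>). ((U \<inter> Q) \<times> (UNIV :: 'g set), map_prod \<phi> (id :: 'g \<Rightarrow> 'g))) ` M"
    then obtain U \<phi> where x: "(U, \<phi>) \<in> M" "x = ((U \<inter> Q) \<times> UNIV, map_prod \<phi> id)" by auto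
    then have "(U \<inter> Q, \<phi>) \<in> restrict_atlas M Q" by (force simp: restrict_atlas_def)
    then show "x \<in> ?P" unfolding prod_atlas_def euclid_def x(2) by blast
  qed
  have im: "map_prod \<phi> (id :: 'g \<Rightarrow> 'g) ` ((U \<inter> Q) \<times> UNIV) = \<phi> ` (U \<inter> Q) \<times> UNIV" for U and \<phi> :: "'m \<Rightarrow> 'a"
    by (simp add: map_prod_surj_on)
  have o: "open (\<phi> ` (U \<inter> Q) \<times> (UNIV :: 'g set))" if "(U, \<phi>) \<in> M" for U \<phi>
    using atlas_openD(1)[OF Q that] by (simp add: Int_commute open_Times)
  have inj: "inj_on (map_prod \<phi> (id :: 'g \<Rightarrow> 'g)) ((U \<inter> Q) \<times> UNIV)" if "(U, \<phi>) \<in> M" for U \<phi>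
    using pre_atlasD(1)[OF preM that] by (auto simp: inj_on_def)
  have "pre_atlas ?P"
    unfolding pre_atlas_def P using inj o by (auto simp: im simp del: map_prod_surj_on)
  moreover have "smooth_on (map_prod \<phi> (id :: 'g \<Rightarrow> 'g) ` ((U \<inter> Q) \<times> UNIV)) (F \<circ> inv_into ((U \<inter> Q) \<times> UNIV) (map_prod \<phi> id)) \<longleftrightarrow>
     smooth_on (\<phi> ` (U \<inter> Q) \<times> UNIV) (\<lambda>z. F (inv_into U \<phi> (fst z), snd z))" if c: "(U, \<phi>) \<in> M" for U \<phi>
    unfolding im
  proof (rule smooth_on_cong[OF o[OF c]])
    fix z :: "_ \<times> 'g" assume "z \<in> \<phi> ` (U \<inter> Q) \<times> UNIV"
    then obtain p w where z: "z = (\<phi> p, w)" "p \<in> U" "p \<in> Q" by auto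
    have "inv_into ((U \<inter> Q) \<times> UNIV) (map_prod \<phi> id) (map_prod \<phi> id (p, w)) = (p, w)"
      by (rule inv_into_f_f[OF inj[OF c]]) (use z in auto)
    then show "(F \<circ> inv_into ((U \<inter> Q) \<times> UNIV) (map_prod \<phi> id)) z = F (inv_into U \<phi> (fst z), snd z)"
      using z pre_atlasD(1)[OF preM c] by simp
  qed
  ultimately show ?thesis by (auto simp: smooth_map_euclid_iff P case_prod_unfold)
qed

subsection \<open>Affine functions and the bundle of affine functions\<close>

locale affine_bundle_over =
  fixes M :: "('m, 'e::real_inner) atlas"
    and A :: "('x, 'm, 'f::euclidean_space, 'v) affine_bundle"
  assumes affine: "is_affine_bundle M A"
begin

lemma fibre_bundle: "is_fibre_bundle M A"
  using affine by (simp add: is_affine_bundle_def)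

lemma preA: "pre_bundle M A"
  by (rule is_fibre_bundle_pre_bundle[OF fibre_bundle])

lemma M: "smooth_manifold M"
  by (rule pre_bundleD(1)[OF preA])

lemma preM: "pre_atlas M"
  by (rule smooth_manifold_pre_atlas[OF M])

lemma preN: "pre_atlas (total_atlas M A)"
  by (rule pre_atlas_total_atlas[OF preA])

lemma triv_points: "(W, \<Phi>) \<in> trivs A \<Longrightarrow> p \<in> W \<Longrightarrow> p \<in> points M"
  using atlas_openD(2)[OF pre_bundleD(3)[OF preA]] by blast

text \<open>The linear part \<Psi> of the trivialization carries the linear form on the model fibre
  to one on \<open>'f\<close>, which is represented by a vector. From here on affineness is handled
  through this formula and the model bundle no longer appears.\<close>

lemma affine_on_fibre_iff:
  assumes t: "(W, \<Phi>) \<in> trivs A" and p: "p \<in> W"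
  shows "affine_on_fibre A p a \<longleftrightarrow> (\<exists>g k. \<forall>x\<in>fibre A p. a x = g \<bullet> \<Phi> x + k)"
proof -
  let ?V = "fibre (model A) p"
  have pM: "p \<in> points M" by (rule triv_points[OF t p])
  have "\<forall>(W, \<Phi>)\<in>trivs A. \<exists>\<Psi>.
       is_vector_bundle M ((model A)\<lparr>trivs := insert (W, \<Psi>) (trivs (model A))\<rparr>) \<and>
       (\<forall>p\<in>W. \<forall>x\<in>fibre A p. \<forall>v\<in>fibre (model A) p. \<Phi> (translate A x v) = \<Phi> x + \<Psi> v)"
    using affine unfolding is_affine_bundle_def by (elim conjE)
  from bspec[OF this t, unfolded prod.case] obtain \<Psi> where
    \<Psi>: "is_vector_bundle M ((model A)\<lparr>trivs := insert (W, \<Psi>) (trivs (model A))\<rparr>)"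
    and tr': "\<forall>p\<in>W. \<forall>x\<in>fibre A p. \<forall>v\<in>fibre (model A) p. \<Phi> (translate A x v) = \<Phi> x + \<Psi> v"
    by (elim exE conjE)
  have tr: "\<Phi> (translate A x v) = \<Phi> x + \<Psi> v" if "x \<in> fibre A p" "v \<in> ?V" for x v
    using tr' p that by blast
  let ?V' = "(model A)\<lparr>trivs := insert (W, \<Psi>) (trivs (model A))\<rparr>"
  have fib: "fibre ?V' p = ?V" by (simp add: fibre_def)
  have t': "(W, \<Psi>) \<in> trivs ?V'" by simp
  have "is_fibre_bundle M ?V'" using \<Psi> unfolding is_vector_bundle_def by (rule conjunct1)
  from pre_bundleD(4)[OF is_fibre_bundle_pre_bundle[OF this] t' p] have b: "bij_betw \<Psi> ?V UNIV"
    unfolding fib .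
  have "\<forall>(W, \<Psi>)\<in>trivs ?V'. \<forall>p\<in>W. \<forall>v\<in>fibre ?V' p.
        (\<forall>w\<in>fibre ?V' p. \<Psi> (vadd ?V' v w) = \<Psi> v + \<Psi> w) \<and> (\<forall>r. \<Psi> (vscale ?V' r v) = r *\<^sub>R \<Psi> v)"
    using \<Psi> unfolding is_vector_bundle_def by (elim conjE)
  from bspec[OF this t'] have "\<forall>v\<in>?V. (\<forall>w\<in>?V. \<Psi> (vadd (model A) v w) = \<Psi> v + \<Psi> w) \<and>
      (\<forall>r. \<Psi> (vscale (model A) r v) = r *\<^sub>R \<Psi> v)"
    using p fib by simp
  then have lin: "v \<in> ?V \<Longrightarrow> w \<in> ?V \<Longrightarrow> \<Psi> (vadd (model A) v w) = \<Psi> v + \<Psi> w"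
      "v \<in> ?V \<Longrightarrow> \<Psi> (vscale (model A) r v) = r *\<^sub>R \<Psi> v" for v w r
    by blast+
  have "is_vector_bundle M (model A)" using affine by (simp add: is_affine_bundle_def)
  then have cl: "v \<in> ?V \<Longrightarrow> w \<in> ?V \<Longrightarrow> vadd (model A) v w \<in> ?V" "v \<in> ?V \<Longrightarrow> vscale (model A) r v \<in> ?V" for v w r
    using pM unfolding is_vector_bundle_def by blast+
  have tc: "translate A x v \<in> fibre A p" if "x \<in> fibre A p" "v \<in> ?V" for x v
    using affine pM that unfolding is_affine_bundle_def by blast
  have "\<forall>x\<in>fibre A p. \<forall>y\<in>fibre A p. \<exists>!v. v \<in> ?V \<and> translate A x v = y"
    using affine pM unfolding is_affine_bundle_def by simp
  then have trans: "\<exists>v\<in>?V. translate A x v = y" if "x \<in> fibre A p" "y \<in> fibre A p" for x y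
    using that by blast
  define \<Psi>' where "\<Psi>' = inv_into ?V \<Psi>"
  have \<Psi>': "\<Psi>' w \<in> ?V" "\<Psi> (\<Psi>' w) = w" for w
    unfolding \<Psi>'_def using b by (metis UNIV_I bij_betw_def inv_into_into) (metis UNIV_I b bij_betw_inv_into_right)
  have \<Psi>'\<Psi>: "\<Psi>' (\<Psi> v) = v" if "v \<in> ?V" for v
    unfolding \<Psi>'_def using b that by (metis bij_betw_inv_into_left)
  show ?thesis
  proof
    assume "affine_on_fibre A p a"
    then obtain l where l: "\<And>v w. v \<in> ?V \<Longrightarrow> w \<in> ?V \<Longrightarrow> l (vadd (model A) v w) = l v + l w"
      "\<And>r v. v \<in> ?V \<Longrightarrow> l (vscale (model A) r v) = r * l v"
      "\<And>x v. x \<in> fibre A p \<Longrightarrow> v \<in> ?V \<Longrightarrow> a (translate A x v) = a x + l v"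
      unfolding affine_on_fibre_def by blast
    have "linear (\<lambda>w. l (\<Psi>' w))"
    proof (rule linearI)
      fix w w' r
      have "\<Psi>' (w + w') = vadd (model A) (\<Psi>' w) (\<Psi>' w')"
        using \<Psi>'\<Psi>[OF cl(1)[OF \<Psi>'(1) \<Psi>'(1)], of w w'] by (simp add: lin \<Psi>')
      then show "l (\<Psi>' (w + w')) = l (\<Psi>' w) + l (\<Psi>' w')" by (simp add: l \<Psi>')
      have "\<Psi>' (r *\<^sub>R w) = vscale (model A) r (\<Psi>' w)"
        using \<Psi>'\<Psi>[OF cl(2)[OF \<Psi>'(1)], of r w] by (simp add: lin \<Psi>')
      then show "l (\<Psi>' (r *\<^sub>R w)) = r *\<^sub>R l (\<Psi>' w)" by (simp add: l \<Psi>')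
    qed
    \<comment> \<open>The adjoint of a linear functional, evaluated at 1, is the vector that
      represents it.\<close>
    define G where "G = adjoint (\<lambda>w. l (\<Psi>' w)) 1"
    have g: "l (\<Psi>' w) = G \<bullet> w" for w
      using adjoint_works[OF \<open>linear (\<lambda>w. l (\<Psi>' w))\<close>, of w 1] by (simp add: G_def inner_commute)
    \<comment> \<open>The point of coordinate 0 serves as origin of the fibre, so the constant term
      is the value there.\<close>
    define x0 where "x0 = inv_into (fibre A p) \<Phi> 0"
    have x0: "x0 \<in> fibre A p" "\<Phi> x0 = 0" using triv_inverse(1,2)[OF preA t p, of 0] by (simp_all add: x0_def)
    have "a x = G \<bullet> \<Phi> x + a x0" if x: "x \<in> fibre A p" for x
    proof -
      obtain v where v: "v \<in> ?V" "translate A x0 v = x" using trans[OF x0(1) x] by blast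
      then have "\<Phi> x = \<Psi> v" using tr[OF x0(1) v(1)] x0 by simp
      then have vv: "\<Psi>' (\<Phi> x) = v" using \<Psi>'\<Psi>[OF v(1)] by simp
      show ?thesis using l(3)[OF x0(1) v(1)] g[of "\<Phi> x"] unfolding vv v(2) by simp
    qed
    then show "\<exists>g k. \<forall>x\<in>fibre A p. a x = g \<bullet> \<Phi> x + k" by blast
  next
    assume "\<exists>g k. \<forall>x\<in>fibre A p. a x = g \<bullet> \<Phi> x + k"
    then obtain g k where g: "\<And>x. x \<in> fibre A p \<Longrightarrow> a x = g \<bullet> \<Phi> x + k" by blast
    show "affine_on_fibre A p a" unfolding affine_on_fibre_def
      by (rule exI[of _ "\<lambda>v. g \<bullet> \<Psi> v"]) (auto simp: lin inner_add_right g tc tr)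
  qed
qed

section \<open>The vector bundle of fibrewise affine functions\<close>

definition plus_triv :: "('x \<Rightarrow> 'f) \<Rightarrow> 'm \<times> ('x \<Rightarrow> real) \<Rightarrow> 'f \<times> real" where
  "plus_triv \<Phi> = (\<lambda>(p, \<alpha>).
     let \<alpha>' = \<alpha> \<circ> inv_into (fibre A p) \<Phi>
     in (\<Sum>b\<in>Basis. (\<alpha>' b - \<alpha>' 0) *\<^sub>R b, \<alpha>' 0))"

lemma trivs_Aplus: "trivs (Aplus M A) = {(W, plus_triv \<Phi>) |W \<Phi>. (W, \<Phi>) \<in> trivs A}"
  by (simp add: Aplus_def plus_triv_def)

lemma fibre_Aplus: "fibre (Aplus M A) p =
    (if p \<in> points M then {p} \<times> {\<alpha>. affine_on_fibre A p \<alpha> \<and> (\<forall>x. x \<notin> fibre A p \<longrightarrow> \<alpha> x = 0)} else {})"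
  by (auto simp: fibre_def Aplus_def)

lemma plus_triv_eq:
  assumes t: "(W, \<Phi>) \<in> trivs A" and p: "p \<in> W" and \<alpha>: "\<And>x. x \<in> fibre A p \<Longrightarrow> \<alpha> x = g \<bullet> \<Phi> x + k"
  shows "plus_triv \<Phi> (p, \<alpha>) = (g, k)"
  using triv_inverse[OF preA t p] by (simp add: plus_triv_def \<alpha> euclidean_representation)

lemma plus_triv_apply:
  assumes t: "(W, \<Phi>) \<in> trivs A" and p: "p \<in> W" and z: "affine_on_fibre A p \<alpha>" and x: "x \<in> fibre A p"
  shows "\<alpha> x = fst (plus_triv \<Phi> (p, \<alpha>)) \<bullet> \<Phi> x + snd (plus_triv \<Phi> (p, \<alpha>))"
proof -
  obtain g k where "\<And>x. x \<in> fibre A p \<Longrightarrow> \<alpha> x = g \<bullet> \<Phi> x + k" using z affine_on_fibre_iff[OF t p] by blast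
  with plus_triv_eq[OF t p, of \<alpha> g k] x show ?thesis by simp
qed

lemma plus_triv_bij:
  assumes t: "(W, \<Phi>) \<in> trivs A" and p: "p \<in> W"
  shows "bij_betw (plus_triv \<Phi>) (fibre (Aplus M A) p) UNIV"
    and "inv_into (fibre (Aplus M A) p) (plus_triv \<Phi>) (g, k) = (p, \<lambda>x. if x \<in> fibre A p then g \<bullet> \<Phi> x + k else 0)"
proof -
  have fib: "fibre (Aplus M A) p = {p} \<times> {\<alpha>. affine_on_fibre A p \<alpha> \<and> (\<forall>x. x \<notin> fibre A p \<longrightarrow> \<alpha> x = 0)}"
    by (simp add: fibre_Aplus triv_points[OF t p])
  have inv: "(p, \<lambda>x. if x \<in> fibre A p then g \<bullet> \<Phi> x + k else 0) \<in> fibre (Aplus M A) p"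
    "plus_triv \<Phi> (p, \<lambda>x. if x \<in> fibre A p then g \<bullet> \<Phi> x + k else 0) = (g, k)" for g k
    unfolding fib by (auto simp: affine_on_fibre_iff[OF t p] intro!: plus_triv_eq[OF t p])
  have inj: "inj_on (plus_triv \<Phi>) (fibre (Aplus M A) p)"
  proof (rule inj_onI)
    fix y z assume y: "y \<in> fibre (Aplus M A) p" and z: "z \<in> fibre (Aplus M A) p" and eq: "plus_triv \<Phi> y = plus_triv \<Phi> z"
    obtain \<alpha> \<beta> where ab: "y = (p, \<alpha>)" "z = (p, \<beta>)" "affine_on_fibre A p \<alpha>" "affine_on_fibre A p \<beta>"
      "\<And>x. x \<notin> fibre A p \<Longrightarrow> \<alpha> x = 0" "\<And>x. x \<notin> fibre A p \<Longrightarrow> \<beta> x = 0" using y z unfolding fib by auto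
    have "\<alpha> x = \<beta> x" for x
      using plus_triv_apply[OF t p ab(3)] plus_triv_apply[OF t p ab(4)] eq ab by (cases "x \<in> fibre A p") auto
    then show "y = z" using ab by auto
  qed
  show "inv_into (fibre (Aplus M A) p) (plus_triv \<Phi>) (g, k) = (p, \<lambda>x. if x \<in> fibre A p then g \<bullet> \<Phi> x + k else 0)"
    using inv_into_f_f[OF inj inv(1)] inv(2) by simp
  have "plus_triv \<Phi> ` fibre (Aplus M A) p = UNIV"
  proof (intro set_eqI iffI UNIV_I)
    fix z :: "'f \<times> real"
    obtain g k where z: "z = (g, k)" by (cases z)
    show "z \<in> plus_triv \<Phi> ` fibre (Aplus M A) p"
      unfolding z using imageI[OF inv(1)[of g k], of "plus_triv \<Phi>"] by (simp only: inv(2))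
  qed
  then show "bij_betw (plus_triv \<Phi>) (fibre (Aplus M A) p) UNIV" using inj by (simp add: bij_betw_def)
qed

lemma fd_e: "finite_dimensional TYPE('e)"
  by (rule smooth_manifold_fd[OF M])

lemma triv_transition_smooth:
  assumes t: "(W, \<Phi>) \<in> trivs A" and t': "(W', \<Phi>') \<in> trivs A" and c: "(U, \<phi>) \<in> M"
  shows "smooth_on (\<phi> ` (U \<inter> (W \<inter> W')) \<times> UNIV)
    (\<lambda>z. \<Phi>' (inv_into (fibre A (inv_into U \<phi> (fst z))) \<Phi> (snd z)))"
proof -
  have "smooth_map (prod_atlas (restrict_atlas M (W \<inter> W')) (euclid :: ('f, 'f) atlas)) euclid
          (\<lambda>(p, y). \<Phi>' (inv_into (fibre A p) \<Phi> y))"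
    using fibre_bundle t t' unfolding is_fibre_bundle_def by blast
  from this[unfolded smooth_map_restrict_prod_iff[OF M atlas_open_Int[OF preM pre_bundleD(3)[OF preA t] pre_bundleD(3)[OF preA t']]]]
  show ?thesis using c by auto
qed

text \<open>The pair \<open>(g, k)\<close> stands for the function
  \<open>g \<bullet> \<Phi> x + k\<close>. Its coordinates in a second trivialization are computed
  from the values of this function at the points whose second coordinate is 0 or a basis vector.
  Smoothness of the transition maps thus reduces to those of \<open>A\<close> at finitely many fixed
  fibre arguments.\<close>

lemma is_fibre_bundle_Aplus: "is_fibre_bundle M (Aplus M A)"
  unfolding is_fibre_bundle_def
proof (intro conjI)
  show "\<forall>(W, \<Phi>)\<in>trivs (Aplus M A). openin (atlas_topology M) W \<and> (\<forall>p\<in>W. bij_betw \<Phi> (fibre (Aplus M A) p) UNIV)"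
    using plus_triv_bij(1) pre_bundleD(3)[OF preA] by (auto simp: trivs_Aplus openin_atlas_topology[OF preM])
  show "finite_dimensional TYPE('f \<times> real)" by (intro finite_dimensional_prod finite_dimensional_euclidean)
  have "points M = (\<Union>t\<in>trivs A. fst t)" using fibre_bundle by (simp add: is_fibre_bundle_def)
  also have "\<dots> = (\<Union>t\<in>trivs (Aplus M A). fst t)" by (force simp: trivs_Aplus)
  finally show "points M = (\<Union>t\<in>trivs (Aplus M A). fst t)" .
  show "\<forall>(W, \<Phi>)\<in>trivs (Aplus M A). \<forall>(W', \<Phi>')\<in>trivs (Aplus M A).
       smooth_map (prod_atlas (restrict_atlas M (W \<inter> W')) euclid) euclid
        (\<lambda>(p, y). \<Phi>' (inv_into (fibre (Aplus M A) p) \<Phi> y))"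
  proof clarify
    fix W \<Phi>p W' \<Phi>p' assume "(W, \<Phi>p) \<in> trivs (Aplus M A)" "(W', \<Phi>p') \<in> trivs (Aplus M A)"
    then obtain \<Phi> \<Phi>' where t: "(W, \<Phi>) \<in> trivs A" "(W', \<Phi>') \<in> trivs A" "\<Phi>p = plus_triv \<Phi>" "\<Phi>p' = plus_triv \<Phi>'"
      by (auto simp: trivs_Aplus)
    let ?Q = "W \<inter> W'"
    have Q: "atlas_open M ?Q" by (rule atlas_open_Int[OF preM pre_bundleD(3)[OF preA t(1)] pre_bundleD(3)[OF preA t(2)]])
    have "smooth_on (\<phi> ` (U \<inter> ?Q) \<times> UNIV) (\<lambda>z. case (inv_into U \<phi> (fst z), snd z) of (p, y) \<Rightarrow>
          plus_triv \<Phi>' (inv_into (fibre (Aplus M A) p) (plus_triv \<Phi>) y))" if c: "(U, \<phi>) \<in> M" for U \<phi>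
    proof -
      have o: "open (\<phi> ` (U \<inter> ?Q))" using atlas_openD(1)[OF Q c] by (simp add: Int_commute)
      let ?S = "\<phi> ` (U \<inter> ?Q) \<times> (UNIV :: ('f \<times> real) set)"
      have oS: "open ?S" by (intro open_Times o open_UNIV)
      \<comment> \<open>The \<open>\<Phi>\<close>-coordinate of the point whose
        \<open>\<Phi>'\<close>-coordinate is \<open>w\<close>. Functions pull back, so the
        transition map of \<open>A\<close> enters in the direction opposite to the one being
        checked.\<close>
      define \<tau> where "\<tau> w z = \<Phi> (inv_into (fibre A (inv_into U \<phi> (fst z))) \<Phi>' w)" for w :: 'f and z :: "'e \<times> ('f \<times> real)"
      have st: "smooth_on ?S (\<tau> w)" for w
      proof -
        have tt: "smooth_on (\<phi> ` (U \<inter> ?Q) \<times> UNIV) (\<lambda>z. \<Phi> (inv_into (fibre A (inv_into U \<phi> (fst z))) \<Phi>' (snd z)))"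
          using triv_transition_smooth[OF t(2,1) c] by (simp add: Int_commute)
        have "smooth_on ?S (\<lambda>z. (fst z, w))"
          by (intro smooth_on_Pair oS smooth_on_bounded_linear bounded_linear_fst smooth_on_const)
        then have "smooth_on ?S (\<lambda>z. \<Phi> (inv_into (fibre A (inv_into U \<phi> (fst (fst z, w)))) \<Phi>' (snd (fst z, w))))"
          by (rule smooth_on_compose[OF finite_dimensional_prod[OF fd_e finite_dimensional_euclidean] oS open_Times[OF o open_UNIV] _ tt]) auto
        then show ?thesis by (simp add: \<tau>_def[abs_def])
      qed
      have sg: "smooth_on ?S (\<lambda>z. fst (snd z))" "smooth_on ?S (\<lambda>z. snd (snd z))"
        by (intro smooth_on_bounded_linear bounded_linear_compose[OF bounded_linear_fst bounded_linear_snd]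
            bounded_linear_compose[OF bounded_linear_snd bounded_linear_snd])+
      define \<sigma> where "\<sigma> w z = fst (snd z) \<bullet> \<tau> w z + snd (snd z)" for w z
      have ss: "smooth_on ?S (\<sigma> w)" for w
        unfolding \<sigma>_def[abs_def] by (intro smooth_on_add smooth_on_inner oS sg st)
      have "smooth_on ?S (\<lambda>z. (\<Sum>b\<in>Basis. (\<sigma> b z - \<sigma> 0 z) *\<^sub>R b, \<sigma> 0 z))"
        by (intro smooth_on_Pair smooth_on_sum smooth_on_scaleR smooth_on_minus smooth_on_const oS ss finite_Basis)
      then show "smooth_on ?S (\<lambda>z. case (inv_into U \<phi> (fst z), snd z) of (p, y) \<Rightarrow>
          plus_triv \<Phi>' (inv_into (fibre (Aplus M A) p) (plus_triv \<Phi>) y))"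
      proof (rule smooth_on_transform[OF _ oS])
        fix z assume "z \<in> ?S"
        then obtain p g k where z: "z = (\<phi> p, (g, k))" "p \<in> U" "p \<in> W" "p \<in> W'" by auto
        then show "(\<Sum>b\<in>Basis. (\<sigma> b z - \<sigma> 0 z) *\<^sub>R b, \<sigma> 0 z) = (case (inv_into U \<phi> (fst z), snd z) of (p, y) \<Rightarrow>
          plus_triv \<Phi>' (inv_into (fibre (Aplus M A) p) (plus_triv \<Phi>) y))"
          using pre_atlasD(1)[OF preM c] plus_triv_bij(2)[OF t(1) z(3)] triv_inverse(1)[OF preA t(2) z(4)]
          by (simp add: plus_triv_def \<sigma>_def \<tau>_def)
      qed
    qed
    then show "smooth_map (prod_atlas (restrict_atlas M ?Q) euclid) euclid
        (\<lambda>(p, y). \<Phi>p' (inv_into (fibre (Aplus M A) p) \<Phi>p y))"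
      unfolding smooth_map_restrict_prod_iff[OF M Q] t(3,4) by (intro ballI) (simp only: split_paired_all prod.case)
  qed
qed (use M in \<open>auto simp: Aplus_def\<close>)

lemma preAplus: "pre_bundle M (Aplus M A)"
  by (rule is_fibre_bundle_pre_bundle[OF is_fibre_bundle_Aplus])

lemma affine_on_fibre_add:
  assumes p: "p \<in> points M" and "affine_on_fibre A p a" "affine_on_fibre A p b"
  shows "affine_on_fibre A p (\<lambda>x. a x + b x)"
proof -
  obtain W \<Phi> where t: "(W, \<Phi>) \<in> trivs A" "p \<in> W" using pre_bundleD(5)[OF preA p] by blast
  obtain g k g' k' where "\<And>x. x \<in> fibre A p \<Longrightarrow> a x = g \<bullet> \<Phi> x + k" "\<And>x. x \<in> fibre A p \<Longrightarrow> b x = g' \<bullet> \<Phi> x + k'"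
    using assms affine_on_fibre_iff[OF t] by metis
  then show ?thesis unfolding affine_on_fibre_iff[OF t]
    by (intro exI[of _ "g + g'"] exI[of _ "k + k'"]) (auto simp: inner_add_left)
qed

lemma affine_on_fibre_scale:
  assumes p: "p \<in> points M" and "affine_on_fibre A p a"
  shows "affine_on_fibre A p (\<lambda>x. r * a x)"
proof -
  obtain W \<Phi> where t: "(W, \<Phi>) \<in> trivs A" "p \<in> W" using pre_bundleD(5)[OF preA p] by blast
  obtain g k where "\<And>x. x \<in> fibre A p \<Longrightarrow> a x = g \<bullet> \<Phi> x + k" using assms affine_on_fibre_iff[OF t] by metis
  then show ?thesis unfolding affine_on_fibre_iff[OF t]
    by (intro exI[of _ "r *\<^sub>R g"] exI[of _ "r * k"]) (auto simp: algebra_simps)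
qed

lemma affine_on_fibre_cong:
  assumes p: "p \<in> points M" and "affine_on_fibre A p a" "\<And>x. x \<in> fibre A p \<Longrightarrow> a x = b x"
  shows "affine_on_fibre A p b"
proof -
  obtain W \<Phi> where t: "(W, \<Phi>) \<in> trivs A" "p \<in> W" using pre_bundleD(5)[OF preA p] by blast
  show ?thesis using assms unfolding affine_on_fibre_iff[OF t] by auto
qed

lemma affine_on_fibre_const:
  assumes p: "p \<in> points M"
  shows "affine_on_fibre A p (\<lambda>x. r)"
proof -
  obtain W \<Phi> where t: "(W, \<Phi>) \<in> trivs A" "p \<in> W" using pre_bundleD(5)[OF preA p] by blast
  show ?thesis unfolding affine_on_fibre_iff[OF t] by (intro exI[of _ 0] exI[of _ r]) auto
qed

lemma is_vector_bundle_Aplus: "is_vector_bundle M (Aplus M A)"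
  unfolding is_vector_bundle_def
proof (intro conjI)
  have va: "vadd (Aplus M A) (p, \<alpha>) (q, \<beta>) = (p, \<lambda>x. \<alpha> x + \<beta> x)"
    and vs: "vscale (Aplus M A) r (p, \<alpha>) = (p, \<lambda>x. r * \<alpha> x)" for p \<alpha> q \<beta> r
    by (simp_all add: Aplus_def)
  show "\<forall>p\<in>points M. \<forall>v\<in>fibre (Aplus M A) p.
        (\<forall>w\<in>fibre (Aplus M A) p. vadd (Aplus M A) v w \<in> fibre (Aplus M A) p) \<and>
        (\<forall>r. vscale (Aplus M A) r v \<in> fibre (Aplus M A) p)"
    by (auto simp: fibre_Aplus va vs affine_on_fibre_add affine_on_fibre_scale)
  show "\<forall>(W, \<Psi>)\<in>trivs (Aplus M A). \<forall>p\<in>W. \<forall>v\<in>fibre (Aplus M A) p.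
        (\<forall>w\<in>fibre (Aplus M A) p. \<Psi> (vadd (Aplus M A) v w) = \<Psi> v + \<Psi> w) \<and>
        (\<forall>r. \<Psi> (vscale (Aplus M A) r v) = r *\<^sub>R \<Psi> v)"
    by (auto simp: trivs_Aplus fibre_Aplus va vs plus_triv_def Let_def algebra_simps sum.distrib
        sum_subtractf scaleR_sum_right split: if_splits)
qed (rule is_fibre_bundle_Aplus)

subsection \<open>Affine functions as sections\<close>

lemma affine_functionsD:
  "a \<in> affine_functions M A \<Longrightarrow> a \<in> smooth_functions (total_atlas M A)"
  "a \<in> affine_functions M A \<Longrightarrow> p \<in> points M \<Longrightarrow> affine_on_fibre A p a"
  by (auto simp: affine_functions_def)

lemma affine_functions_cong:
  assumes a: "a \<in> affine_functions M A" and ab: "\<And>x. x \<in> total_space A \<Longrightarrow> a x = b x"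
  shows "b \<in> affine_functions M A"
  unfolding affine_functions_def
proof safe
  show "b \<in> smooth_functions (total_atlas M A)"
    by (rule smooth_functions_cong[OF preN affine_functionsD(1)[OF a]]) (use ab in \<open>simp add: points_total_atlas[OF preA]\<close>)
  show "affine_on_fibre A p b" if "p \<in> points M" for p
    by (rule affine_on_fibre_cong[OF that affine_functionsD(2)[OF a that]]) (use ab in \<open>simp add: fibre_def\<close>)
qed

lemma affine_functions_const: "(\<lambda>_. r) \<in> affine_functions M A"
  by (auto simp: affine_functions_def smooth_functions_const[OF preN] affine_on_fibre_const)

lemma affine_functions_add:
  "a \<in> affine_functions M A \<Longrightarrow> b \<in> affine_functions M A \<Longrightarrow> (\<lambda>x. a x + b x) \<in> affine_functions M A"
  unfolding affine_functions_def using smooth_functions_add[OF preN, of a b] affine_on_fibre_add[of _ a b] by blast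

lemma affine_functions_proj_mult:
  assumes f: "f \<in> smooth_functions M" and a: "a \<in> affine_functions M A"
  shows "(\<lambda>x. f (proj A x) * a x) \<in> affine_functions M A"
  unfolding affine_functions_def
proof safe
  show "(\<lambda>x. f (proj A x) * a x) \<in> smooth_functions (total_atlas M A)"
    using smooth_functions_mult[OF preN smooth_functions_proj[OF preA f] affine_functionsD(1)[OF a]] by simp
  show "affine_on_fibre A p (\<lambda>x. f (proj A x) * a x)" if "p \<in> points M" for p
    by (rule affine_on_fibre_cong[OF that affine_on_fibre_scale[OF that affine_functionsD(2)[OF a that], of "f p"]])
      (auto simp: fibre_def)
qed

lemma affine_functions_proj: "f \<in> smooth_functions M \<Longrightarrow> f \<circ> proj A \<in> affine_functions M A"
  using affine_functions_proj_mult[OF _ affine_functions_const[of 1], of f] unfolding o_def mult_1_right .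

lemma affine_functions_scale: "a \<in> affine_functions M A \<Longrightarrow> (\<lambda>x. r * a x) \<in> affine_functions M A"
  by (rule affine_functions_proj_mult[OF smooth_functions_const[OF preM, of r]])

lemma affine_functions_sum:
  assumes "finite I" "\<And>i. i \<in> I \<Longrightarrow> a i \<in> affine_functions M A"
  shows "(\<lambda>x. \<Sum>i\<in>I. a i x) \<in> affine_functions M A"
  using assms
proof (induction I rule: finite_induct)
  case empty
  show ?case by (simp add: affine_functions_const)
next
  case (insert i I)
  then have "(\<lambda>x. a i x + (\<Sum>i\<in>I. a i x)) \<in> affine_functions M A" by (intro affine_functions_add) auto
  with insert.hyps show ?case by simp
qed

text \<open>The coordinates in an induced trivialization are built from the values of
  \<open>a\<close> along the local sections of \<open>A\<close> with constant fibre coordinate 0 or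
  a basis vector, so they inherit smoothness from \<open>a\<close>.\<close>

lemma tilde_in_sections:
  assumes a: "a \<in> affine_functions M A"
  shows "tilde M A a \<in> sections M (Aplus M A)"
  unfolding sections_iff[OF preAplus]
proof (intro conjI)
  show "tilde M A a \<in> extensional (points M)" by (simp add: tilde_def)
  show "\<forall>p\<in>points M. tilde M A a p \<in> fibre (Aplus M A) p"
    using affine_on_fibre_cong[OF _ affine_functionsD(2)[OF a]] by (auto simp: fibre_Aplus tilde_def)
  show "\<forall>(U, \<phi>)\<in>M. \<forall>(W, \<Phi>)\<in>trivs (Aplus M A). smooth_on (\<phi> ` (U \<inter> W)) (\<Phi> \<circ> tilde M A a \<circ> inv_into U \<phi>)"
  proof clarify
    fix U \<phi> W \<Phi>p assume c: "(U, \<phi>) \<in> M" and "(W, \<Phi>p) \<in> trivs (Aplus M A)"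
    then obtain \<Phi> where t: "(W, \<Phi>) \<in> trivs A" "\<Phi>p = plus_triv \<Phi>" by (auto simp: trivs_Aplus)
    let ?S = "\<phi> ` (U \<inter> W)"
    have o: "open ?S" using atlas_openD(1)[OF pre_bundleD(3)[OF preA t(1)] c] by (simp add: Int_commute)
    define \<sigma> where "\<sigma> w y = a (inv_into (fibre A (inv_into U \<phi> y)) \<Phi> w)" for w y
    have ss: "smooth_on ?S (\<sigma> w)" for w
    proof -
      have sa: "smooth_on (?S \<times> UNIV) (\<lambda>z. a (inv_into (fibre A (inv_into U \<phi> (fst z))) \<Phi> (snd z)))"
        using affine_functionsD(1)[OF a] c t unfolding smooth_total_iff[OF preA] by blast
      have "smooth_on ?S (\<lambda>y. (y, w))" by (intro smooth_on_Pair o smooth_on_id smooth_on_const)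
      then have "smooth_on ?S (\<lambda>y. a (inv_into (fibre A (inv_into U \<phi> (fst (y, w)))) \<Phi> (snd (y, w))))"
        by (rule smooth_on_compose[OF finite_dimensional_prod[OF fd_e finite_dimensional_euclidean] o open_Times[OF o open_UNIV] _ sa]) auto
      then show ?thesis by (simp add: \<sigma>_def[abs_def])
    qed
    have "smooth_on ?S (\<lambda>z. (\<Sum>b\<in>Basis. (\<sigma> b z - \<sigma> 0 z) *\<^sub>R b, \<sigma> 0 z))"
      by (intro smooth_on_Pair smooth_on_sum smooth_on_scaleR smooth_on_minus smooth_on_const o ss finite_Basis)
    then show "smooth_on ?S (\<Phi>p \<circ> tilde M A a \<circ> inv_into U \<phi>)"
    proof (rule smooth_on_transform[OF _ o])
      fix y assume "y \<in> ?S"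
      then obtain p where p: "y = \<phi> p" "p \<in> U" "p \<in> W" by auto
      then show "(\<Sum>b\<in>Basis. (\<sigma> b y - \<sigma> 0 y) *\<^sub>R b, \<sigma> 0 y) = (\<Phi>p \<circ> tilde M A a \<circ> inv_into U \<phi>) y"
        using pre_atlasD(1)[OF preM c] triv_inverse(1)[OF preA t(1) p(3)] triv_points[OF t(1) p(3)]
        by (simp add: plus_triv_def \<sigma>_def t(2) tilde_def)
    qed
  qed
qed

text \<open>Inverse of \<open>tilde\<close> on sections; in the other order the two cancel only on
  \<open>total_space A\<close>, since \<open>tilde\<close> forgets all other values.\<close>

definition untilde :: "('m \<Rightarrow> 'm \<times> ('x \<Rightarrow> real)) \<Rightarrow> 'x \<Rightarrow> real" where
  "untilde s x = snd (s (proj A x)) x"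

lemma section_fibre:
  assumes s: "s \<in> sections M (Aplus M A)" and p: "p \<in> points M"
  shows "fst (s p) = p" "affine_on_fibre A p (snd (s p))" "x \<notin> fibre A p \<Longrightarrow> snd (s p) x = 0"
proof -
  have "s p \<in> fibre (Aplus M A) p" using s p unfolding sections_iff[OF preAplus] by blast
  then show "fst (s p) = p" "affine_on_fibre A p (snd (s p))" "x \<notin> fibre A p \<Longrightarrow> snd (s p) x = 0"
    using p by (auto simp: fibre_Aplus)
qed

lemma tilde_untilde:
  assumes s: "s \<in> sections M (Aplus M A)"
  shows "tilde M A (untilde s) = s"
proof (rule extensionalityI)
  show "tilde M A (untilde s) \<in> extensional (points M)" by (simp add: tilde_def)
  show "s \<in> extensional (points M)" using s unfolding sections_iff[OF preAplus] by blast
  fix p assume p: "p \<in> points M"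
  have "(\<lambda>x. if x \<in> fibre A p then untilde s x else 0) = snd (s p)"
    using section_fibre(3)[OF s p] by (auto simp: untilde_def fibre_def)
  then show "tilde M A (untilde s) p = s p" using section_fibre(1)[OF s p] p by (simp add: tilde_def prod_eq_iff)
qed

text \<open>In a trivialization the function sends (y, w) to \<open>g \<bullet> w + k\<close>, where
  \<open>(g, k)\<close> are the coordinates of the section at y; this is jointly smooth, and affine
  in w.\<close>

lemma untilde_affine:
  assumes s: "s \<in> sections M (Aplus M A)"
  shows "untilde s \<in> affine_functions M A"
  unfolding affine_functions_def
proof safe
  show "affine_on_fibre A p (untilde s)" if "p \<in> points M" for p
    by (rule affine_on_fibre_cong[OF that section_fibre(2)[OF s that]]) (auto simp: untilde_def fibre_def)
  show "untilde s \<in> smooth_functions (total_atlas M A)"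
    unfolding smooth_total_iff[OF preA]
  proof clarify
    fix U \<phi> W \<Phi> assume c: "(U, \<phi>) \<in> M" and t: "(W, \<Phi>) \<in> trivs A"
    let ?T = "\<phi> ` (U \<inter> W)"
    let ?S = "?T \<times> (UNIV :: 'f set)"
    have o: "open ?T" using atlas_openD(1)[OF pre_bundleD(3)[OF preA t] c] by (simp add: Int_commute)
    have oS: "open ?S" by (intro open_Times o open_UNIV)
    have "(W, plus_triv \<Phi>) \<in> trivs (Aplus M A)" using t by (auto simp: trivs_Aplus)
    then have ss: "smooth_on ?T (plus_triv \<Phi> \<circ> s \<circ> inv_into U \<phi>)"
      using s c unfolding sections_iff[OF preAplus] by blast
    have s1: "smooth_on ?S (\<lambda>z. (plus_triv \<Phi> \<circ> s \<circ> inv_into U \<phi>) (fst z))"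
      by (rule smooth_on_compose[OF fd_e oS o smooth_on_bounded_linear[OF bounded_linear_fst] ss]) auto
    have "smooth_on ?S (\<lambda>z. fst ((plus_triv \<Phi> \<circ> s \<circ> inv_into U \<phi>) (fst z)) \<bullet> snd z + snd ((plus_triv \<Phi> \<circ> s \<circ> inv_into U \<phi>) (fst z)))"
      by (intro smooth_on_add smooth_on_inner oS smooth_on_fst[OF oS s1] smooth_on_snd[OF oS s1] smooth_on_bounded_linear bounded_linear_snd)
    then show "smooth_on ?S (\<lambda>z. untilde s (inv_into (fibre A (inv_into U \<phi> (fst z))) \<Phi> (snd z)))"
    proof (rule smooth_on_transform[OF _ oS])
      fix z assume "z \<in> ?S"
      then obtain p w where z: "z = (\<phi> p, w)" "p \<in> U" "p \<in> W" by auto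
      have pM: "p \<in> points M" by (rule triv_points[OF t z(3)])
      have inv_p: "proj A (inv_into (fibre A p) \<Phi> w) = p"
        using triv_inverse(1)[OF preA t z(3), of w] by (simp add: fibre_def)
      have "(p, snd (s p)) = s p" using section_fibre(1)[OF s pM] by (simp add: prod_eq_iff)
      moreover note plus_triv_apply[OF t z(3) section_fibre(2)[OF s pM] triv_inverse(1)[OF preA t z(3)], of w]
      ultimately show "fst ((plus_triv \<Phi> \<circ> s \<circ> inv_into U \<phi>) (fst z)) \<bullet> snd z + snd ((plus_triv \<Phi> \<circ> s \<circ> inv_into U \<phi>) (fst z))
        = untilde s (inv_into (fibre A (inv_into U \<phi> (fst z))) \<Phi> (snd z))"
        using z pre_atlasD(1)[OF preM c] inv_p by (simp add: untilde_def triv_inverse(2)[OF preA t z(3)])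
    qed
  qed
qed

lemma tilde_cong:
  assumes "\<And>x. x \<in> total_space A \<Longrightarrow> a x = b x"
  shows "tilde M A a = tilde M A b"
proof -
  have "(\<lambda>x. if x \<in> fibre A p then a x else 0) = (\<lambda>x. if x \<in> fibre A p then b x else 0)" for p
    by (rule ext) (simp add: fibre_def assms)
  then show ?thesis by (simp add: tilde_def)
qed

lemma untilde_tilde:
  assumes x: "x \<in> total_space A"
  shows "untilde (tilde M A a) x = a x"
proof -
  have "proj A x \<in> points M" by (rule pre_bundleD(2)[OF preA x])
  then show ?thesis using x by (simp add: untilde_def tilde_def fibre_def)
qed

lemma sec_add_tilde: "sec_add M (Aplus M A) (tilde M A a) (tilde M A b) = tilde M A (\<lambda>x. a x + b x)"
proof -
  have "(\<lambda>x. (if x \<in> fibre A p then a x else 0) + (if x \<in> fibre A p then b x else 0)) =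
      (\<lambda>x. if x \<in> fibre A p then a x + b x else 0)" for p by (rule ext) simp
  then show ?thesis unfolding sec_add_def tilde_def by (intro restrict_ext) (simp add: Aplus_def)
qed

lemma sec_mult_tilde: "sec_mult M (Aplus M A) f (tilde M A a) = tilde M A (\<lambda>x. f (proj A x) * a x)"
proof -
  have "(\<lambda>x. f p * (if x \<in> fibre A p then a x else 0)) =
      (\<lambda>x. if x \<in> fibre A p then f (proj A x) * a x else 0)" for p by (rule ext) (simp add: fibre_def)
  then show ?thesis unfolding sec_mult_def tilde_def by (intro restrict_ext) (simp add: Aplus_def)
qed

end

subsection \<open>The Jacobi bracket of affine functions\<close>

locale affine_jacobi_over = affine_bundle_over M A
  for M :: "('m, 'e::real_inner) atlas"
    and A :: "('x, 'm, 'f::euclidean_space, 'v) affine_bundle" +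
  fixes \<Lambda> :: "('x, 'e \<times> 'f) bivector_field"
    and E :: "'x \<Rightarrow> 'x \<times> ('x, 'e \<times> 'f) tangent"
  assumes jacobi: "affine_jacobi_structure M A \<Lambda> E"
begin

abbreviation N :: "('x, 'e \<times> 'f) atlas" where "N \<equiv> total_atlas M A"

abbreviation J :: "('x \<Rightarrow> real) \<Rightarrow> ('x \<Rightarrow> real) \<Rightarrow> 'x \<Rightarrow> real" where "J \<equiv> jacobi_bracket N \<Lambda> E"

lemma N: "smooth_manifold N"
  using jacobi by (simp add: affine_jacobi_structure_def jacobi_structure_def)

lemma points_N: "x \<in> points N \<longleftrightarrow> x \<in> total_space A"
  by (simp add: points_total_atlas[OF preA])

lemma bivector: "is_bivector_field N \<Lambda>"
  using jacobi by (simp add: affine_jacobi_structure_def jacobi_structure_def)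

lemma J_affine: "a \<in> affine_functions M A \<Longrightarrow> b \<in> affine_functions M A \<Longrightarrow> J a b \<in> affine_functions M A"
  using jacobi by (simp add: affine_jacobi_structure_def)

lemma J_jacobi:
  assumes "f \<in> smooth_functions N" "g \<in> smooth_functions N" "h \<in> smooth_functions N" "x \<in> total_space A"
  shows "J f (J g h) x + J g (J h f) x + J h (J f g) x = 0"
  using jacobi assms points_N by (simp add: affine_jacobi_structure_def jacobi_structure_def Let_def)

lemma bivector_linear:
  assumes x: "x \<in> total_space A" and "\<omega> \<in> cotangent_space N x" "\<eta> \<in> cotangent_space N x" "\<theta> \<in> cotangent_space N x"
  shows "\<Lambda> x (\<lambda>v. r * \<omega> v + s * \<eta> v) \<theta> = r * \<Lambda> x \<omega> \<theta> + s * \<Lambda> x \<eta> \<theta>"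
    "\<Lambda> x \<theta> (\<lambda>v. r * \<omega> v + s * \<eta> v) = r * \<Lambda> x \<theta> \<omega> + s * \<Lambda> x \<theta> \<eta>"
    "\<Lambda> x \<omega> \<omega> = 0"
proof -
  have "\<forall>p\<in>points N. \<forall>\<omega>\<in>cotangent_space N p. \<forall>\<eta>\<in>cotangent_space N p.
        \<Lambda> p \<omega> \<omega> = 0 \<and>
        (\<forall>\<theta>\<in>cotangent_space N p. \<forall>r s.
           \<Lambda> p (\<lambda>v. r * \<omega> v + s * \<eta> v) \<theta> = r * \<Lambda> p \<omega> \<theta> + s * \<Lambda> p \<eta> \<theta> \<and>
           \<Lambda> p \<theta> (\<lambda>v. r * \<omega> v + s * \<eta> v) = r * \<Lambda> p \<theta> \<omega> + s * \<Lambda> p \<theta> \<eta>)"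
    using bivector unfolding is_bivector_field_def by (elim conjE)
  from this[rule_format, of x \<omega> \<eta>] assms points_N
  show "\<Lambda> x (\<lambda>v. r * \<omega> v + s * \<eta> v) \<theta> = r * \<Lambda> x \<omega> \<theta> + s * \<Lambda> x \<eta> \<theta>"
    "\<Lambda> x \<theta> (\<lambda>v. r * \<omega> v + s * \<eta> v) = r * \<Lambda> x \<theta> \<omega> + s * \<Lambda> x \<theta> \<eta>"
    "\<Lambda> x \<omega> \<omega> = 0" by blast+
qed

lemma bivector_zero:
  assumes "x \<in> total_space A" "\<omega> \<in> cotangent_space N x"
  shows "\<Lambda> x \<omega> (\<lambda>_. 0) = 0"
  using bivector_linear(2)[OF assms(1) zero_cotangent zero_cotangent assms(2), of 0 0] by simp

text \<open>Polarization: \<Lambda> vanishes on the diagonal at \<omega>, at \<eta> and at their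
  sum. That the sum is a covector appears as a hypothesis; \<open>J_antisym\<close> discharges it
  with the differential of a sum of functions.\<close>

lemma bivector_antisym:
  assumes x: "x \<in> total_space A" and w: "\<omega> \<in> cotangent_space N x" and e: "\<eta> \<in> cotangent_space N x"
    and we: "(\<lambda>v. 1 * \<omega> v + 1 * \<eta> v) \<in> cotangent_space N x"
  shows "\<Lambda> x \<omega> \<eta> = - \<Lambda> x \<eta> \<omega>"
  using bivector_linear(1)[OF x w e we, of 1 1] bivector_linear(2)[OF x w e w, of 1 1]
    bivector_linear(2)[OF x w e e, of 1 1] bivector_linear(3)[OF x w w w] bivector_linear(3)[OF x e e e]
    bivector_linear(3)[OF x we we we] by simp

lemma d_cotangent: "f \<in> smooth_functions N \<Longrightarrow> x \<in> total_space A \<Longrightarrow> differential N f x \<in> cotangent_space N x"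
  by (rule differential_cotangent[OF N]) (simp_all add: points_N)

section \<open>Algebra of the Jacobi bracket on the total space\<close>

lemma J_cong:
  assumes a: "a \<in> smooth_functions N" "\<And>x. x \<in> total_space A \<Longrightarrow> a x = a' x"
    and b: "b \<in> smooth_functions N" "\<And>x. x \<in> total_space A \<Longrightarrow> b x = b' x" and x: "x \<in> total_space A"
  shows "J a b x = J a' b' x"
proof -
  have "differential N a x = differential N a' x" "differential N b x = differential N b' x"
    using differential_cong[OF N a(1), of x a'] differential_cong[OF N b(1), of x b'] a b x by (auto simp: points_N)
  then show ?thesis using a b x by (simp add: jacobi_bracket_def vf_apply_def)
qed

lemma J_antisym:
  assumes a: "a \<in> smooth_functions N" and b: "b \<in> smooth_functions N" and x: "x \<in> total_space A"
  shows "J a b x = - J b a x"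
proof -
  have "differential N (\<lambda>x. a x + b x) x \<in> cotangent_space N x"
    by (rule d_cotangent[OF smooth_functions_add[OF preN a b] x])
  then have "\<Lambda> x (differential N a x) (differential N b x) = - \<Lambda> x (differential N b x) (differential N a x)"
    by (intro bivector_antisym x d_cotangent a b) (simp only: differential_add[OF N a b] x points_N)
  then show ?thesis by (simp add: jacobi_bracket_def)
qed

lemma J_add:
  assumes a: "a \<in> smooth_functions N" and b: "b \<in> smooth_functions N" and c: "c \<in> smooth_functions N"
    and x: "x \<in> total_space A"
  shows "J a (\<lambda>x. b x + c x) x = J a b x + J a c x"
proof -
  have "differential N (\<lambda>x. b x + c x) x = (\<lambda>v. 1 * differential N b x v + 1 * differential N c x v)"
    by (rule differential_add[OF N b c]) (simp add: points_N x)
  then show ?thesis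
    by (simp add: jacobi_bracket_def vf_apply_def algebra_simps
        bivector_linear(2)[OF x d_cotangent[OF b x] d_cotangent[OF c x] d_cotangent[OF a x], of 1 1, simplified])
qed

text \<open>On the affine function \<open>a\<close>, \<open>anchor_form a f\<close> is \<open>\<rho>\<^sup>+(a)(f) \<circ> \<pi>\<close>.\<close>

definition anchor_form :: "('x \<Rightarrow> real) \<Rightarrow> ('m \<Rightarrow> real) \<Rightarrow> 'x \<Rightarrow> real" where
  "anchor_form a f x = \<Lambda> x (differential N a x) (differential N (f \<circ> proj A) x)
     + a x * differential N (f \<circ> proj A) x (snd (E x))"

section \<open>The Leibniz rule and affine frames\<close>

lemma proj_smooth: "f \<in> smooth_functions M \<Longrightarrow> f \<circ> proj A \<in> smooth_functions N"
  by (rule smooth_functions_proj[OF preA])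

lemma differential_proj_mult:
  assumes f: "f \<in> smooth_functions M" and b: "b \<in> smooth_functions N" and x: "x \<in> total_space A"
  shows "differential N (\<lambda>x. f (proj A x) * b x) x =
     (\<lambda>v. f (proj A x) * differential N b x v + b x * differential N (f \<circ> proj A) x v)"
  using differential_mult[OF N proj_smooth[OF f] b, of x] x by (simp add: points_N)

text \<open>The bracket is a first-order operator in its second argument, not a derivation: the
  zeroth-order term \<open>- f b E(a)\<close> occurs only once and is absorbed by
  \<open>f {a, b}\<close>. The remainder is therefore \<open>anchor_form a f\<close> rather than the
  bracket of \<open>a\<close> with \<open>f \<circ> proj A\<close>.\<close>

lemma J_leibniz:
  assumes a: "a \<in> smooth_functions N" and f: "f \<in> smooth_functions M" and b: "b \<in> smooth_functions N" and x: "x \<in> total_space A"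
  shows "J a (\<lambda>x. f (proj A x) * b x) x = f (proj A x) * J a b x + b x * anchor_form a f x"
  unfolding jacobi_bracket_def vf_apply_def anchor_form_def differential_proj_mult[OF f b x]
    bivector_linear(2)[OF x d_cotangent[OF b x] d_cotangent[OF proj_smooth[OF f] x] d_cotangent[OF a x]]
  by (simp add: algebra_simps)

text \<open>The case \<open>b = 1\<close> of the Leibniz rule. It identifies the right-hand side of
  the defining equation of \<open>rho\<close> with \<open>anchor_form\<close>.\<close>

lemma anchor_form_eq:
  assumes a: "a \<in> smooth_functions N" and f: "f \<in> smooth_functions M" and x: "x \<in> total_space A"
  shows "J a (f \<circ> proj A) x - f (proj A x) * J a (\<lambda>_. 1) x = anchor_form a f x"
  using J_leibniz[OF a f smooth_functions_const[OF preN, of 1] x] by (simp add: o_def)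

lemma anchor_form_cong:
  assumes a: "a \<in> smooth_functions N" "\<And>x. x \<in> total_space A \<Longrightarrow> a x = b x" and x: "x \<in> total_space A"
  shows "anchor_form a f x = anchor_form b f x"
  unfolding anchor_form_def using differential_cong[OF N a(1), of x b] a x by (auto simp: points_N)

text \<open>The definition involves \<Lambda> and \<open>E\<close> separately, while the affineness
  hypothesis speaks only of brackets; \<open>anchor_form_eq\<close> supplies an expression in terms
  of brackets of affine functions.\<close>

lemma anchor_form_affine:
  assumes a: "a \<in> affine_functions M A" and f: "f \<in> smooth_functions M"
  shows "anchor_form a f \<in> affine_functions M A"
proof -
  have "(\<lambda>x. J a (f \<circ> proj A) x + (-1) * (f (proj A x) * J a (\<lambda>_. 1) x)) \<in> affine_functions M A"
    by (intro affine_functions_add affine_functions_scale affine_functions_proj_mult J_affine a f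
        affine_functions_const affine_functions_proj)
  then show ?thesis
    by (rule affine_functions_cong) (simp add: anchor_form_eq[OF affine_functionsD(1)[OF a] f, symmetric])
qed

text \<open>The local functions \<open>g \<bullet> \<Phi> x + k\<close> are made global by a cutoff
  pulled back from the base: being constant on each fibre, it preserves affineness. One
  neighbourhood \<open>V\<close> serves all \<open>g\<close> and \<open>k\<close>, so the family can
  be used as a local frame of \<open>Aplus M A\<close>.\<close>

lemma affine_frame:
  assumes t: "(W, \<Phi>) \<in> trivs A" and p: "p \<in> W"
  obtains V a where "atlas_open M V" "p \<in> V" "V \<subseteq> W" "\<And>g k. a g k \<in> affine_functions M A"
    "\<And>g k x. x \<in> total_space A \<Longrightarrow> proj A x \<in> V \<Longrightarrow> a g k x = g \<bullet> \<Phi> x + k"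
proof -
  note W = pre_bundleD(3)[OF preA t]
  obtain \<kappa> V K where k: "\<kappa> \<in> smooth_functions M" "atlas_open M V" "p \<in> V" "V \<subseteq> K" "K \<subseteq> W"
    "closedin (atlas_topology M) K" "\<And>q. q \<in> V \<Longrightarrow> \<kappa> q = 1" "\<And>q. q \<in> points M - K \<Longrightarrow> \<kappa> q = 0"
    by (rule manifold_bump_exists[OF M W p]) (rule that)
  let ?W = "{x \<in> total_space A. proj A x \<in> W}"
  let ?K = "{x \<in> total_space A. proj A x \<in> K}"
  define a where "a g k x = (if x \<in> ?W then (\<kappa> \<circ> proj A) x * (g \<bullet> \<Phi> x + k) else 0)" for g k x
  have Wo: "atlas_open N ?W" by (rule atlas_open_proj_vimage[OF preA W])
  have "atlas_open M (points M - K)"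
    using openin_diff[OF openin_topspace k(6)] openin_atlas_topology[OF preM] topspace_atlas_topology[OF preM] by auto
  from atlas_open_proj_vimage[OF preA this]
  have "openin (atlas_topology N) {x \<in> total_space A. proj A x \<in> points M - K}" by (simp add: openin_atlas_topology[OF preN])
  moreover have "{x \<in> total_space A. proj A x \<in> points M - K} = topspace (atlas_topology N) - ?K"
    using pre_bundleD(2)[OF preA] by (auto simp: topspace_atlas_topology[OF preN] points_N)
  moreover have "?K \<subseteq> topspace (atlas_topology N)"
    unfolding topspace_atlas_topology[OF preN] points_total_atlas[OF preA] by blast
  ultimately have Kc: "closedin (atlas_topology N) ?K"
    unfolding closedin_def by simp
  have near: "smooth_near N x (\<lambda>x. g \<bullet> \<Phi> x + k)" if x: "x \<in> ?W" for g k x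
  proof -
    obtain c where c: "c \<in> M" "proj A x \<in> fst c" using points_chart[OF triv_points[OF t]] x by blast
    define U \<phi> where "U = fst c" and "\<phi> = snd c"
    have U: "(U, \<phi>) \<in> M" "proj A x \<in> U" using c by (auto simp: U_def \<phi>_def)
    let ?V = "{x \<in> total_space A. proj A x \<in> U \<inter> W}" and ?\<psi> = "\<lambda>x. (\<phi> (proj A x), \<Phi> x)"
    note C = total_atlasI[OF U(1) t]
    have o: "open (?\<psi> ` ?V)" by (rule pre_atlasD(2)[OF preN C])
    have "smooth_on (?\<psi> ` ?V) (\<lambda>z. g \<bullet> snd z + k)"
      by (intro smooth_on_add smooth_on_inner smooth_on_const o smooth_on_bounded_linear bounded_linear_snd)
    then have "smooth_on (?\<psi> ` ?V) ((\<lambda>x. g \<bullet> \<Phi> x + k) \<circ> inv_into ?V ?\<psi>)"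
    proof (rule smooth_on_transform[OF _ o])
      fix z assume "z \<in> ?\<psi> ` ?V"
      then obtain y where y: "y \<in> ?V" "z = ?\<psi> y" by blast
      have "inv_into ?V ?\<psi> (?\<psi> y) = y" by (rule inv_into_f_f[OF pre_atlasD(1)[OF preN C] y(1)])
      then show "g \<bullet> snd z + k = ((\<lambda>x. g \<bullet> \<Phi> x + k) \<circ> inv_into ?V ?\<psi>) z" by (simp add: y(2))
    qed
    then show ?thesis unfolding smooth_near_def using C x U o
      by (intro exI[of _ ?V] exI[of _ ?\<psi>] exI[of _ "?\<psi> ` ?V"]) auto
  qed
  have sm: "a g k \<in> smooth_functions N" for g k
    unfolding a_def[abs_def]
  proof (rule smooth_cutoff[OF N proj_smooth[OF k(1)] Kc _ Wo _ near])
    show "(\<kappa> \<circ> proj A) q = 0" if "q \<in> points N - ?K" for q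
      using that k(8)[of "proj A q"] pre_bundleD(2)[OF preA] by (auto simp: points_N)
  qed (use k(5) in auto)
  have af: "affine_on_fibre A q (a g k)" if q: "q \<in> points M" for g k q
  proof (cases "q \<in> W")
    case True
    then show ?thesis unfolding affine_on_fibre_iff[OF t True]
      by (intro exI[of _ "\<kappa> q *\<^sub>R g"] exI[of _ "\<kappa> q * k"]) (auto simp: a_def fibre_def algebra_simps)
  next
    case False
    show ?thesis by (rule affine_on_fibre_cong[OF q affine_on_fibre_const[OF q, of 0]]) (use False in \<open>auto simp: a_def fibre_def\<close>)
  qed
  show ?thesis
  proof (rule that[of V a])
    show "a g k \<in> affine_functions M A" for g k using sm af by (simp add: affine_functions_def)
    show "a g k' x = g \<bullet> \<Phi> x + k'" if "x \<in> total_space A" "proj A x \<in> V" for g k' x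
      using that k(4,5,7) by (auto simp: a_def)
  qed (use k in auto)
qed

text \<open>A product of affine functions is affine only if one factor is constant; since
  \<open>b \<sqdot> anchor_form a f\<close> is affine for every affine \<open>b\<close>, the anchor form is basic.\<close>

lemma affine_multiplier_constant:
  assumes p: "p \<in> points M" and h: "affine_on_fibre A p h"
    and bh: "\<And>b. b \<in> affine_functions M A \<Longrightarrow> affine_on_fibre A p (\<lambda>x. b x * h x)"
    and x: "x \<in> fibre A p" and y: "y \<in> fibre A p"
  shows "h x = h y"
proof -
  obtain W \<Phi> where t: "(W, \<Phi>) \<in> trivs A" "p \<in> W" using pre_bundleD(5)[OF preA p] by blast
  obtain g k where g: "\<And>x. x \<in> fibre A p \<Longrightarrow> h x = g \<bullet> \<Phi> x + k" using h affine_on_fibre_iff[OF t] by blast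
  obtain V a where a: "atlas_open M V" "p \<in> V" "V \<subseteq> W" "\<And>g k. a g k \<in> affine_functions M A"
    "\<And>g k x. x \<in> total_space A \<Longrightarrow> proj A x \<in> V \<Longrightarrow> a g k x = g \<bullet> \<Phi> x + k" by (rule affine_frame[OF t]) (rule that)
  \<comment> \<open>The multiplier is given the same linear part \<open>g\<close> as
    \<open>h\<close>, so the quadratic part of the product is the square of the form
    \<open>g \<bullet> _\<close>.\<close>
  obtain g' k' where g': "\<And>x. x \<in> fibre A p \<Longrightarrow> a g 0 x * h x = g' \<bullet> \<Phi> x + k'"
    using bh[OF a(4)[of g 0]] unfolding affine_on_fibre_iff[OF t] by blast
  \<comment> \<open>Restriction to the points of coordinate \<open>r *\<^sub>R g\<close>. The values
    at r = 0, 1, -1 isolate the coefficient of r squared, which is the square of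
    \<open>g \<bullet> g\<close>.\<close>
  have "(r * (g \<bullet> g)) * (r * (g \<bullet> g) + k) = r * (g' \<bullet> g) + k'" for r
  proof -
    define x where "x = inv_into (fibre A p) \<Phi> (r *\<^sub>R g)"
    have "x \<in> fibre A p" "\<Phi> x = r *\<^sub>R g" using triv_inverse(1,2)[OF preA t, of "r *\<^sub>R g"] by (auto simp: x_def)
    then show ?thesis using g'[of x] g[of x] a(5)[of x g 0] a(2) by (simp add: fibre_def)
  qed
  from this[of 0] this[of 1] this[of "-1"] have "k' = 0"
    "(g \<bullet> g) * (g \<bullet> g) + (g \<bullet> g) * k = g' \<bullet> g + k'" "(g \<bullet> g) * (g \<bullet> g) - (g \<bullet> g) * k = - (g' \<bullet> g) + k'"
    by (simp_all add: algebra_simps)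
  then have "(g \<bullet> g) * (g \<bullet> g) = 0" by linarith
  then have "g = 0" by simp
  then show ?thesis using g x y by simp
qed

lemma anchor_form_fibre_constant:
  assumes a: "a \<in> affine_functions M A" and f: "f \<in> smooth_functions M" and p: "p \<in> points M"
    and x: "x \<in> fibre A p" and y: "y \<in> fibre A p"
  shows "anchor_form a f x = anchor_form a f y"
proof (rule affine_multiplier_constant[OF p affine_functionsD(2)[OF anchor_form_affine[OF a f] p] _ x y])
  fix b assume b: "b \<in> affine_functions M A"
  have "(\<lambda>x. J a (\<lambda>x. f (proj A x) * b x) x + (-1) * (f (proj A x) * J a b x)) \<in> affine_functions M A"
    by (intro affine_functions_add affine_functions_scale affine_functions_proj_mult J_affine a b f)
  then have "(\<lambda>x. b x * anchor_form a f x) \<in> affine_functions M A"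
    by (rule affine_functions_cong) (simp add: J_leibniz a b f affine_functionsD(1))
  then show "affine_on_fibre A p (\<lambda>x. b x * anchor_form a f x)" by (rule affine_functionsD(2)[OF _ p])
qed

lemma anchor_form_proj_mult:
  assumes g: "g \<in> smooth_functions M" and a: "a \<in> smooth_functions N" and f: "f \<in> smooth_functions M" and x: "x \<in> total_space A"
  shows "anchor_form (\<lambda>x. g (proj A x) * a x) f x = g (proj A x) * anchor_form a f x +
     a x * \<Lambda> x (differential N (g \<circ> proj A) x) (differential N (f \<circ> proj A) x)"
  unfolding anchor_form_def differential_proj_mult[OF g a x]
    bivector_linear(1)[OF x d_cotangent[OF a x] d_cotangent[OF proj_smooth[OF g] x] d_cotangent[OF proj_smooth[OF f] x]]
  by (simp add: algebra_simps)

text \<open>Here positive rank is essential: the summand \<open>a \<sqdot> \<Lambda>(dg, df)\<close> of \<open>anchor_form (g a) f\<close>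
  must be basic for affine functions \<open>a\<close> that are not constant on the fibre.\<close>

lemma bivector_basic_zero:
  assumes g: "g \<in> smooth_functions M" and f: "f \<in> smooth_functions M" and x: "x \<in> total_space A"
  shows "\<Lambda> x (differential N (g \<circ> proj A) x) (differential N (f \<circ> proj A) x) = 0"
proof -
  let ?L = "\<lambda>x. \<Lambda> x (differential N (g \<circ> proj A) x) (differential N (f \<circ> proj A) x)"
  define p where "p = proj A x"
  have p: "p \<in> points M" using pre_bundleD(2)[OF preA x] by (simp add: p_def)
  have xp: "x \<in> fibre A p" using x by (simp add: p_def fibre_def)
  \<comment> \<open>In \<open>anchor_form_proj_mult\<close> both anchor forms and the pulled-back
    factor \<open>g\<close> are constant on the fibre, hence so is the remaining term.\<close>
  have const: "a y * ?L y = a z * ?L z" if a: "a \<in> affine_functions M A" and y: "y \<in> fibre A p" and z: "z \<in> fibre A p" for a y z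
  proof -
    have tot: "y \<in> total_space A" "z \<in> total_space A" "proj A y = p" "proj A z = p" using y z by (auto simp: fibre_def)
    show ?thesis
      using anchor_form_fibre_constant[OF affine_functions_proj_mult[OF g a] f p y z]
        anchor_form_fibre_constant[OF a f p y z]
        anchor_form_proj_mult[OF g affine_functionsD(1)[OF a] f tot(1)]
        anchor_form_proj_mult[OF g affine_functionsD(1)[OF a] f tot(2)] tot by simp
  qed
  obtain W \<Phi> where t: "(W, \<Phi>) \<in> trivs A" "p \<in> W" using pre_bundleD(5)[OF preA p] by blast
  obtain V a where a: "atlas_open M V" "p \<in> V" "V \<subseteq> W" "\<And>g k. a g k \<in> affine_functions M A"
    "\<And>g k x. x \<in> total_space A \<Longrightarrow> proj A x \<in> V \<Longrightarrow> a g k x = g \<bullet> \<Phi> x + k" by (rule affine_frame[OF t]) (rule that)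
  obtain b :: 'f where b: "b \<in> Basis" using nonempty_Basis by blast
  \<comment> \<open>Moving by a basis vector \<open>b\<close> raises the affine function
    \<open>a b 0\<close> by exactly 1. Since \<open>?L\<close> takes the same value at
    \<open>x\<close> and \<open>y\<close>, and so does its product with \<open>a b 0\<close>, that
    value is 0.\<close>
  define y where "y = inv_into (fibre A p) \<Phi> (\<Phi> x + b)"
  have y: "y \<in> fibre A p" "\<Phi> y = \<Phi> x + b" using triv_inverse(1,2)[OF preA t, of "\<Phi> x + b"] by (auto simp: y_def)
  have "?L x = ?L y" using const[OF affine_functions_const[of 1] xp y(1)] by simp
  moreover have "a b 0 x * ?L x = a b 0 y * ?L y" by (rule const[OF a(4) xp y(1)])
  moreover have "a b 0 y = a b 0 x + 1"
    using a(5)[of x b 0] a(5)[of y b 0] xp y a(2) b by (simp add: fibre_def inner_add_right)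
  ultimately show ?thesis by (simp add: algebra_simps)
qed

section \<open>Linearity of the anchor form in both arguments\<close>

lemma anchor_form_const_zero:
  assumes a: "a \<in> smooth_functions N" and x: "x \<in> total_space A"
  shows "anchor_form a (\<lambda>_. r) x = 0"
  using differential_const[OF N, of x r] bivector_zero[OF x d_cotangent[OF a x]] x
  by (simp add: anchor_form_def o_def points_N)

lemma anchor_form_add:
  assumes a: "a \<in> smooth_functions N" and b: "b \<in> smooth_functions N" and f: "f \<in> smooth_functions M" and x: "x \<in> total_space A"
  shows "anchor_form (\<lambda>x. a x + b x) f x = anchor_form a f x + anchor_form b f x"
proof -
  have "differential N (\<lambda>x. a x + b x) x = (\<lambda>v. 1 * differential N a x v + 1 * differential N b x v)"
    by (rule differential_add[OF N a b]) (simp add: points_N x)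
  then show ?thesis unfolding anchor_form_def
    using bivector_linear(1)[OF x d_cotangent[OF a x] d_cotangent[OF b x] d_cotangent[OF proj_smooth[OF f] x], of 1 1]
    by (simp add: algebra_simps)
qed

lemma anchor_form_scale:
  assumes a: "a \<in> smooth_functions N" and f: "f \<in> smooth_functions M" and x: "x \<in> total_space A"
  shows "anchor_form (\<lambda>x. r * a x) f x = r * anchor_form a f x"
  using anchor_form_proj_mult[OF smooth_functions_const[OF preM] a f x, of r]
    bivector_basic_zero[OF smooth_functions_const[OF preM] f x, of r] by simp

lemma anchor_form_sum_left:
  assumes "finite I" "\<And>i. i \<in> I \<Longrightarrow> a i \<in> smooth_functions N" and f: "f \<in> smooth_functions M" and x: "x \<in> total_space A"
  shows "anchor_form (\<lambda>x. \<Sum>i\<in>I. a i x) f x = (\<Sum>i\<in>I. anchor_form (a i) f x)"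
  using assms(1,2)
proof (induction I rule: finite_induct)
  case empty
  show ?case using anchor_form_scale[OF smooth_functions_const[OF preN, of 0] f x, of 0] by simp
next
  case (insert i I)
  have "anchor_form (\<lambda>x. a i x + (\<Sum>i\<in>I. a i x)) f x = anchor_form (a i) f x + anchor_form (\<lambda>x. \<Sum>i\<in>I. a i x) f x"
    by (intro anchor_form_add f x smooth_functions_sum preN insert.hyps) (use insert.prems in auto)
  then show ?case using insert by simp
qed

lemma anchor_form_linear_right:
  assumes a: "a \<in> smooth_functions N" and f: "f \<in> smooth_functions M" and g: "g \<in> smooth_functions M" and x: "x \<in> total_space A"
  shows "anchor_form a (\<lambda>q. r * f q + g q) x = r * anchor_form a f x + anchor_form a g x"
proof -
  have rf: "(\<lambda>q. r * f q) \<in> smooth_functions M" by (intro smooth_functions_mult preM smooth_functions_const f)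
  have "differential N ((\<lambda>q. r * f q) \<circ> proj A) x = (\<lambda>v. r * differential N (f \<circ> proj A) x v)"
    using differential_proj_mult[OF smooth_functions_const[OF preM, of r] proj_smooth[OF f] x]
      differential_const[OF N, of x r] x by (simp add: points_N o_def)
  moreover have "differential N ((\<lambda>q. r * f q + g q) \<circ> proj A) x =
      (\<lambda>v. 1 * differential N ((\<lambda>q. r * f q) \<circ> proj A) x v + 1 * differential N (g \<circ> proj A) x v)"
    using differential_add[OF N proj_smooth[OF rf] proj_smooth[OF g], of x] x by (simp add: points_N o_def)
  ultimately have "differential N ((\<lambda>q. r * f q + g q) \<circ> proj A) x =
      (\<lambda>v. r * differential N (f \<circ> proj A) x v + 1 * differential N (g \<circ> proj A) x v)" by simp
  then show ?thesis unfolding anchor_form_def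
    by (simp only: bivector_linear(2)[OF x d_cotangent[OF proj_smooth[OF f] x] d_cotangent[OF proj_smooth[OF g] x] d_cotangent[OF a x]])
      (simp add: algebra_simps)
qed

lemma anchor_form_sum_right:
  assumes "finite I" "\<And>i. i \<in> I \<Longrightarrow> F i \<in> smooth_functions M" and a: "a \<in> smooth_functions N" and x: "x \<in> total_space A"
  shows "anchor_form a (\<lambda>q. \<Sum>i\<in>I. r i * F i q) x = (\<Sum>i\<in>I. r i * anchor_form a (F i) x)"
  using assms(1,2)
proof (induction I rule: finite_induct)
  case empty
  show ?case using anchor_form_const_zero[OF a x] by simp
next
  case (insert i I)
  have "anchor_form a (\<lambda>q. r i * F i q + (\<Sum>i\<in>I. r i * F i q)) x =
      r i * anchor_form a (F i) x + anchor_form a (\<lambda>q. \<Sum>i\<in>I. r i * F i q) x"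
    by (intro anchor_form_linear_right a x smooth_functions_sum smooth_functions_mult smooth_functions_const preM insert.hyps)
      (use insert.prems in auto)
  then show ?case using insert by simp
qed

section \<open>First-order dependence on \<open>f\<close> and pointwise dependence on
  \<open>a\<close>\<close>

lemma total_chart_derivative_proj:
  assumes f: "f \<in> smooth_functions M" and U: "(U, \<phi>) \<in> M" and t: "(W, \<Phi>) \<in> trivs A"
    and x: "x \<in> total_space A" "proj A x \<in> U" "proj A x \<in> W"
  shows "frechet_derivative ((f \<circ> proj A) \<circ> inv_into {x \<in> total_space A. proj A x \<in> U \<inter> W} (\<lambda>x. (\<phi> (proj A x), \<Phi> x)))
      (at (\<phi> (proj A x), \<Phi> x)) = (\<lambda>z. frechet_derivative (f \<circ> inv_into U \<phi>) (at (\<phi> (proj A x))) (fst z))"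
proof -
  let ?V = "{x \<in> total_space A. proj A x \<in> U \<inter> W}" and ?\<psi> = "\<lambda>x. (\<phi> (proj A x), \<Phi> x)"
  let ?D = "frechet_derivative (f \<circ> inv_into U \<phi>) (at (\<phi> (proj A x)))"
  note C = total_atlasI[OF U t]
  have "(f \<circ> inv_into U \<phi>) differentiable (at (\<phi> (proj A x)))"
    using smooth_functions_chart_differentiable[OF M f U] x by simp
  then have "((f \<circ> inv_into U \<phi>) has_derivative ?D) (at (fst (?\<psi> x)))" by (simp add: frechet_derivative_works)
  then have "((\<lambda>z. (f \<circ> inv_into U \<phi>) (fst z)) has_derivative (\<lambda>z. ?D (fst z))) (at (?\<psi> x))"
    by (rule has_derivative_compose[OF has_derivative_fst[OF has_derivative_ident]])
  then have "(((f \<circ> proj A) \<circ> inv_into ?V ?\<psi>) has_derivative (\<lambda>z. ?D (fst z))) (at (?\<psi> x))"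
  proof (rule has_derivative_transform_within_open[OF _ pre_atlasD(2)[OF preN C]])
    show "?\<psi> x \<in> ?\<psi> ` ?V" using x by blast
    fix z assume "z \<in> ?\<psi> ` ?V"
    then obtain y where y: "y \<in> ?V" "z = ?\<psi> y" by blast
    have "inv_into ?V ?\<psi> (?\<psi> y) = y" by (rule inv_into_f_f[OF pre_atlasD(1)[OF preN C] y(1)])
    then show "(f \<circ> inv_into U \<phi>) (fst z) = ((f \<circ> proj A) \<circ> inv_into ?V ?\<psi>) z"
      using y pre_atlasD(1)[OF preM U] by simp
  qed
  then show ?thesis by (rule frechet_derivative_at[symmetric])
qed

text \<open>In a bundle chart the first derivative of \<open>f\<close> at \<open>p\<close>
  determines the differential of \<open>f \<circ> proj A\<close> at every point over
  \<open>p\<close>, and \<open>anchor_form\<close> sees \<open>f\<close> only through that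
  differential.\<close>

lemma anchor_form_chart_cong:
  assumes f: "f \<in> smooth_functions M" and g: "g \<in> smooth_functions M" and c: "c \<in> M" "p \<in> fst c" and x: "x \<in> fibre A p"
    and eq: "frechet_derivative (f \<circ> chart_inv c) (at (snd c p)) = frechet_derivative (g \<circ> chart_inv c) (at (snd c p))"
  shows "anchor_form a f x = anchor_form a g x"
proof -
  have U: "(fst c, snd c) \<in> M" using c by simp
  have x': "x \<in> total_space A" "proj A x = p" using x by (auto simp: fibre_def)
  have p: "p \<in> points M" using pre_bundleD(2)[OF preA x'(1)] x' by simp
  obtain W \<Phi> where t: "(W, \<Phi>) \<in> trivs A" "p \<in> W" using pre_bundleD(5)[OF preA p] by blast
  have "differential N (f \<circ> proj A) x = differential N (g \<circ> proj A) x"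
    by (rule differential_eqI_chart[OF N proj_smooth[OF f] proj_smooth[OF g] total_atlasI[OF U t(1)]])
      (use x' c t eq total_chart_derivative_proj[OF f U t(1)] total_chart_derivative_proj[OF g U t(1)] in auto)
  then show ?thesis by (simp add: anchor_form_def)
qed

text \<open>In a bundle chart the derivative of \<open>k\<close> kills all directions along the
  fibre, so it is determined by a linear form on the model space of the base. The cut-off linear
  coordinate given by that form has the same differential after pulling back.\<close>

lemma differential_vanishing_on_fibre:
  assumes k: "k \<in> smooth_functions N" and z: "\<And>y. y \<in> fibre A p \<Longrightarrow> k y = 0" and x: "x \<in> fibre A p"
  shows "\<exists>g\<in>smooth_functions M. differential N k x = differential N (g \<circ> proj A) x"
proof -
  have x': "x \<in> total_space A" "proj A x = p" using x by (auto simp: fibre_def)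
  have p: "p \<in> points M" using pre_bundleD(2)[OF preA x'(1)] x' by simp
  obtain W \<Phi> where t: "(W, \<Phi>) \<in> trivs A" "p \<in> W" using pre_bundleD(5)[OF preA p] by blast
  obtain c where c: "c \<in> M" "p \<in> fst c" by (rule points_chart[OF p])
  obtain U \<phi> where cU: "c = (U, \<phi>)" by (cases c)
  have U: "(U, \<phi>) \<in> M" "p \<in> U" using c cU by auto
  let ?V = "{x \<in> total_space A. proj A x \<in> U \<inter> W}" and ?\<psi> = "\<lambda>x. (\<phi> (proj A x), \<Phi> x)"
  note C = total_atlasI[OF U(1) t(1)]
  have xV: "x \<in> ?V" using x' U t by simp
  let ?k = "k \<circ> inv_into ?V ?\<psi>"
  define D where "D = frechet_derivative ?k (at (?\<psi> x))"
  have "?k differentiable (at (?\<psi> x))"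
    using smooth_functions_chart_differentiable[OF N k C] xV by simp
  then have D: "(?k has_derivative D) (at (?\<psi> x))" by (simp add: D_def frechet_derivative_works)
  have lin: "linear D" by (rule has_derivative_linear[OF D])
  have vert: "D (0, w) = 0" for w
  proof -
    \<comment> \<open>A straight line through \<open>x\<close> inside the fibre: the base coordinate
      stays at \<open>\<phi> p\<close>, so \<open>?k\<close> vanishes along it.\<close>
    define \<gamma> where "\<gamma> s = (\<phi> p, \<Phi> x + s *\<^sub>R w)" for s :: real
    have "(\<gamma> has_derivative (\<lambda>s. (0, s *\<^sub>R w))) (at 0)"
      unfolding \<gamma>_def by (auto intro!: derivative_eq_intros)
    moreover have "(?k has_derivative D) (at (\<gamma> 0))" using D by (simp add: \<gamma>_def x')
    ultimately have "((\<lambda>s. ?k (\<gamma> s)) has_derivative (\<lambda>s. D (0, s *\<^sub>R w))) (at 0)"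
      by (rule has_derivative_compose)
    moreover have "?k (\<gamma> s) = 0" for s
      using total_chart_inv[OF preA t(1) U(1) U(2) t(2)] z[OF triv_inverse(1)[OF preA t]] by (simp add: \<gamma>_def)
    ultimately have "((\<lambda>s. 0) has_derivative (\<lambda>s. D (0, s *\<^sub>R w))) (at (0::real))" by simp
    then have "(\<lambda>s. D (0, s *\<^sub>R w)) = (\<lambda>_::real. 0)" by (rule has_derivative_unique) simp
    from fun_cong[OF this, of 1] show ?thesis by simp
  qed
  obtain B :: "'e set" where B: "orthonormal_basis B" by (rule finite_dimensional_orthonormal_basis[OF fd_e])
  \<comment> \<open>The vector representing the functional \<open>\<lambda>u. D (u, 0)\<close>,
    written in the orthonormal basis \<open>B\<close>.\<close>
  define b where "b = (\<Sum>b\<in>B. D (b, 0) *\<^sub>R b)"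
  have "linear (\<lambda>u. D (u, 0))"
  proof (rule linearI)
    show "D (u + u', 0) = D (u, 0) + D (u', 0)" for u u' using linear_add[OF lin, of "(u, 0)" "(u', 0)"] by simp
    show "D (r *\<^sub>R u, 0) = r *\<^sub>R D (u, 0)" for r u using linear_cmul[OF lin, of r "(u, 0)"] by simp
  qed
  have b: "D (u, 0) = b \<bullet> u" for u
  proof -
    have "D (u, 0) = (\<Sum>b\<in>B. (u \<bullet> b) *\<^sub>R D (b, 0))"
      by (rule orthonormal_basis_linear[OF B \<open>linear (\<lambda>u. D (u, 0))\<close>])
    also have "\<dots> = b \<bullet> u" by (simp add: b_def inner_sum_left inner_commute[of u] mult.commute)
    finally show ?thesis .
  qed
  obtain V F where F: "atlas_open M V" "p \<in> V" "V \<subseteq> fst c" "\<And>b. F b \<in> smooth_functions M"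
    "\<And>b q. q \<in> V \<Longrightarrow> F b q = b \<bullet> snd c q" by (rule chart_coordinate_functions[OF M c]) (rule that)
  have Fd: "frechet_derivative (F b \<circ> inv_into U \<phi>) (at (\<phi> (proj A x))) u = b \<bullet> u" for u
    using coordinate_function_derivative_same[OF M c F(1-3) F(5)] by (simp add: cU x')
  have "frechet_derivative ((F b \<circ> proj A) \<circ> inv_into ?V ?\<psi>) (at (?\<psi> x)) z = D z" for z
  proof -
    have "D z = D (fst z, 0) + D (0, snd z)" by (simp flip: linear_add[OF lin])
    then show ?thesis using total_chart_derivative_proj[OF F(4) U(1) t(1), of x b] x' U t by (simp add: Fd[unfolded x'(2)] vert b)
  qed
  then have "differential N k x = differential N (F b \<circ> proj A) x"
    by (intro differential_eqI_chart[OF N k proj_smooth[OF F(4)] C]) (use xV in \<open>auto simp: D_def\<close>)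
  then show ?thesis using F(4) by blast
qed

text \<open>For the difference of the two functions, the differential at \<open>x\<close> is that of
  a basic function, so the bivector term vanishes; the term with \<open>E\<close> carries the value
  of the difference at \<open>x\<close>, which is 0.\<close>

lemma anchor_form_fibre_cong:
  assumes a: "a \<in> smooth_functions N" and b: "b \<in> smooth_functions N" and f: "f \<in> smooth_functions M"
    and ab: "\<And>y. y \<in> fibre A p \<Longrightarrow> a y = b y" and x: "x \<in> fibre A p"
  shows "anchor_form a f x = anchor_form b f x"
proof -
  have x': "x \<in> total_space A" using x by (auto simp: fibre_def)
  let ?k = "\<lambda>y. a y - b y"
  have k: "?k \<in> smooth_functions N" by (rule smooth_functions_diff[OF preN a b])
  obtain g where g: "g \<in> smooth_functions M" "differential N ?k x = differential N (g \<circ> proj A) x"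
    using differential_vanishing_on_fibre[OF k _ x] ab by auto
  have "anchor_form ?k f x = 0"
    unfolding anchor_form_def g(2) bivector_basic_zero[OF g(1) f x'] using ab[OF x] by simp
  then show ?thesis using anchor_form_add[OF k b f x'] by simp
qed

text \<open>Only the first derivative of \<open>f\<close> at \<open>p\<close> matters, so
  \<open>f\<close> may be replaced by a combination of cut-off coordinates with the same derivative.
  Linearity then gives this derivative applied to the vector \<open>w\<close> formed from the values
  on the coordinates. One point \<open>x\<close> of the fibre suffices because the anchor form is
  constant there.\<close>

lemma anchor_form_tangent_vector:
  assumes a: "a \<in> affine_functions M A" and p: "p \<in> points M"
  shows "\<exists>v\<in>tangent_space M p. \<forall>f\<in>smooth_functions M. \<forall>x\<in>fibre A p. anchor_form a f x = differential M f p v"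
proof -
  obtain x where x: "x \<in> fibre A p" using fibre_nonempty[OF preA p] by blast
  have x': "x \<in> total_space A" using x by (auto simp: fibre_def)
  note as = affine_functionsD(1)[OF a]
  obtain B :: "'e set" where B: "orthonormal_basis B" by (rule finite_dimensional_orthonormal_basis[OF fd_e])
  have "\<exists>v\<in>tangent_space M p. \<forall>f\<in>smooth_functions M. anchor_form a f x = differential M f p v"
  proof (rule tangent_vector_of_functional[OF M p])
    fix c assume c: "c \<in> M" "p \<in> fst c"
    obtain V F where F: "atlas_open M V" "p \<in> V" "V \<subseteq> fst c" "\<And>b. F b \<in> smooth_functions M"
      "\<And>b q. q \<in> V \<Longrightarrow> F b q = b \<bullet> snd c q" by (rule chart_coordinate_functions[OF M c]) (rule that)
    define w where "w = (\<Sum>b\<in>B. anchor_form a (F b) x *\<^sub>R b)"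
    have "anchor_form a f x = frechet_derivative (f \<circ> chart_inv c) (at (snd c p)) w" if f: "f \<in> smooth_functions M" for f
    proof -
      define D where "D = frechet_derivative (f \<circ> chart_inv c) (at (snd c p))"
      have lin: "linear D" unfolding D_def
        by (rule chart_derivative_linear[OF smooth_functions_chart_differentiable[OF M f c]])
      \<comment> \<open>The linear part of \<open>f\<close> at \<open>p\<close> in the chart
        \<open>c\<close>, made global through the functions \<open>F b\<close>.\<close>
      define g where "g q = (\<Sum>b\<in>B. D b * F b q)" for q
      have g: "g \<in> smooth_functions M" unfolding g_def
        by (intro smooth_functions_sum smooth_functions_mult smooth_functions_const preM orthonormal_basisD(1)[OF B] F(4))
      have "((F b \<circ> chart_inv c) has_derivative (\<lambda>u. b \<bullet> u)) (at (snd c p))" for b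
      proof -
        have "frechet_derivative (F b \<circ> chart_inv c) (at (snd c p)) = (\<lambda>u. b \<bullet> u)"
          using coordinate_function_derivative_same[OF M c F(1-3) F(5)] by blast
        then show ?thesis
          using smooth_functions_chart_differentiable[OF M F(4) c, of b] by (simp add: frechet_derivative_works)
      qed
      then have "((\<lambda>y. \<Sum>b\<in>B. D b * (F b \<circ> chart_inv c) y) has_derivative (\<lambda>u. \<Sum>b\<in>B. D b * (b \<bullet> u))) (at (snd c p))"
        by (intro has_derivative_sum has_derivative_mult_right)
      moreover have "(\<Sum>b\<in>B. D b * (b \<bullet> u)) = D u" for u
        using orthonormal_basis_linear[OF B lin, of u] by (simp add: inner_commute mult.commute)
      ultimately have "((g \<circ> chart_inv c) has_derivative D) (at (snd c p))" by (simp add: g_def o_def)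
      then have "frechet_derivative (g \<circ> chart_inv c) (at (snd c p)) = D" by (rule frechet_derivative_at[symmetric])
      then have "anchor_form a f x = anchor_form a g x"
        by (intro anchor_form_chart_cong[OF f g c x]) (simp add: D_def)
      also have "\<dots> = (\<Sum>b\<in>B. D b * anchor_form a (F b) x)"
        unfolding g_def by (rule anchor_form_sum_right[OF orthonormal_basisD(1)[OF B] F(4) as x'])
      also have "\<dots> = D w" by (simp add: w_def linear_sum[OF lin] linear_cmul[OF lin] mult.commute)
      finally show ?thesis by (simp add: D_def)
    qed
    then show "\<exists>w. \<forall>f\<in>smooth_functions M. anchor_form a f x = frechet_derivative (f \<circ> chart_inv c) (at (snd c p)) w" by blast
  qed
  then show ?thesis using anchor_form_fibre_constant[OF a _ p _ x] by metis
qed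

definition anchor_field :: "('x \<Rightarrow> real) \<Rightarrow> 'm \<Rightarrow> 'm \<times> ('m, 'e) tangent" where
  "anchor_field a = (\<lambda>p\<in>points M. (p, SOME v. v \<in> tangent_space M p \<and>
     (\<forall>f\<in>smooth_functions M. \<forall>x\<in>fibre A p. anchor_form a f x = differential M f p v)))"

text \<open>By \<open>vector_fieldsI\<close> it suffices that the action on each global
  \<open>f\<close> is smooth, and this action is the function on \<open>M\<close> to which
  \<open>anchor_form a f\<close> descends.\<close>

lemma anchor_field:
  assumes a: "a \<in> affine_functions M A"
  shows "anchor_field a \<in> vector_fields M"
    and "\<And>f x. f \<in> smooth_functions M \<Longrightarrow> x \<in> total_space A \<Longrightarrow> vf_apply M (anchor_field a) f (proj A x) = anchor_form a f x"
proof -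
  have v: "fst (anchor_field a p) = p" "snd (anchor_field a p) \<in> tangent_space M p"
    "\<And>f x. f \<in> smooth_functions M \<Longrightarrow> x \<in> fibre A p \<Longrightarrow> anchor_form a f x = differential M f p (snd (anchor_field a p))"
    if p: "p \<in> points M" for p
  proof -
    let ?P = "\<lambda>v. v \<in> tangent_space M p \<and> (\<forall>f\<in>smooth_functions M. \<forall>x\<in>fibre A p. anchor_form a f x = differential M f p v)"
    define v0 where "v0 = (SOME v. ?P v)"
    have "?P v0" unfolding v0_def by (rule someI_ex[of ?P]) (use anchor_form_tangent_vector[OF a p] in blast)
    moreover have "anchor_field a p = (p, v0)" using p by (simp add: anchor_field_def v0_def)
    ultimately show "fst (anchor_field a p) = p" "snd (anchor_field a p) \<in> tangent_space M p"
      "\<And>f x. f \<in> smooth_functions M \<Longrightarrow> x \<in> fibre A p \<Longrightarrow> anchor_form a f x = differential M f p (snd (anchor_field a p))"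
      by simp_all
  qed
  show ap: "vf_apply M (anchor_field a) f (proj A x) = anchor_form a f x" if "f \<in> smooth_functions M" "x \<in> total_space A" for f x
    using v(3)[OF pre_bundleD(2)[OF preA that(2)] that(1), of x] that(2) by (simp add: vf_apply_def fibre_def)
  show "anchor_field a \<in> vector_fields M"
  proof (rule vector_fieldsI[OF M])
    show "anchor_field a \<in> extensional (points M)" by (simp add: anchor_field_def)
    fix f assume f: "f \<in> smooth_functions M"
    have "\<exists>h\<in>smooth_functions M. \<forall>x\<in>total_space A. anchor_form a f x = h (proj A x)"
      by (rule smooth_functions_descend[OF preA affine_functionsD(1)[OF anchor_form_affine[OF a f]]])
        (rule anchor_form_fibre_constant[OF a f])
    then obtain h where h: "h \<in> smooth_functions M" "\<And>x. x \<in> total_space A \<Longrightarrow> anchor_form a f x = h (proj A x)"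
      by blast
    show "vf_apply M (anchor_field a) f \<in> smooth_functions M"
    proof (rule smooth_functions_cong[OF preM h(1)])
      fix p assume p: "p \<in> points M"
      obtain x where "x \<in> fibre A p" using fibre_nonempty[OF preA p] by blast
      then show "h p = vf_apply M (anchor_field a) f p" using h(2)[of x] ap[OF f, of x] by (simp add: fibre_def)
    qed
  qed (use v in auto)
qed

end

subsection \<open>The Lie algebroid structure\<close>

context affine_jacobi_over
begin

lemma sectionE:
  assumes "s \<in> sections M (Aplus M A)"
  obtains a where "a \<in> affine_functions M A" "s = tilde M A a"
  using tilde_untilde[OF assms] untilde_affine[OF assms] by metis

lemma plus_operations_iff:
  "plus_operations M A \<Lambda> E br rho \<longleftrightarrow>
     br \<in> sections M (Aplus M A) \<rightarrow>\<^sub>E sections M (Aplus M A) \<rightarrow>\<^sub>E sections M (Aplus M A) \<and>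
     rho \<in> sections M (Aplus M A) \<rightarrow>\<^sub>E vector_fields M \<and>
     (\<forall>a\<in>affine_functions M A. \<forall>b\<in>affine_functions M A.
         br (tilde M A a) (tilde M A b) = tilde M A (J a b)) \<and>
     (\<forall>a\<in>affine_functions M A. \<forall>f\<in>smooth_functions M. \<forall>x\<in>total_space A.
         vf_apply M (rho (tilde M A a)) f (proj A x) = anchor_form a f x)"
  unfolding plus_operations_def Let_def using anchor_form_eq affine_functionsD(1) by simp

lemma plus_operationsD:
  assumes "plus_operations M A \<Lambda> E br rho"
  shows "br \<in> sections M (Aplus M A) \<rightarrow>\<^sub>E sections M (Aplus M A) \<rightarrow>\<^sub>E sections M (Aplus M A)"
    and "rho \<in> sections M (Aplus M A) \<rightarrow>\<^sub>E vector_fields M"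
    and "a \<in> affine_functions M A \<Longrightarrow> b \<in> affine_functions M A \<Longrightarrow> br (tilde M A a) (tilde M A b) = tilde M A (J a b)"
    and "a \<in> affine_functions M A \<Longrightarrow> f \<in> smooth_functions M \<Longrightarrow> x \<in> total_space A \<Longrightarrow>
         vf_apply M (rho (tilde M A a)) f (proj A x) = anchor_form a f x"
proof -
  note * = assms[unfolded plus_operations_iff]
  show "br \<in> sections M (Aplus M A) \<rightarrow>\<^sub>E sections M (Aplus M A) \<rightarrow>\<^sub>E sections M (Aplus M A)"
    by (rule *[THEN conjunct1])
  show "rho \<in> sections M (Aplus M A) \<rightarrow>\<^sub>E vector_fields M" by (rule *[THEN conjunct2, THEN conjunct1])
  show "br (tilde M A a) (tilde M A b) = tilde M A (J a b)"
    if "a \<in> affine_functions M A" "b \<in> affine_functions M A"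
    using *[THEN conjunct2, THEN conjunct2, THEN conjunct1] that by blast
  show "vf_apply M (rho (tilde M A a)) f (proj A x) = anchor_form a f x"
    if "a \<in> affine_functions M A" "f \<in> smooth_functions M" "x \<in> total_space A"
    using *[THEN conjunct2, THEN conjunct2, THEN conjunct2] that by blast
qed

section \<open>Existence and uniqueness of the operations on sections\<close>

lemma plus_operations_exists: "\<exists>br rho. plus_operations M A \<Lambda> E br rho"
proof -
  let ?G = "sections M (Aplus M A)"
  define br where "br = (\<lambda>s\<in>?G. \<lambda>t\<in>?G. tilde M A (J (untilde s) (untilde t)))"
  define rho where "rho = (\<lambda>s\<in>?G. anchor_field (untilde s))"
  have "br \<in> ?G \<rightarrow>\<^sub>E ?G \<rightarrow>\<^sub>E ?G"
    unfolding br_def by (intro restrict_PiE_iff[THEN iffD2] ballI) (simp add: restrict_PiE_iff tilde_in_sections J_affine untilde_affine)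
  moreover have "rho \<in> ?G \<rightarrow>\<^sub>E vector_fields M"
    unfolding rho_def by (simp add: restrict_PiE_iff anchor_field(1) untilde_affine)
  moreover have "br (tilde M A a) (tilde M A b) = tilde M A (J a b)"
    if a: "a \<in> affine_functions M A" and b: "b \<in> affine_functions M A" for a b
  proof -
    note ta = tilde_in_sections[OF a] and tb = tilde_in_sections[OF b]
    have "br (tilde M A a) (tilde M A b) = tilde M A (J (untilde (tilde M A a)) (untilde (tilde M A b)))"
      using ta tb by (simp add: br_def)
    \<comment> \<open>\<open>untilde (tilde M A a)\<close> agrees with \<open>a\<close> on the total
      space only, so congruence of the bracket is required instead of equality of functions.\<close>
    also have "\<dots> = tilde M A (J a b)"
      by (intro tilde_cong J_cong affine_functionsD(1) untilde_affine ta tb untilde_tilde)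
    finally show ?thesis .
  qed
  moreover have "vf_apply M (rho (tilde M A a)) f (proj A x) = anchor_form a f x"
    if a: "a \<in> affine_functions M A" and f: "f \<in> smooth_functions M" and x: "x \<in> total_space A" for a f x
  proof -
    note ta = tilde_in_sections[OF a]
    have "vf_apply M (rho (tilde M A a)) f (proj A x) = anchor_form (untilde (tilde M A a)) f x"
      using ta by (simp add: rho_def anchor_field(2)[OF untilde_affine f x])
    also have "\<dots> = anchor_form a f x"
      by (intro anchor_form_cong affine_functionsD(1) untilde_affine ta untilde_tilde x)
    finally show ?thesis .
  qed
  ultimately show ?thesis unfolding plus_operations_iff by blast
qed

text \<open>Every section has the form \<open>tilde M A a\<close>, so the equations fix both maps on
  sections; elsewhere the extensional function spaces prescribe \<open>undefined\<close>. For
  \<open>rho\<close> it matters that a vector field is determined by its action on global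
  functions.\<close>

lemma plus_operations_unique:
  assumes 1: "plus_operations M A \<Lambda> E br rho" and 2: "plus_operations M A \<Lambda> E br' rho'"
  shows "br = br'" "rho = rho'"
proof -
  let ?G = "sections M (Aplus M A)"
  note br = plus_operationsD(1)[OF 1] plus_operationsD(1)[OF 2]
  note rho = plus_operationsD(2)[OF 1] plus_operationsD(2)[OF 2]
  show "br = br'"
  proof (rule PiE_ext[OF br])
    fix s assume s: "s \<in> ?G"
    show "br s = br' s"
    proof (rule PiE_ext[OF PiE_mem[OF br(1) s] PiE_mem[OF br(2) s]])
      fix t assume t: "t \<in> ?G"
      obtain a where a: "a \<in> affine_functions M A" "s = tilde M A a" by (rule sectionE[OF s])
      obtain b where b: "b \<in> affine_functions M A" "t = tilde M A b" by (rule sectionE[OF t])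
      show "br s t = br' s t" 
        unfolding a(2) b(2) plus_operationsD(3)[OF 1 a(1) b(1)] plus_operationsD(3)[OF 2 a(1) b(1)] ..
    qed
  qed
  show "rho = rho'"
  proof (rule PiE_ext[OF rho])
    fix s assume s: "s \<in> ?G"
    show "rho s = rho' s"
    proof (rule vector_field_eqI[OF M PiE_mem[OF rho(1) s] PiE_mem[OF rho(2) s]])
      fix f p assume f: "f \<in> smooth_functions M" and p: "p \<in> points M"
      obtain a where a: "a \<in> affine_functions M A" "s = tilde M A a" by (rule sectionE[OF s])
      obtain x where "x \<in> fibre A p" using fibre_nonempty[OF preA p] by blast
      then have x: "x \<in> total_space A" "proj A x = p" by (auto simp: fibre_def)
      show "vf_apply M (rho s) f p = vf_apply M (rho' s) f p"
        unfolding a(2) x(2)[symmetric] plus_operationsD(4)[OF 1 a(1) f x(1)] plus_operationsD(4)[OF 2 a(1) f x(1)] ..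
    qed
  qed
qed

context
  fixes br rho
  assumes plus: "plus_operations M A \<Lambda> E br rho"
begin

lemma br_tilde: "a \<in> affine_functions M A \<Longrightarrow> b \<in> affine_functions M A \<Longrightarrow>
    br (tilde M A a) (tilde M A b) = tilde M A (J a b)"
  by (rule plus_operationsD(3)[OF plus])

lemma rho_tilde:
  assumes a: "a \<in> affine_functions M A" and p: "p \<in> points M"
  shows "fst (rho (tilde M A a) p) = p" "snd (rho (tilde M A a) p) \<in> tangent_space M p"
    "\<And>f x. f \<in> smooth_functions M \<Longrightarrow> x \<in> fibre A p \<Longrightarrow>
       differential M f p (snd (rho (tilde M A a) p)) = anchor_form a f x"
proof -
  have "rho (tilde M A a) \<in> vector_fields M"
    by (rule PiE_mem[OF plus_operationsD(2)[OF plus] tilde_in_sections[OF a]])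
  then have "rho (tilde M A a) p \<in> {p} \<times> tangent_space M p"
    using p unfolding sections_iff[OF pre_bundle_tangent_bundle[OF M]] fibre_tangent_bundle[OF p, symmetric] by blast
  then show "fst (rho (tilde M A a) p) = p" "snd (rho (tilde M A a) p) \<in> tangent_space M p" by auto
  fix f x assume f: "f \<in> smooth_functions M" and x: "x \<in> fibre A p"
  then have "x \<in> total_space A" "proj A x = p" by (auto simp: fibre_def)
  then show "differential M f p (snd (rho (tilde M A a) p)) = anchor_form a f x"
    using plus_operationsD(4)[OF plus a f, of x] by (simp add: vf_apply_def)
qed

section \<open>The anchor as a bundle map\<close>

lemma rho_tilde_eqI:
  assumes a: "a \<in> affine_functions M A" and p: "p \<in> points M" and v: "v \<in> tangent_space M p"
    and eq: "\<And>f x. f \<in> smooth_functions M \<Longrightarrow> x \<in> fibre A p \<Longrightarrow> differential M f p v = anchor_form a f x"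
  shows "rho (tilde M A a) p = (p, v)"
proof -
  obtain x where x: "x \<in> fibre A p" using fibre_nonempty[OF preA p] by blast
  have "snd (rho (tilde M A a) p) = v"
    by (rule tangent_vector_eqI[OF M p rho_tilde(2)[OF a p] v]) (simp add: rho_tilde(3)[OF a p _ x] eq[OF _ x])
  then show ?thesis using rho_tilde(1)[OF a p] by (simp add: prod_eq_iff)
qed

text \<open>Passage from sections to vectors: some global affine function extending the given
  fibrewise one is chosen, \<open>rho\<close> is applied to its section, and the result is evaluated
  at the base point. \<open>anchor_eq\<close> removes the choice.\<close>

definition anchor :: "'m \<times> ('x \<Rightarrow> real) \<Rightarrow> 'm \<times> ('m, 'e) tangent" where
  "anchor z = rho (tilde M A (SOME a. a \<in> affine_functions M A \<and> (\<forall>x\<in>fibre A (fst z). a x = snd z x))) (fst z)"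

text \<open>Two affine functions that agree on one fibre have equal anchor forms along it, and a
  tangent vector at \<open>p\<close> is determined by these values; so any extension may replace the
  chosen one.\<close>

lemma anchor_eq:
  assumes a: "a \<in> affine_functions M A" and p: "p \<in> points M" and \<alpha>: "\<And>x. x \<in> fibre A p \<Longrightarrow> a x = \<alpha> x"
  shows "anchor (p, \<alpha>) = rho (tilde M A a) p"
proof -
  let ?P = "\<lambda>a. a \<in> affine_functions M A \<and> (\<forall>x\<in>fibre A p. a x = \<alpha> x)"
  define b where "b = (SOME a. ?P a)"
  have "?P b" unfolding b_def by (rule someI[of ?P a]) (use a \<alpha> in blast)
  then have b: "b \<in> affine_functions M A" "\<And>x. x \<in> fibre A p \<Longrightarrow> b x = a x" using \<alpha> by auto
  have "rho (tilde M A a) p = (p, snd (rho (tilde M A b) p))"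
  proof (rule rho_tilde_eqI[OF a p rho_tilde(2)[OF b(1) p]])
    fix f x assume f: "f \<in> smooth_functions M" and x: "x \<in> fibre A p"
    show "differential M f p (snd (rho (tilde M A b) p)) = anchor_form a f x"
      using rho_tilde(3)[OF b(1) p f x]
        anchor_form_fibre_cong[OF affine_functionsD(1)[OF b(1)] affine_functionsD(1)[OF a] f b(2) x] by simp
  qed
  also have "\<dots> = rho (tilde M A b) p" using rho_tilde(1)[OF b(1) p] by (simp add: prod_eq_iff)
  finally show ?thesis by (simp add: anchor_def b_def)
qed

lemma affine_extension:
  assumes p: "p \<in> points M" and \<alpha>: "affine_on_fibre A p \<alpha>"
  obtains a where "a \<in> affine_functions M A" "\<And>x. x \<in> fibre A p \<Longrightarrow> a x = \<alpha> x"
proof -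
  obtain W \<Phi> where t: "(W, \<Phi>) \<in> trivs A" "p \<in> W" using pre_bundleD(5)[OF preA p] by blast
  obtain V a where a: "atlas_open M V" "p \<in> V" "V \<subseteq> W" "\<And>g k. a g k \<in> affine_functions M A"
    "\<And>g k x. x \<in> total_space A \<Longrightarrow> proj A x \<in> V \<Longrightarrow> a g k x = g \<bullet> \<Phi> x + k" by (rule affine_frame[OF t]) (rule that)
  obtain g k where "\<And>x. x \<in> fibre A p \<Longrightarrow> \<alpha> x = g \<bullet> \<Phi> x + k" using \<alpha> unfolding affine_on_fibre_iff[OF t] by blast
  then show ?thesis using that[OF a(4)[of g k]] a(2,5) by (simp add: fibre_def)
qed

lemma anchor_section:
  assumes s: "s \<in> sections M (Aplus M A)" and p: "p \<in> points M"
  shows "anchor (s p) = rho s p"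
proof -
  obtain a where a: "a \<in> affine_functions M A" "s = tilde M A a" using sectionE[OF s] by metis
  have "s p = (p, \<lambda>x. if x \<in> fibre A p then a x else 0)" using p by (simp add: a(2) tilde_def)
  then show ?thesis using anchor_eq[OF a(1) p, of "\<lambda>x. if x \<in> fibre A p then a x else 0"] a(2) by simp
qed

text \<open>Sums and multiples of global extensions extend the sums and multiples of the given
  vectors, so linearity is inherited from \<open>anchor_form\<close> in its first argument.\<close>

lemma anchor_fibre_linear:
  assumes p: "p \<in> points M" and v: "v \<in> fibre (Aplus M A) p"
  shows "w \<in> fibre (Aplus M A) p \<Longrightarrow> anchor (vadd (Aplus M A) v w) = vadd (tangent_bundle M) (anchor v) (anchor w)"
    and "anchor (vscale (Aplus M A) r v) = vscale (tangent_bundle M) r (anchor v)"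
    and "anchor v \<in> {p} \<times> tangent_space M p"
proof -
  obtain \<alpha> where \<alpha>: "v = (p, \<alpha>)" "affine_on_fibre A p \<alpha>" using v p by (auto simp: fibre_Aplus)
  obtain a where a: "a \<in> affine_functions M A" "\<And>x. x \<in> fibre A p \<Longrightarrow> a x = \<alpha> x" by (rule affine_extension[OF p \<alpha>(2)]) (rule that)
  have av: "anchor v = rho (tilde M A a) p" unfolding \<alpha>(1) by (rule anchor_eq[OF a(1) p a(2)])
  have eta: "rho (tilde M A a) p = (p, snd (rho (tilde M A a) p))" if "a \<in> affine_functions M A" for a
    using rho_tilde(1)[OF that p] by (simp add: prod_eq_iff)
  show "anchor v \<in> {p} \<times> tangent_space M p" using rho_tilde(1,2)[OF a(1) p] unfolding av by (simp add: mem_Times_iff)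
  show "anchor (vscale (Aplus M A) r v) = vscale (tangent_bundle M) r (anchor v)"
  proof -
    have "vscale (Aplus M A) r v = (p, \<lambda>x. r * \<alpha> x)" by (simp add: Aplus_def \<alpha>(1))
    then have "anchor (vscale (Aplus M A) r v) = rho (tilde M A (\<lambda>x. r * a x)) p"
      using anchor_eq[OF affine_functions_scale[OF a(1), of r] p] a(2) by simp
    also have "\<dots> = (p, \<lambda>c. r *\<^sub>R snd (rho (tilde M A a) p) c)"
    proof (rule rho_tilde_eqI[OF affine_functions_scale[OF a(1)] p tangent_space_scale[OF M rho_tilde(2)[OF a(1) p]]])
      fix f x assume f: "f \<in> smooth_functions M" and x: "x \<in> fibre A p"
      then have "x \<in> total_space A" by (simp add: fibre_def)
      then show "differential M f p (\<lambda>c. r *\<^sub>R snd (rho (tilde M A a) p) c) = anchor_form (\<lambda>x. r * a x) f x"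
        by (simp add: differential_vector_scale[OF M f p rho_tilde(2)[OF a(1) p]] rho_tilde(3)[OF a(1) p f x]
            anchor_form_scale[OF affine_functionsD(1)[OF a(1)] f])
    qed
    also have "\<dots> = vscale (tangent_bundle M) r (p, snd (rho (tilde M A a) p))" by (simp add: tangent_bundle_def)
    finally show ?thesis unfolding av eta[OF a(1), symmetric] .
  qed
  assume w: "w \<in> fibre (Aplus M A) p"
  obtain \<beta> where \<beta>: "w = (p, \<beta>)" "affine_on_fibre A p \<beta>" using w p by (auto simp: fibre_Aplus)
  obtain b where b: "b \<in> affine_functions M A" "\<And>x. x \<in> fibre A p \<Longrightarrow> b x = \<beta> x" by (rule affine_extension[OF p \<beta>(2)]) (rule that)
  have bw: "anchor w = rho (tilde M A b) p" unfolding \<beta>(1) by (rule anchor_eq[OF b(1) p b(2)])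
  show "anchor (vadd (Aplus M A) v w) = vadd (tangent_bundle M) (anchor v) (anchor w)"
  proof -
    have "vadd (Aplus M A) v w = (p, \<lambda>x. \<alpha> x + \<beta> x)" by (simp add: Aplus_def \<alpha>(1) \<beta>(1))
    then have "anchor (vadd (Aplus M A) v w) = rho (tilde M A (\<lambda>x. a x + b x)) p"
      using anchor_eq[OF affine_functions_add[OF a(1) b(1)] p] a(2) b(2) by simp
    also have "\<dots> = (p, \<lambda>c. snd (rho (tilde M A a) p) c + snd (rho (tilde M A b) p) c)"
    proof (rule rho_tilde_eqI[OF affine_functions_add[OF a(1) b(1)] p tangent_space_add[OF M rho_tilde(2)[OF a(1) p] rho_tilde(2)[OF b(1) p]]])
      fix f x assume f: "f \<in> smooth_functions M" and x: "x \<in> fibre A p"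
      then have "x \<in> total_space A" by (simp add: fibre_def)
      then show "differential M f p (\<lambda>c. snd (rho (tilde M A a) p) c + snd (rho (tilde M A b) p) c) = anchor_form (\<lambda>x. a x + b x) f x"
        by (simp add: differential_vector_add[OF M f p rho_tilde(2)[OF a(1) p] rho_tilde(2)[OF b(1) p]]
            rho_tilde(3)[OF a(1) p f x] rho_tilde(3)[OF b(1) p f x]
            anchor_form_add[OF affine_functionsD(1)[OF a(1)] affine_functionsD(1)[OF b(1)] f])
    qed
    also have "\<dots> = vadd (tangent_bundle M) (p, snd (rho (tilde M A a) p)) (p, snd (rho (tilde M A b) p))" by (simp add: tangent_bundle_def)
    finally show ?thesis unfolding av bw eta[OF a(1), symmetric] eta[OF b(1), symmetric] .
  qed
qed

text \<open>Over a small set the vector with coordinates \<open>(g, k)\<close> is a combination,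
  with coefficients \<open>g \<bullet> i\<close> and \<open>k\<close>, of the affine frame
  functions. By fibrewise linearity the components of its anchor are bilinear in these coefficients
  and in the anchor forms of the frame functions, and the latter are smooth functions on
  \<open>M\<close>.\<close>

lemma anchor_smooth: "smooth_map (total_atlas M (Aplus M A)) (total_atlas M (tangent_bundle M)) anchor"
proof (rule smooth_mapI[OF pre_atlas_total_atlas[OF preAplus] pre_atlas_total_atlas[OF pre_bundle_tangent_bundle[OF M]]])
  have fib: "z \<in> fibre (Aplus M A) (fst z)" "fst z \<in> points M" if "z \<in> total_space (Aplus M A)" for z
    using that by (auto simp: fibre_def Aplus_def)
  have pr: "proj (Aplus M A) = fst" "proj (tangent_bundle M) = fst" by (simp_all add: Aplus_def tangent_bundle_def)
  have anc: "anchor z \<in> total_space (tangent_bundle M)" "fst (anchor z) = fst z" if "z \<in> total_space (Aplus M A)" for z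
    using anchor_fibre_linear(3)[OF fib(2,1)[OF that]] fib(2)[OF that] by (auto simp: tangent_bundle_def)
  show "anchor z \<in> points (total_atlas M (tangent_bundle M))" if "z \<in> points (total_atlas M (Aplus M A))" for z
    using that anc(1) by (simp add: points_total_atlas[OF preAplus] points_total_atlas[OF pre_bundle_tangent_bundle[OF M]])
  fix C \<psi> C' \<psi>' assume "(C, \<psi>) \<in> total_atlas M (Aplus M A)" "(C', \<psi>') \<in> total_atlas M (tangent_bundle M)"
  from this(1) obtain U \<phi> W \<Phi>p where C: "(U, \<phi>) \<in> M" "(W, \<Phi>p) \<in> trivs (Aplus M A)"
    "C = {x \<in> total_space (Aplus M A). proj (Aplus M A) x \<in> U \<inter> W}" "\<psi> = (\<lambda>x. (\<phi> (proj (Aplus M A) x), \<Phi>p x))" by (rule total_atlasE)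
  from \<open>(C', \<psi>') \<in> total_atlas M (tangent_bundle M)\<close> obtain U' \<phi>' W' \<Phi>' where
    C': "(U', \<phi>') \<in> M" "(W', \<Phi>') \<in> trivs (tangent_bundle M)"
    "C' = {x \<in> total_space (tangent_bundle M). proj (tangent_bundle M) x \<in> U' \<inter> W'}"
    "\<psi>' = (\<lambda>x. (\<phi>' (proj (tangent_bundle M) x), \<Phi>' x))" by (rule total_atlasE)
  obtain \<Phi> where t: "(W, \<Phi>) \<in> trivs A" "\<Phi>p = plus_triv \<Phi>" using C(2) by (auto simp: trivs_Aplus)
  obtain c where c: "c \<in> M" "W' = fst c" "\<Phi>' = (\<lambda>(p, v). v c)" using C'(2) by (auto simp: tangent_bundle_def)
  have c': "(fst c, snd c) \<in> M" using c by simp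
  let ?Q = "U \<inter> W \<inter> (U' \<inter> fst c)"
  have eq: "C \<inter> anchor -` C' = {x \<in> total_space (Aplus M A). proj (Aplus M A) x \<in> ?Q}"
    using anc by (auto simp: C(3) C'(3) pr c(2))
  have "?Q \<subseteq> W" by auto
  from triv_image[OF preAplus C(2) this, of \<phi>] have im: "\<psi> ` (C \<inter> anchor -` C') = \<phi> ` ?Q \<times> UNIV"
    unfolding eq C(4) .
  have Q': "atlas_open M (W \<inter> (U' \<inter> fst c))"
    by (intro atlas_open_Int[OF preM] pre_bundleD(3)[OF preA t(1)] chart_domain_open[OF M C'(1)] chart_domain_open[OF M c'])
  have "?Q = W \<inter> (U' \<inter> fst c) \<inter> U" by auto
  then have oQ: "open (\<phi> ` ?Q)" using atlas_openD(1)[OF Q' C(1)] by simp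
  show "open (\<psi> ` (C \<inter> anchor -` C'))" unfolding im by (intro open_Times oQ open_UNIV)
  note inj = pre_atlasD(1)[OF preM C(1)]
  obtain B :: "'e set" where B: "orthonormal_basis B" by (rule finite_dimensional_orthonormal_basis[OF fd_e])
  show "smooth_on (\<psi> ` (C \<inter> anchor -` C')) (\<psi>' \<circ> anchor \<circ> inv_into C \<psi>)"
    unfolding im
  proof (rule smooth_on_local)
    fix z0 :: "'e \<times> ('f \<times> real)" assume "z0 \<in> \<phi> ` ?Q \<times> UNIV"
    then obtain p w0 where p: "z0 = (\<phi> p, w0)" "p \<in> U" "p \<in> W" "p \<in> U'" "p \<in> fst c" by auto
    obtain V a where a: "atlas_open M V" "p \<in> V" "V \<subseteq> W" "\<And>g k. a g k \<in> affine_functions M A"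
      "\<And>g k x. x \<in> total_space A \<Longrightarrow> proj A x \<in> V \<Longrightarrow> a g k x = g \<bullet> \<Phi> x + k" by (rule affine_frame[OF t(1) p(3)]) (rule that)
    obtain V' F where F: "atlas_open M V'" "p \<in> V'" "V' \<subseteq> fst c" "\<And>b. F b \<in> smooth_functions M"
      "\<And>b q. q \<in> V' \<Longrightarrow> F b q = b \<bullet> snd c q" by (rule chart_coordinate_functions[OF M c(1) p(5)]) (rule that)
    \<comment> \<open>The anchor form of each frame function against each cut-off coordinate is
      basic, hence the pullback of a smooth function on \<open>M\<close>; these functions are then
      collected into one family \<open>h\<close>.\<close>
    have "\<exists>h. h \<in> smooth_functions M \<and> (\<forall>x\<in>total_space A. anchor_form (a g k) (F b) x = h (proj A x))" for g k b
    proof -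
      have "\<exists>h\<in>smooth_functions M. \<forall>x\<in>total_space A. anchor_form (a g k) (F b) x = h (proj A x)"
        by (rule smooth_functions_descend[OF preA affine_functionsD(1)[OF anchor_form_affine[OF a(4) F(4)]]])
          (rule anchor_form_fibre_constant[OF a(4) F(4)])
      then show ?thesis by blast
    qed
    then obtain h where h: "\<And>g k b. h g k b \<in> smooth_functions M"
      "\<And>g k b x. x \<in> total_space A \<Longrightarrow> anchor_form (a g k) (F b) x = h g k b (proj A x)" by metis
    define Q where "Q = V \<inter> V' \<inter> ?Q"
    have "Q = (V \<inter> V') \<inter> (W \<inter> (U' \<inter> fst c)) \<inter> U" by (auto simp: Q_def)
    then have o: "open (\<phi> ` Q)"
      using atlas_openD(1)[OF atlas_open_Int[OF preM atlas_open_Int[OF preM a(1) F(1)] Q'] C(1)] by simp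
    let ?S = "\<phi> ` Q \<times> (UNIV :: ('f \<times> real) set)"
    have oS: "open ?S" by (intro open_Times o open_UNIV)
    have lift: "smooth_on ?S (\<lambda>z. f (fst z))" if "smooth_on (\<phi> ` Q) f" for f :: "'e \<Rightarrow> 'a::real_normed_vector"
      by (rule smooth_on_compose[OF fd_e oS o smooth_on_bounded_linear[OF bounded_linear_fst] that]) auto
    have sh: "smooth_on ?S (\<lambda>z. (h g k b \<circ> inv_into U \<phi>) (fst z))" for g k b
      by (rule lift[OF smooth_on_subset[OF smooth_functionsD[OF preM h(1) C(1)]]]) (auto simp: Q_def)
    have sg: "smooth_on ?S (\<lambda>z. fst (snd z))" "smooth_on ?S (\<lambda>z. snd (snd z))"
      by (intro smooth_on_bounded_linear bounded_linear_compose[OF bounded_linear_fst bounded_linear_snd]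
          bounded_linear_compose[OF bounded_linear_snd bounded_linear_snd])+
    \<comment> \<open>The component along \<open>b\<close> of the anchor at the point with
      coordinates z: linear in the fibre coordinates, with coefficients that depend smoothly on the
      base point.\<close>
    define r where "r b z = (\<Sum>i\<in>Basis. (fst (snd z) \<bullet> i) * (h i 0 b \<circ> inv_into U \<phi>) (fst z)) +
        snd (snd z) * (h 0 1 b \<circ> inv_into U \<phi>) (fst z)" for b and z :: "'e \<times> ('f \<times> real)"
    have sr: "smooth_on ?S (r b)" for b
      unfolding r_def[abs_def] by (intro smooth_on_add smooth_on_sum smooth_on_mult smooth_on_inner smooth_on_const oS finite_Basis sg sh)
    have st: "smooth_on ?S (\<lambda>z. (\<phi>' \<circ> inv_into U \<phi>) (fst z))"
      by (rule lift[OF smooth_on_subset[OF smooth_manifold_transition(2)[OF M C(1) C'(1)]]]) (auto simp: Q_def)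
    have "smooth_on ?S (\<lambda>z. ((\<phi>' \<circ> inv_into U \<phi>) (fst z), \<Sum>b\<in>B. r b z *\<^sub>R b))"
      by (intro smooth_on_Pair smooth_on_sum smooth_on_scaleR smooth_on_const oS st sr orthonormal_basisD(1)[OF B])
    then have "smooth_on ?S (\<psi>' \<circ> anchor \<circ> inv_into C \<psi>)"
    proof (rule smooth_on_transform[OF _ oS])
      fix z assume "z \<in> ?S"
      then obtain q g k where z: "z = (\<phi> q, (g, k))" and qQ: "q \<in> Q" by auto
      then have q: "q \<in> U" "q \<in> W" "q \<in> U'" "q \<in> fst c" "q \<in> V" "q \<in> V'" by (auto simp: Q_def)
      have qM: "q \<in> points M" by (rule triv_points[OF t(1) q(2)])
      obtain x where x: "x \<in> fibre A q" using fibre_nonempty[OF preA qM] by blast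
      then have x': "x \<in> total_space A" "proj A x = q" by (auto simp: fibre_def)
      define \<alpha> where "\<alpha> x = (if x \<in> fibre A q then g \<bullet> \<Phi> x + k else 0)" for x
      have "inv_into C \<psi> z = (q, \<alpha>)"
        unfolding z C(3,4) using total_chart_inv[OF preAplus C(2,1) q(1,2)] plus_triv_bij(2)[OF t(1) q(2)]
        by (simp add: t(2) \<alpha>_def[abs_def])
      \<comment> \<open>The fibre coordinates of \<open>z\<close> are frozen as constants, so that
        only homogeneity under real scalars is used. On the fibre over \<open>q\<close> this global
        affine function restricts to \<alpha>.\<close>
      moreover define b where "b = (\<lambda>x. (\<Sum>i\<in>Basis. (g \<bullet> i) * a i 0 x) + k * a 0 1 x)"
      have b: "b \<in> affine_functions M A" unfolding b_def
        by (intro affine_functions_add affine_functions_sum affine_functions_scale a(4) finite_Basis)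
      have "anchor (q, \<alpha>) = rho (tilde M A b) q"
      proof (rule anchor_eq[OF b qM])
        fix y assume y: "y \<in> fibre A q"
        then have y': "y \<in> total_space A" "proj A y \<in> V" using q by (auto simp: fibre_def)
        have "b y = (\<Sum>i\<in>Basis. (g \<bullet> i) * (i \<bullet> \<Phi> y)) + k" by (simp add: b_def a(5)[OF y'])
        also have "(\<Sum>i\<in>Basis. (g \<bullet> i) * (i \<bullet> \<Phi> y)) = g \<bullet> \<Phi> y"
          by (subst (2) euclidean_inner) (simp add: inner_commute)
        finally show "b y = \<alpha> y" using y by (simp add: \<alpha>_def)
      qed
      moreover have "snd (rho (tilde M A b) q) c = (\<Sum>b\<in>B. r b z *\<^sub>R b)"
      proof -
        let ?v = "snd (rho (tilde M A b) q)"
        note bs = affine_functionsD(1)[OF a(4)]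
        have "r e z = ?v c \<bullet> e" for e
        proof -
          have "e \<bullet> ?v c = differential M (F e) q ?v"
            by (rule coordinate_function_differential[OF M c(1) q(4) F(1) q(6) F(3) F(5) F(4) rho_tilde(2)[OF b qM], symmetric])
          also have "\<dots> = anchor_form b (F e) x" by (rule rho_tilde(3)[OF b qM F(4) x])
          also have "\<dots> = anchor_form (\<lambda>x. \<Sum>i\<in>Basis. (g \<bullet> i) * a i 0 x) (F e) x + anchor_form (\<lambda>x. k * a 0 1 x) (F e) x"
            unfolding b_def
            by (intro anchor_form_add F(4) x'(1) affine_functionsD(1) affine_functions_sum affine_functions_scale a(4) finite_Basis)
          also have "anchor_form (\<lambda>x. \<Sum>i\<in>Basis. (g \<bullet> i) * a i 0 x) (F e) x = (\<Sum>i\<in>Basis. anchor_form (\<lambda>x. (g \<bullet> i) * a i 0 x) (F e) x)"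
            by (intro anchor_form_sum_left F(4) x'(1) affine_functionsD(1) affine_functions_scale a(4) finite_Basis)
          also have "(\<Sum>i\<in>Basis. anchor_form (\<lambda>x. (g \<bullet> i) * a i 0 x) (F e) x) + anchor_form (\<lambda>x. k * a 0 1 x) (F e) x = r e z"
            by (simp add: anchor_form_scale[OF bs F(4) x'(1)] h(2)[OF x'(1)] x'(2) r_def z inj q(1))
          finally show ?thesis by (simp add: inner_commute)
        qed
        then show ?thesis using orthonormal_basisD(2)[OF B, of "?v c"] by simp
      qed
      ultimately show "((\<phi>' \<circ> inv_into U \<phi>) (fst z), \<Sum>b\<in>B. r b z *\<^sub>R b) = (\<psi>' \<circ> anchor \<circ> inv_into C \<psi>) z"
        using rho_tilde(1)[OF b qM] by (simp add: C'(4) pr c(3) z inj q(1) case_prod_unfold)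
    qed
    moreover have "z0 \<in> ?S" using p a(2) F(2) by (auto simp: Q_def)
    ultimately show "\<exists>T. open T \<and> z0 \<in> T \<and> smooth_on T (\<psi>' \<circ> anchor \<circ> inv_into C \<psi>)" using oS by blast
  qed
qed

section \<open>The Lie algebroid axioms\<close>

lemma lie_bracket_br: "lie_bracket_on_sections M (Aplus M A) br"
  unfolding lie_bracket_on_sections_def
proof (intro ballI conjI allI)
  let ?S = "\<lambda>a. a \<in> smooth_functions N"
  note sm = affine_functionsD(1)
  fix X Y assume "X \<in> sections M (Aplus M A)" "Y \<in> sections M (Aplus M A)"
  then obtain a b where a: "a \<in> affine_functions M A" "X = tilde M A a" and b: "b \<in> affine_functions M A" "Y = tilde M A b"
    by (metis sectionE)
  show "br X Y \<in> sections M (Aplus M A)" unfolding a(2) b(2) br_tilde[OF a(1) b(1)] by (rule tilde_in_sections[OF J_affine[OF a(1) b(1)]])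
  show "br X Y = sec_mult M (Aplus M A) (\<lambda>_. - 1) (br Y X)"
    unfolding a(2) b(2) br_tilde[OF a(1) b(1)] br_tilde[OF b(1) a(1)] sec_mult_tilde
    by (rule tilde_cong) (simp add: J_antisym[OF sm[OF a(1)] sm[OF b(1)]])
  \<comment> \<open>A constant is a basic function whose anchor form is zero, so the Leibniz rule
    leaves homogeneity only.\<close>
  have scale_right: "J a (\<lambda>x. r * b x) x = r * J a b x"
    if "a \<in> affine_functions M A" "b \<in> affine_functions M A" "x \<in> total_space A" for a b r x
    using J_leibniz[OF sm[OF that(1)] smooth_functions_const[OF preM] sm[OF that(2)] that(3), of r]
      anchor_form_const_zero[OF sm[OF that(1)] that(3), of r] by simp
  \<comment> \<open>Linearity in the left argument is obtained from the right one by antisymmetry,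
    here and for sums.\<close>
  have scale_left: "J (\<lambda>x. r * a x) b x = r * J a b x"
    if "a \<in> affine_functions M A" "b \<in> affine_functions M A" "x \<in> total_space A" for a b r x
    using J_antisym[OF sm[OF affine_functions_scale[OF that(1)]] sm[OF that(2)] that(3), of r]
      J_antisym[OF sm[OF that(1)] sm[OF that(2)] that(3)] scale_right[OF that(2,1,3), of r] by simp
  show "br (sec_mult M (Aplus M A) (\<lambda>_. r) X) Y = sec_mult M (Aplus M A) (\<lambda>_. r) (br X Y)" for r
    unfolding a(2) b(2) sec_mult_tilde br_tilde[OF a(1) b(1)] br_tilde[OF affine_functions_scale[OF a(1)] b(1)]
    by (rule tilde_cong) (rule scale_left[OF a(1) b(1)])
  show "br X (sec_mult M (Aplus M A) (\<lambda>_. r) Y) = sec_mult M (Aplus M A) (\<lambda>_. r) (br X Y)" for r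
    unfolding a(2) b(2) sec_mult_tilde br_tilde[OF a(1) b(1)] br_tilde[OF a(1) affine_functions_scale[OF b(1)]]
    by (rule tilde_cong) (rule scale_right[OF a(1) b(1)])
  fix Z assume "Z \<in> sections M (Aplus M A)"
  then obtain c where c: "c \<in> affine_functions M A" "Z = tilde M A c" by (metis sectionE)
  note add = J_add[OF sm sm sm]
  show "br Z (sec_add M (Aplus M A) X Y) = sec_add M (Aplus M A) (br Z X) (br Z Y)"
    unfolding a(2) b(2) c(2) sec_add_tilde br_tilde[OF c(1) affine_functions_add[OF a(1) b(1)]] br_tilde[OF c(1) a(1)] br_tilde[OF c(1) b(1)]
    by (rule tilde_cong) (rule add[OF c(1) a(1) b(1)])
  show "br (sec_add M (Aplus M A) X Y) Z = sec_add M (Aplus M A) (br X Z) (br Y Z)"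
    unfolding a(2) b(2) c(2) sec_add_tilde br_tilde[OF affine_functions_add[OF a(1) b(1)] c(1)] br_tilde[OF a(1) c(1)] br_tilde[OF b(1) c(1)]
  proof (rule tilde_cong)
    fix x assume x: "x \<in> total_space A"
    show "J (\<lambda>x. a x + b x) c x = J a c x + J b c x"
      using J_antisym[OF sm[OF affine_functions_add[OF a(1) b(1)]] sm[OF c(1)] x] add[OF c(1) a(1) b(1) x]
        J_antisym[OF sm[OF a(1)] sm[OF c(1)] x] J_antisym[OF sm[OF b(1)] sm[OF c(1)] x] by simp
  qed
  show "br X (br Y Z) = sec_add M (Aplus M A) (br (br X Y) Z) (br Y (br X Z))"
    unfolding a(2) b(2) c(2) br_tilde[OF b(1) c(1)] br_tilde[OF a(1) b(1)] br_tilde[OF a(1) c(1)]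
      br_tilde[OF a(1) J_affine[OF b(1) c(1)]] br_tilde[OF J_affine[OF a(1) b(1)] c(1)] br_tilde[OF b(1) J_affine[OF a(1) c(1)]] sec_add_tilde
  proof (rule tilde_cong)
    fix x assume x: "x \<in> total_space A"
    \<comment> \<open>The cyclic Jacobi identity contains the inner bracket of \<open>c\<close> with
      \<open>a\<close>, while the derivation form needs that of \<open>a\<close> with
      \<open>c\<close>. The two are negatives of each other on the total space only, hence
      congruence first and homogeneity afterwards.\<close>
    have "J b (J c a) x = J b (\<lambda>x. -1 * J a c x) x"
      by (rule J_cong[OF sm[OF b(1)] refl sm[OF J_affine[OF c(1) a(1)]] _ x]) (simp add: J_antisym[OF sm[OF c(1)] sm[OF a(1)]])
    also have "\<dots> = -1 * J b (J a c) x" by (rule scale_right[OF b(1) J_affine[OF a(1) c(1)] x])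
    finally have "J b (J c a) x = - J b (J a c) x" by simp
    then show "J a (J b c) x = J (J a b) c x + J b (J a c) x"
      using J_jacobi[OF sm[OF a(1)] sm[OF b(1)] sm[OF c(1)] x] J_antisym[OF sm[OF J_affine[OF a(1) b(1)]] sm[OF c(1)] x] by simp
  qed
qed

text \<open>Read through \<open>tilde\<close>, the algebroid Leibniz rule is the Leibniz rule of the
  Jacobi bracket, because the anchor of \<open>tilde M A a\<close> acts on \<open>f\<close> by
  \<open>anchor_form a f\<close>.\<close>

lemma lie_algebroid_plus: "lie_algebroid M (Aplus M A) br anchor"
  unfolding lie_algebroid_def
proof (intro conjI ballI is_vector_bundle_Aplus lie_bracket_br)
  show "vector_bundle_morphism M (Aplus M A) (tangent_bundle M) anchor"
    unfolding vector_bundle_morphism_def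
  proof (intro conjI ballI allI impI anchor_smooth)
    fix v assume "v \<in> total_space (Aplus M A)"
    then have "v \<in> fibre (Aplus M A) (fst v)" "fst v \<in> points M" by (auto simp: fibre_def Aplus_def)
    then show "proj (tangent_bundle M) (anchor v) = proj (Aplus M A) v"
      using anchor_fibre_linear(3)[of "fst v" v] by (auto simp: tangent_bundle_def Aplus_def)
  qed (simp_all add: anchor_fibre_linear)
  fix X Y f assume X: "X \<in> sections M (Aplus M A)" and Y: "Y \<in> sections M (Aplus M A)" and f: "f \<in> smooth_functions M"
  obtain a where a: "a \<in> affine_functions M A" "X = tilde M A a" using sectionE[OF X] by metis
  obtain b where b: "b \<in> affine_functions M A" "Y = tilde M A b" using sectionE[OF Y] by metis
  show "br X (sec_mult M (Aplus M A) f Y) =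
       sec_add M (Aplus M A) (sec_mult M (Aplus M A) f (br X Y)) (sec_mult M (Aplus M A) (vf_apply M (anchor \<circ> X) f) Y)"
    unfolding b(2) sec_mult_tilde unfolding a(2) br_tilde[OF a(1) b(1)] br_tilde[OF a(1) affine_functions_proj_mult[OF f b(1)]] sec_mult_tilde sec_add_tilde
  proof (rule tilde_cong)
    fix x assume x: "x \<in> total_space A"
    have p: "proj A x \<in> points M" by (rule pre_bundleD(2)[OF preA x])
    have "vf_apply M (anchor \<circ> tilde M A a) f (proj A x) = anchor_form a f x"
      using anchor_section[OF X p] rho_tilde(3)[OF a(1) p f, of x] x by (simp add: vf_apply_def a(2) fibre_def)
    then show "J a (\<lambda>x. f (proj A x) * b x) x = f (proj A x) * J a b x + vf_apply M (anchor \<circ> tilde M A a) f (proj A x) * b x"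
      using J_leibniz[OF affine_functionsD(1)[OF a(1)] f affine_functionsD(1)[OF b(1)] x] by simp
  qed
qed

lemma rho_eq_anchor:
  assumes s: "s \<in> sections M (Aplus M A)"
  shows "rho s = (\<lambda>p\<in>points M. anchor (s p))"
proof (rule extensionalityI)
  have "rho s \<in> vector_fields M" by (rule PiE_mem[OF plus_operationsD(2)[OF plus] s])
  then show "rho s \<in> extensional (points M)" unfolding sections_iff[OF pre_bundle_tangent_bundle[OF M]] by blast
qed (auto simp: anchor_section[OF s])

end

end

text \<open>The defining equations constrain the operations only through affine functions, so it is
  part of the claim that they determine exactly one pair. Since \<open>rho\<close> acts on sections
  while \<open>lie_algebroid\<close> expects a bundle map, the anchor is asserted to exist and to
  induce \<open>rho\<close> on every section.\<close>

theorem theorem3p3: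
  fixes M :: "('m, 'e::real_inner) atlas"
    and A :: "('x, 'm, 'f::euclidean_space, 'v) affine_bundle"
    and \<Lambda> :: "('x, 'e \<times> 'f) bivector_field"
    and E :: "'x \<Rightarrow> 'x \<times> ('x, 'e \<times> 'f) tangent"
  assumes "is_affine_bundle M A"
    and "affine_jacobi_structure M A \<Lambda> E"
  shows "(\<exists>!(br, rho). plus_operations M A \<Lambda> E br rho) \<and>
    (\<forall>br rho. plus_operations M A \<Lambda> E br rho \<longrightarrow>
      (\<exists>\<rho>. lie_algebroid M (Aplus M A) br \<rho> \<and>
           (\<forall>s\<in>sections M (Aplus M A). rho s = (\<lambda>p\<in>points M. \<rho> (s p)))))"
proof -
  interpret affine_jacobi_over M A \<Lambda> E by unfold_locales (rule assms)+
  obtain br rho where "plus_operations M A \<Lambda> E br rho" using plus_operations_exists by blast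
  then have "\<exists>!(br, rho). plus_operations M A \<Lambda> E br rho"
    using plus_operations_unique by (intro ex1I[of _ "(br, rho)"]) auto
  then show ?thesis using lie_algebroid_plus rho_eq_anchor by blast
qed

end
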